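(* Let $d\ge 1$, let $K\subset\mathbb{R}^d$ be an open bounded convex set symmetric with respect to the origin and containing the origin, and let $C\subset\mathbb{R}^d$ be a nonempty open convex cone. (i) Let $h>0$ and $\nu\in\mathfrak{N}^{1,\infty}_{K,h}(C)$. Then $D_\mu\nu\in L_\infty(C)$ and $$\|D_\mu\nu\|_{L_\infty(C)}\le \|D_\mu\nu-S_h\nu\|_{L_\infty(C)}+\|S_h\|\,\|\nu\|_{K,h}\le \frac{dh}{d+1}\big\||\nabla D_\mu\nu|_{K^\circ}\big\|_{L_\infty(C)}+\frac{\|\nu\|_{K,h}}{h^d\mu(K\cap C)},\qquad (1)$$ where $$S_h\nu(x)=\frac{\nu\big(x+(hK\cap C)\big)}{h^d\mu(K\cap C)},\quad x\in C,$$ and $\|S_h\|$ is the norm of $S_h$ as an operator from $(\mathfrak{N}_{K,h}(C),\|\cdot\|_{K,h})$ to $L_\infty(C)$. (ii) If $\nu\in\mathfrak{N}^{1,\infty}_{K}(C)$, then (1) holds for every $h>0$, and $$\|D_\mu\nu\|_{L_\infty(C)}\le\left(\frac{d+1}{\mu(K\cap C)}\right)^{\frac1{d+1}}\big\||\nabla D_\mu\nu|_{K^\circ}\big\|_{L_\infty(C)}^{\frac d{d+1}}\,\|\nu\|_K^{\frac1{d+1}}.\qquad (2)$$ (iii) Both inequalities are sharp: for every $h>0$, (1) (with this $h$) becomes an equality for the measure $$\nu_{e,h}(Q)=\int_Q (h-|x|_K)_+\,d\mu(x),\qquad Q\subset C \text{ Lebesgue measurable},$$ and (2) becomes an equality for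 $\nu_{e,h}$ with arbitrary $h>0$.
   Context: $\mu$ is Lebesgue measure on $\mathbb{R}^d$ and $(x,y)$ is the dot product. A cone is a set closed under multiplication by positive scalars. $\alpha_+=\max\{\alpha,0\}$. $|x|_K=\inf\{\lambda>0: x\in\lambda K\}$ is the norm generated by $K$; $K^\circ=\{y\in\mathbb{R}^d:\sup_{x\in K}(x,y)\le 1\}$ is the polar set, and $|z|_{K^\circ}=\sup\{(x,z):|x|_K\le1\}$ is the dual norm. $\mathfrak{N}(C)$ is the linear space of charges (finite real-valued signed measures) $\nu$ on the Lebesgue measurable subsets of $C$ that are absolutely continuous with respect to $\mu$; $D_\mu\nu\in L_1(C)$ is the Radon--Nikodym derivative of $\nu$, so that $\nu(Q)=\int_Q D_\mu\nu\,d\mu$. For $h>0$, $\|\nu\|_{K,h}=\|\nu(\cdot+(hK\cap C))\|_{L_\infty(C)}=\operatorname{ess\,sup}_{x\in C}|\nu(x+(hK\cap C))|$ (note $x+(hK\cap C)\subset C$ for $x\in C$), and $\|\nu\|_K=\sup_{h>0}\|\nu\|_{K,h}$. $W^{1,\infty}(C)$ is the space of functions $f:C\to\mathbb{R}$ such that $f$ and all its first-order distributional partial derivatives belong to $L_\infty(C)$; $\nabla$ is the distributional gradient. $\mathfrak{N}_K(C)$ (resp. $\mathfrak{N}_{K,h}(C)$) is the set of $\nu\in\mathfrak{N}(C)$ with $\|\nu\|_K<\infty$ (resp. $\|\nu\|_{K,h}<\infty$), and $\mathfrak{N}^{1,\infty}_K(C)$ (resp. $\mathfrak{N}^{1,\infty}_{K,h}(C)$)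 is the set of $\nu\in\mathfrak{N}_K(C)$ (resp. $\nu\in\mathfrak{N}_{K,h}(C)$) with $D_\mu\nu\in W^{1,\infty}(C)$. For a linear operator $A$ from a seminormed space $X$ to a normed space $Y$, $\|A\|=\sup_{\|x\|_X\le1}\|Ax\|_Y$. *)

theory Defs
  imports "HOL-Analysis.Analysis" "HOL-Probability.Essential_Supremum"
begin

text \<open>
  Only strictly positive factors are used, so open cones not containing the origin are
  allowed; the library's \<^const>\<open>cone\<close> and \<^const>\<open>conic\<close> force the origin into a
  nonempty cone.
\<close>

definition pos_cone :: "'a::real_vector set \<Rightarrow> bool" where
  "pos_cone C \<longleftrightarrow> (\<forall>x\<in>C. \<forall>t>0. t *\<^sub>R x \<in> C)"

definition body_norm :: "'a::real_vector set \<Rightarrow> 'a \<Rightarrow> real" where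
  "body_norm K x = Inf {l. 0 < l \<and> x \<in> (\<lambda>y. l *\<^sub>R y) ` K}"

definition dual_norm :: "'a::real_inner set \<Rightarrow> 'a \<Rightarrow> real" where
  "dual_norm K z = Sup {x \<bullet> z | x. body_norm K x \<le> 1}"


subsection \<open>Essentially bounded functions\<close>

text \<open>
  Functions on \<open>C\<close> are total functions whose values outside \<open>C\<close> are irrelevant.
  Norms take values in \<^typ>\<open>ennreal\<close>; \<^const>\<open>esssup\<close> is infinite on non-measurable functions.
\<close>

definition Linf_norm :: "'a::euclidean_space set \<Rightarrow> ('a \<Rightarrow> real) \<Rightarrow> ennreal" where
  "Linf_norm C f = esssup (lebesgue_on C) (\<lambda>x. ennreal \<bar>f x\<bar>)"

definition Linf :: "'a::euclidean_space set \<Rightarrow> ('a \<Rightarrow> real) set" where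
  "Linf C = {f. f \<in> borel_measurable (lebesgue_on C) \<and> Linf_norm C f < \<infinity>}"


subsection \<open>Distributional derivatives\<close>

primrec C_k :: "nat \<Rightarrow> ('a::euclidean_space \<Rightarrow> real) \<Rightarrow> bool" where
  "C_k 0 f \<longleftrightarrow> continuous_on UNIV f"
| "C_k (Suc k) f \<longleftrightarrow> (\<forall>x. f differentiable (at x)) \<and>
     (\<forall>i\<in>Basis. C_k k (\<lambda>x. frechet_derivative f (at x) i))"

definition test_functions :: "'a::euclidean_space set \<Rightarrow> ('a \<Rightarrow> real) set" where
  "test_functions C = {\<phi>. (\<forall>k. C_k k \<phi>) \<and>
     compact (closure {x. \<phi> x \<noteq> 0}) \<and> closure {x. \<phi> x \<noteq> 0} \<subseteq> C}"

definition locally_integrable :: "'a::euclidean_space set \<Rightarrow> ('a \<Rightarrow> real) \<Rightarrow> bool" where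
  "locally_integrable C f \<longleftrightarrow> (\<forall>B. compact B \<and> B \<subseteq> C \<longrightarrow> set_integrable lebesgue B f)"

definition weak_partial ::
    "'a::euclidean_space set \<Rightarrow> ('a \<Rightarrow> real) \<Rightarrow> 'a \<Rightarrow> ('a \<Rightarrow> real) \<Rightarrow> bool" where
  "weak_partial C f i g \<longleftrightarrow> locally_integrable C f \<and> locally_integrable C g \<and>
     (\<forall>\<phi>\<in>test_functions C.
        (LINT x:C|lebesgue. f x * frechet_derivative \<phi> (at x) i) =
        - (LINT x:C|lebesgue. g x * \<phi> x))"

definition weak_grad :: "'a::euclidean_space set \<Rightarrow> ('a \<Rightarrow> real) \<Rightarrow> 'a \<Rightarrow> 'a" where
  "weak_grad C f = (SOME g. \<forall>i\<in>Basis. weak_partial C f i (\<lambda>x. g x \<bullet> i))"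

definition W1inf :: "'a::euclidean_space set \<Rightarrow> ('a \<Rightarrow> real) set" where
  "W1inf C = {f \<in> Linf C. \<forall>i\<in>Basis. \<exists>g\<in>Linf C. weak_partial C f i g}"


subsection \<open>Charges\<close>

text \<open>
  For measurable \<open>C\<close>, \<^term>\<open>sets (lebesgue_on C)\<close> consists of the Lebesgue measurable
  subsets of \<open>C\<close>. Values of a charge on other sets are irrelevant.
\<close>

definition charge_on :: "'a::euclidean_space set \<Rightarrow> ('a set \<Rightarrow> real) \<Rightarrow> bool" where
  "charge_on C \<nu> \<longleftrightarrow> \<nu> {} = 0 \<and>
     (\<forall>A::nat \<Rightarrow> 'a set. range A \<subseteq> sets (lebesgue_on C) \<and> disjoint_family A
        \<longrightarrow> (\<lambda>n. \<nu> (A n)) sums \<nu> (\<Union>n. A n))"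

definition ac_charges :: "'a::euclidean_space set \<Rightarrow> ('a set \<Rightarrow> real) set" where
  "ac_charges C = {\<nu>. charge_on C \<nu> \<and>
     (\<forall>Q\<in>sets (lebesgue_on C). Q \<in> null_sets lebesgue \<longrightarrow> \<nu> Q = 0)}"

definition charge_deriv :: "'a::euclidean_space set \<Rightarrow> ('a set \<Rightarrow> real) \<Rightarrow> 'a \<Rightarrow> real" where
  "charge_deriv C \<nu> = (SOME f. integrable (lebesgue_on C) f \<and>
     (\<forall>Q\<in>sets (lebesgue_on C). \<nu> Q = (LINT x:Q|lebesgue. f x)))"

definition shifted_set :: "'a::real_vector set \<Rightarrow> 'a set \<Rightarrow> real \<Rightarrow> 'a \<Rightarrow> 'a set" where
  "shifted_set K C h x = (\<lambda>y. x + y) ` ((\<lambda>y. h *\<^sub>R y) ` K \<inter> C)"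

definition charge_norm_h ::
    "'a::euclidean_space set \<Rightarrow> 'a set \<Rightarrow> real \<Rightarrow> ('a set \<Rightarrow> real) \<Rightarrow> ennreal" where
  "charge_norm_h K C h \<nu> = Linf_norm C (\<lambda>x. \<nu> (shifted_set K C h x))"

definition charge_norm ::
    "'a::euclidean_space set \<Rightarrow> 'a set \<Rightarrow> ('a set \<Rightarrow> real) \<Rightarrow> ennreal" where
  "charge_norm K C \<nu> = (SUP h\<in>{0<..}. charge_norm_h K C h \<nu>)"

definition charges_K_h ::
    "'a::euclidean_space set \<Rightarrow> 'a set \<Rightarrow> real \<Rightarrow> ('a set \<Rightarrow> real) set" where
  "charges_K_h K C h = {\<nu> \<in> ac_charges C. charge_norm_h K C h \<nu> < \<infinity>}"

definition charges_K ::
    "'a::euclidean_space set \<Rightarrow> 'a set \<Rightarrow> ('a set \<Rightarrow> real) set" where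
  "charges_K K C = {\<nu> \<in> ac_charges C. charge_norm K C \<nu> < \<infinity>}"

definition charges1_K_h ::
    "'a::euclidean_space set \<Rightarrow> 'a set \<Rightarrow> real \<Rightarrow> ('a set \<Rightarrow> real) set" where
  "charges1_K_h K C h = {\<nu> \<in> charges_K_h K C h. charge_deriv C \<nu> \<in> W1inf C}"

definition charges1_K ::
    "'a::euclidean_space set \<Rightarrow> 'a set \<Rightarrow> ('a set \<Rightarrow> real) set" where
  "charges1_K K C = {\<nu> \<in> charges_K K C. charge_deriv C \<nu> \<in> W1inf C}"


subsection \<open>The averaging operator and the two bounds\<close>

definition S_op ::
    "'a::euclidean_space set \<Rightarrow> 'a set \<Rightarrow> real \<Rightarrow> ('a set \<Rightarrow> real) \<Rightarrow> 'a \<Rightarrow> real" where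
  "S_op K C h \<nu> x = \<nu> (shifted_set K C h x) / (h ^ DIM('a) * measure lebesgue (K \<inter> C))"

definition operator_norm ::
    "'b set \<Rightarrow> ('b \<Rightarrow> ennreal) \<Rightarrow> ('c \<Rightarrow> ennreal) \<Rightarrow> ('b \<Rightarrow> 'c) \<Rightarrow> ennreal" where
  "operator_norm X p q A = (SUP x\<in>{x \<in> X. p x \<le> 1}. q (A x))"

definition S_op_norm :: "'a::euclidean_space set \<Rightarrow> 'a set \<Rightarrow> real \<Rightarrow> ennreal" where
  "S_op_norm K C h =
     operator_norm (charges_K_h K C h) (charge_norm_h K C h) (Linf_norm C) (S_op K C h)"

definition grad_norm ::
    "'a::euclidean_space set \<Rightarrow> 'a set \<Rightarrow> ('a set \<Rightarrow> real) \<Rightarrow> ennreal" where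
  "grad_norm K C \<nu> = Linf_norm C (\<lambda>x. dual_norm K (weak_grad C (charge_deriv C \<nu>) x))"

definition additive_mid ::
    "'a::euclidean_space set \<Rightarrow> 'a set \<Rightarrow> real \<Rightarrow> ('a set \<Rightarrow> real) \<Rightarrow> ennreal" where
  "additive_mid K C h \<nu> =
     Linf_norm C (\<lambda>x. charge_deriv C \<nu> x - S_op K C h \<nu> x)
       + S_op_norm K C h * charge_norm_h K C h \<nu>"

definition additive_bound ::
    "'a::euclidean_space set \<Rightarrow> 'a set \<Rightarrow> real \<Rightarrow> ('a set \<Rightarrow> real) \<Rightarrow> ennreal" where
  "additive_bound K C h \<nu> =
     ennreal (real DIM('a) * h / (real DIM('a) + 1)) * grad_norm K C \<nu>
       + charge_norm_h K C h \<nu> / ennreal (h ^ DIM('a) * measure lebesgue (K \<inter> C))"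

text \<open>
  The multiplicative bound is meant for members of \<^const>\<open>charges1_K\<close>, for which both norms
  converted by \<^const>\<open>enn2real\<close> are finite.
\<close>

definition multiplicative_bound ::
    "'a::euclidean_space set \<Rightarrow> 'a set \<Rightarrow> ('a set \<Rightarrow> real) \<Rightarrow> ennreal" where
  "multiplicative_bound K C \<nu> =
     (let d = real DIM('a) in
      ennreal (((d + 1) / measure lebesgue (K \<inter> C)) powr (1 / (d + 1))
        * enn2real (grad_norm K C \<nu>) powr (d / (d + 1))
        * enn2real (charge_norm K C \<nu>) powr (1 / (d + 1))))"

definition extremal_charge ::
    "'a::euclidean_space set \<Rightarrow> real \<Rightarrow> 'a set \<Rightarrow> real" where
  "extremal_charge K h Q = (LINT x:Q|lebesgue. max (h - body_norm K x) 0)"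

end

theory Submission
  imports Defs
begin

text \<open>
  Write \<open>|x|\<close> for the norm generated by \<open>K\<close>, \<open>d\<close> for the dimension, \<open>m\<close> for the measure of
  \<open>K \<inter> C\<close>, and \<open>f\<close> for the derivative of the charge \<open>\<nu>\<close>.

  The average \<open>S\<^sub>h \<nu> (x)\<close> is the mean of \<open>f (x + y)\<close> over the truncated cone
  \<open>{y \<in> C. |y| < h}\<close>, which has measure \<open>h\<^sup>d m\<close>.  If the dual norm of the weak gradient is at most
  \<open>G\<close>, then \<open>|f (x + y) - f x| \<le> G |y|\<close> for every \<open>y \<in> C\<close> and almost every \<open>x \<in> C\<close>
  (\<open>increment_bound\<close>).  Integrating over \<open>y\<close>, and using that the mean of \<open>|y|\<close> over the truncated
  cone is \<open>d h / (d + 1)\<close> (\<open>sector_integral\<close>), gives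
  \<open>|f - S\<^sub>h \<nu>| \<le> d h G / (d + 1)\<close> almost everywhere (\<open>average_deviation\<close>).  Since \<open>S\<^sub>h \<nu>\<close> is
  \<open>\<nu>\<close> of a shifted set divided by \<open>h\<^sup>d m\<close>, its norm is at most that of \<open>\<nu>\<close> divided by
  \<open>h\<^sup>d m\<close>, and the triangle inequality yields the additive estimate.  The multiplicative estimate is
  the infimum of the additive one over \<open>h\<close> (\<open>optimize_additive_bound\<close>).

  The increment bound is proved by duality.  For a nonnegative test function \<open>\<phi>\<close> with support in
  \<open>C\<close> the function \<open>t \<mapsto> \<integral> f(x) \<phi>(x - t y) dx\<close> is differentiable, and since the translated
  test functions are still supported in \<open>C\<close>, the definition of the weak gradient bounds its
  derivative by \<open>G |y| \<integral> \<phi>\<close>; the mean value theorem bounds the increment from 0 to 1.  An inequality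
  that holds against all nonnegative test functions holds almost everywhere (\<open>AE_le_if_tested\<close>): box
  indicators are limits of test functions, and the Lebesgue differentiation theorem does the rest.

  For sharpness, the extremal charge has the density \<open>max (h - |x|) 0\<close>.  It is Lipschitz with
  constant 1 with respect to \<open>|x|\<close>, so the dual norm of its weak gradient is at most 1; all its
  values on shifted sets are at most the total mass \<open>m h\<^bsup>d+1\<^esup> / (d + 1)\<close>; its essential supremum is at
  least \<open>h\<close>.  With these three estimates both right-hand sides are at most \<open>h\<close>, while the left-hand
  side is at least \<open>h\<close>, so equality holds throughout.

  Two ingredients relate the definitions to this argument: a charge has a density because its Hahn
  decomposition reduces the Radon--Nikodym theorem to positive measures, and the density of the
  extremal charge has weak derivatives because it is a difference of two convex functions, whose
  difference quotients converge.
\<close>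

section \<open>The norm generated by a convex body\<close>

locale symmetric_body =
  fixes K :: "'a::euclidean_space set"
  assumes open_K: "open K" and bounded_K: "bounded K" and convex_K: "convex K"
    and symmetric_K: "x \<in> K \<Longrightarrow> - x \<in> K" and zero_in_K: "0 \<in> K"
begin

abbreviation "p \<equiv> body_norm K"

lemma dilate_iff: "l > 0 \<Longrightarrow> x \<in> (\<lambda>y. l *\<^sub>R y) ` K \<longleftrightarrow> x /\<^sub>R l \<in> K"
  by (force simp: image_iff)

lemma body_norm_eq: "p x = Inf {l. 0 < l \<and> x /\<^sub>R l \<in> K}"
  unfolding body_norm_def by (rule arg_cong[where f=Inf]) (auto simp: dilate_iff)

lemma inner_ball: obtains r where "r > 0" "\<And>x l. l > 0 \<Longrightarrow> norm x < r * l \<Longrightarrow> x /\<^sub>R l \<in> K"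
proof -
  obtain r where r: "r > 0" "ball 0 r \<subseteq> K"
    using open_K zero_in_K openE by blast
  have "x /\<^sub>R l \<in> K" if "l > 0" "norm x < r * l" for x l
    using that r by (intro subsetD[OF r(2)]) (simp add: field_simps)
  with r(1) show ?thesis using that by blast
qed

lemma dilate_factors_nonempty: "{l. 0 < l \<and> x /\<^sub>R l \<in> K} \<noteq> {}"
proof -
  obtain r where r: "r > 0" "\<And>x l. l > 0 \<Longrightarrow> norm x < r * l \<Longrightarrow> x /\<^sub>R l \<in> K"
    using inner_ball by blast
  have "norm x < r * ((norm x + 1) / r)" using r by simp
  moreover have "(norm x + 1) / r > 0" using r(1) by (simp add: add_nonneg_pos)
  ultimately have "(norm x + 1) / r \<in> {l. 0 < l \<and> x /\<^sub>R l \<in> K}" using r(2) by blast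
  then show ?thesis by blast
qed

lemma dilate_factors_bdd: "bdd_below {l. 0 < l \<and> x /\<^sub>R l \<in> K}"
  by (rule bdd_belowI[of _ 0]) auto

lemma body_norm_nonneg: "0 \<le> p x"
  unfolding body_norm_eq using dilate_factors_nonempty by (intro cInf_greatest) auto

lemma dilate_mono: 
  assumes "0 < l" "l \<le> l'" "x /\<^sub>R l \<in> K" shows "x /\<^sub>R l' \<in> K"
proof -
  have "(1 - l / l') *\<^sub>R 0 + (l / l') *\<^sub>R (x /\<^sub>R l) \<in> K"
    using assms zero_in_K by (intro convexD[OF convex_K]) auto
  then show ?thesis using assms by (simp add: field_simps)
qed

text \<open>Openness of the body makes the sublevel sets strict.\<close>

lemma body_norm_less_iff: 
  assumes h: "h > 0" shows "p x < h \<longleftrightarrow> x /\<^sub>R h \<in> K"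
proof
  assume "p x < h"
  then obtain l where "0 < l" "x /\<^sub>R l \<in> K" "l < h"
    unfolding body_norm_eq using cInf_less_iff[OF dilate_factors_nonempty dilate_factors_bdd] by auto
  then show "x /\<^sub>R h \<in> K" using dilate_mono[of l h x] by auto
next
  assume x: "x /\<^sub>R h \<in> K"
  have "((\<lambda>l. x /\<^sub>R l) \<longlongrightarrow> x /\<^sub>R h) (at_left h)"
    using h by (intro tendsto_intros) auto
  then have "\<forall>\<^sub>F l in at_left h. x /\<^sub>R l \<in> K"
    using open_K x topological_tendstoD by blast
  moreover have "\<forall>\<^sub>F l in at_left h. 0 < l \<and> l < h"
    using eventually_at_left_field h by (auto simp: eventually_at_left_field intro!: exI[of _ 0])
  ultimately have "\<forall>\<^sub>F l in at_left h. 0 < l \<and> l < h \<and> x /\<^sub>R l \<in> K"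
    by eventually_elim auto
  then obtain l where "0 < l \<and> l < h \<and> x /\<^sub>R l \<in> K"
    using eventually_happens[of _ "at_left h"] by (auto simp: trivial_limit_at_left_real)
  then show "p x < h"
    unfolding body_norm_eq using cInf_lower[OF _ dilate_factors_bdd, of l x] by fastforce
qed

lemma in_dilate_iff: "h > 0 \<Longrightarrow> x \<in> (\<lambda>y. h *\<^sub>R y) ` K \<longleftrightarrow> p x < h"
  by (simp add: dilate_iff body_norm_less_iff)

lemma body_norm_scale: assumes "t > 0" shows "p (t *\<^sub>R x) = t * p x"
proof -
  have *: "p (s *\<^sub>R y) \<le> s * p y" if "s > 0" for s y
  proof (rule field_le_epsilon)
    fix e :: real assume e: "e > 0"
    have "p y < p y + e / s" using e that by simp
    moreover have pos: "p y + e / s > 0" using body_norm_nonneg[of y] e that by (simp add: add_nonneg_pos)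
    ultimately have "y /\<^sub>R (p y + e / s) \<in> K" using body_norm_less_iff by blast
    moreover have "(s *\<^sub>R y) /\<^sub>R (s * (p y + e / s)) = y /\<^sub>R (p y + e / s)" using that by simp
    ultimately have "(s *\<^sub>R y) /\<^sub>R (s * (p y + e / s)) \<in> K" by metis
    then have "p (s *\<^sub>R y) < s * (p y + e / s)"
      using body_norm_less_iff[of "s * (p y + e / s)"] pos that by simp
    then show "p (s *\<^sub>R y) \<le> s * p y + e" using that by (simp add: algebra_simps)
  qed
  have "p x \<le> inverse t * p (t *\<^sub>R x)" using *[of "inverse t" "t *\<^sub>R x"] assms by simp
  with *[of t x] assms show ?thesis by (simp add: field_simps)
qed

lemma body_norm_zero: "p 0 = 0"
  using body_norm_scale[of 2 0] by simp

lemma body_norm_triangle: "p (x + y) \<le> p x + p y"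
proof (rule field_le_epsilon)
  fix e :: real assume e: "e > 0"
  define a b where "a = p x + e / 2" and "b = p y + e / 2"
  have a: "a > 0" "x /\<^sub>R a \<in> K" and b: "b > 0" "y /\<^sub>R b \<in> K"
    using e body_norm_nonneg[of x] body_norm_nonneg[of y] body_norm_less_iff[of a x] body_norm_less_iff[of b y]
    by (auto simp: a_def b_def)
  have "(a / (a + b)) *\<^sub>R (x /\<^sub>R a) + (b / (a + b)) *\<^sub>R (y /\<^sub>R b) \<in> K"
    using a b by (intro convexD[OF convex_K]) (auto simp: add_divide_distrib[symmetric])
  also have "(a / (a + b)) *\<^sub>R (x /\<^sub>R a) + (b / (a + b)) *\<^sub>R (y /\<^sub>R b) = (x + y) /\<^sub>R (a + b)"
  proof -
    have "a / (a + b) * inverse a = inverse (a + b)" "b / (a + b) * inverse b = inverse (a + b)"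
      using a b by (simp_all add: field_simps)
    then show ?thesis by (simp add: scaleR_add_right)
  qed
  finally have "p (x + y) < a + b" using a b by (simp add: body_norm_less_iff)
  then show "p (x + y) \<le> p x + p y + e" by (simp add: a_def b_def)
qed

lemma body_norm_minus: "p (- x) = p x"
proof -
  have "{l. 0 < l \<and> (- x) /\<^sub>R l \<in> K} = {l. 0 < l \<and> x /\<^sub>R l \<in> K}"
    using symmetric_K by fastforce
  then show ?thesis by (simp add: body_norm_eq)
qed

lemma body_norm_diff: "\<bar>p x - p y\<bar> \<le> p (x - y)"
  using body_norm_triangle[of "x - y" y] body_norm_triangle[of "y - x" x] body_norm_minus[of "x - y"] by simp

lemma body_norm_le_norm: obtains B where "B > 0" "\<And>x. p x \<le> B * norm x"
proof -
  obtain r where r: "r > 0" "\<And>x l. l > 0 \<Longrightarrow> norm x < r * l \<Longrightarrow> x /\<^sub>R l \<in> K"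
    using inner_ball by blast
  have "p x \<le> (1 / r) * norm x" for x
  proof (rule field_le_epsilon)
    fix e :: real assume e: "e > 0"
    have "x /\<^sub>R (norm x / r + e) \<in> K"
      using e r(1) by (intro r(2)) (auto simp: add_nonneg_pos field_simps)
    then show "p x \<le> (1 / r) * norm x + e"
      using body_norm_less_iff[of "norm x / r + e" x] e r(1) by (simp add: add_nonneg_pos)
  qed
  then show ?thesis using r(1) that[of "1/r"] by simp
qed

lemma norm_le_body_norm: obtains B where "B > 0" "\<And>x. norm x \<le> B * p x"
proof -
  obtain R where R: "R > 0" "\<And>x. x \<in> K \<Longrightarrow> norm x \<le> R"
    using bounded_K bounded_pos by blast
  have "norm x \<le> R * p x" for x
  proof (rule field_le_epsilon)
    fix e :: real assume e: "e > 0"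
    have pos: "p x + e / R > 0" using e R(1) body_norm_nonneg[of x] by (simp add: add_nonneg_pos)
    then have "x /\<^sub>R (p x + e / R) \<in> K"
      using e R(1) by (subst body_norm_less_iff[symmetric]) auto
    from R(2)[OF this] pos have "norm x \<le> R * (p x + e / R)" by (simp add: field_simps)
    then show "norm x \<le> R * p x + e" using R(1) by (simp add: algebra_simps)
  qed
  then show ?thesis using R(1) that[of R] by simp
qed

lemma continuous_on_body_norm: "continuous_on S p"
proof -
  obtain B where B: "B > 0" "\<And>x. p x \<le> B * norm x" using body_norm_le_norm by blast
  have "B-lipschitz_on S p"
    using B body_norm_diff by (intro lipschitz_onI) (auto simp: dist_real_def dist_norm intro: order_trans)
  then show ?thesis by (rule lipschitz_on_continuous_on)
qed

lemma borel_measurable_body_norm [measurable]: "p \<in> borel_measurable borel"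
  by (intro borel_measurable_continuous_onI continuous_on_body_norm)


subsection \<open>The dual norm\<close>

lemma dual_norm_set_bdd: "bdd_above {x \<bullet> z | x. p x \<le> 1}"
proof -
  obtain B where B: "B > 0" "\<And>x. norm x \<le> B * p x" using norm_le_body_norm by blast
  have "x \<bullet> z \<le> B * norm z" if "p x \<le> 1" for x
  proof -
    have "x \<bullet> z \<le> norm x * norm z" by (rule norm_cauchy_schwarz)
    also have "norm x \<le> B" using B(2)[of x] that B(1) mult_left_le[of "p x" B] by linarith
    finally show ?thesis by (simp add: mult_right_mono)
  qed
  then show ?thesis by (intro bdd_aboveI[of _ "B * norm z"]) auto
qed

lemma dual_norm_le_iff:
  assumes "0 \<le> G" shows "dual_norm K z \<le> G \<longleftrightarrow> (\<forall>x. x \<bullet> z \<le> G * p x)"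
proof
  assume G: "dual_norm K z \<le> G"
  obtain B where B: "B > 0" "\<And>x. norm x \<le> B * p x" using norm_le_body_norm by blast
  show "\<forall>x. x \<bullet> z \<le> G * p x"
  proof
    fix x
    show "x \<bullet> z \<le> G * p x"
    proof (cases "p x = 0")
      case True
      then show ?thesis using B(2)[of x] by simp
    next
      case False
      then have pos: "p x > 0" using body_norm_nonneg[of x] by simp
      have "(x /\<^sub>R p x) \<bullet> z \<le> dual_norm K z"
        unfolding dual_norm_def using pos body_norm_scale[of "inverse (p x)" x]
        by (intro cSup_upper dual_norm_set_bdd CollectI exI[of _ "x /\<^sub>R p x"]) auto
      with G have "(x /\<^sub>R p x) \<bullet> z \<le> G" by simp
      with pos show ?thesis by (simp add: field_simps)
    qed
  qed
next
  assume *: "\<forall>x. x \<bullet> z \<le> G * p x"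
  have "x \<bullet> z \<le> G" if "p x \<le> 1" for x
    using *[rule_format, of x] mult_left_le[OF that assms] by linarith
  then show "dual_norm K z \<le> G"
    unfolding dual_norm_def using body_norm_zero by (intro cSup_least) (auto intro!: exI[of _ 0])
qed

lemma dual_norm_nonneg: "0 \<le> dual_norm K z"
proof -
  have "(0::'a) \<bullet> z \<le> dual_norm K z"
    unfolding dual_norm_def by (intro cSup_upper dual_norm_set_bdd) (auto simp: body_norm_zero intro!: exI[of _ 0])
  then show ?thesis by simp
qed

lemma inner_le_dual_norm: "x \<bullet> z \<le> dual_norm K z * p x"
  using dual_norm_le_iff[OF dual_norm_nonneg, of z z] by simp

lemma dual_norm_le_norm: obtains B where "B > 0" "\<And>z. dual_norm K z \<le> B * norm z"
proof -
  obtain B where B: "B > 0" "\<And>x. norm x \<le> B * p x" using norm_le_body_norm by blast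
  have "dual_norm K z \<le> B * norm z" for z
  proof (subst dual_norm_le_iff, use B in simp, intro allI)
    fix x
    have "x \<bullet> z \<le> norm x * norm z" by (rule norm_cauchy_schwarz)
    also have "\<dots> \<le> (B * p x) * norm z" by (intro mult_right_mono B) simp
    finally show "x \<bullet> z \<le> B * norm z * p x" by (simp add: mult_ac)
  qed
  with B show ?thesis using that by blast
qed

lemma borel_measurable_dual_norm [measurable]: "dual_norm K \<in> borel_measurable borel"
proof (rule borel_measurableI_le)
  fix G :: real
  show "{z \<in> space borel. dual_norm K z \<le> G} \<in> sets borel"
  proof (cases "0 \<le> G")
    case True
    have "{z. dual_norm K z \<le> G} = (\<Inter>x. {z. x \<bullet> z \<le> G * p x})"
      using dual_norm_le_iff[OF True] by auto
    moreover have "closed (\<Inter>x. {z. x \<bullet> z \<le> G * p x})"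
      by (intro closed_INT ballI closed_halfspace_le)
    ultimately show ?thesis by simp
  next
    case False
    then have "\<not> dual_norm K z \<le> G" for z using dual_norm_nonneg[of z] by linarith
    then show ?thesis by simp
  qed
qed

end

section \<open>Smooth bump functions\<close>

lemma frechet_derivative_eqI:
  assumes "(f has_derivative f') (at x)" shows "frechet_derivative f (at x) i = f' i"
  unfolding frechet_derivative_at[OF assms, symmetric] ..

lemma C_k_continuous: "C_k k f \<Longrightarrow> continuous_on UNIV f"
  by (cases k) (auto simp: continuous_on_eq_continuous_at differentiable_imp_continuous_within)

lemma C_k_Suc_D: "C_k (Suc k) f \<Longrightarrow> C_k k f"
proof (induction k arbitrary: f)
  case 0
  then show ?case using C_k_continuous[of "Suc 0" f] by simp
next
  case (Suc k)
  show ?case unfolding C_k.simps(2)[of k]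
    using Suc.prems Suc.IH by (metis C_k.simps(2))
qed

lemma C_k_add:
  assumes "C_k k f" "C_k k g" shows "C_k k (\<lambda>x. f x + g x)"
  using assms
proof (induction k arbitrary: f g)
  case 0
  then show ?case by (auto intro: continuous_intros)
next
  case (Suc k)
  then have d: "f differentiable (at x)" "g differentiable (at x)" for x by auto
  have "frechet_derivative (\<lambda>x. f x + g x) (at x) i
      = frechet_derivative f (at x) i + frechet_derivative g (at x) i" for x i
    using d by (intro frechet_derivative_eqI has_derivative_add) (auto simp: frechet_derivative_works)
  with Suc d show ?case by auto
qed

lemma frechet_derivative_mult_real:
  fixes f g :: "'a::real_normed_vector \<Rightarrow> real"
  assumes "f differentiable (at x)" "g differentiable (at x)"
  shows "frechet_derivative (\<lambda>x. f x * g x) (at x) i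
      = f x * frechet_derivative g (at x) i + frechet_derivative f (at x) i * g x"
  using assms by (intro frechet_derivative_eqI has_derivative_mult) (auto simp: frechet_derivative_works)

lemma C_k_mult:
  assumes "C_k k f" "C_k k g" shows "C_k k (\<lambda>x. f x * g x)"
  using assms
proof (induction k arbitrary: f g)
  case 0
  then show ?case by (auto intro: continuous_intros)
next
  case (Suc k)
  then have d: "f differentiable (at x)" "g differentiable (at x)" for x by auto
  have "C_k k f" "C_k k g" using Suc.prems C_k_Suc_D by blast+
  moreover have "C_k k (\<lambda>x. frechet_derivative f (at x) i)" "C_k k (\<lambda>x. frechet_derivative g (at x) i)"
    if "i \<in> Basis" for i using Suc.prems that by auto
  ultimately show ?case
    using d Suc.IH by (auto simp: frechet_derivative_mult_real intro!: C_k_add)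
qed

lemma frechet_derivative_const_real: "frechet_derivative (\<lambda>x. c::real) (at x) i = 0"
  by (intro frechet_derivative_eqI has_derivative_const)

lemma C_k_const: "C_k k (\<lambda>x. c)"
  by (induction k arbitrary: c) (auto simp: frechet_derivative_const_real)

lemma C_k_prod:
  assumes "finite I" "\<And>i. i \<in> I \<Longrightarrow> C_k k (f i)" shows "C_k k (\<lambda>x. \<Prod>i\<in>I. f i x)"
  using assms by (induction I rule: finite_induct) (auto intro: C_k_mult C_k_const)

lemma has_derivative_translated:
  assumes "f differentiable (at (x - y))"
  shows "((\<lambda>x. f (x - y)) has_derivative frechet_derivative f (at (x - y))) (at x)"
proof -
  have "((\<lambda>x. x - y) has_derivative (\<lambda>h. h)) (at x)"
    by (auto intro!: derivative_eq_intros)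
  moreover have "(f has_derivative frechet_derivative f (at (x - y))) (at (x - y))"
    using assms by (simp add: frechet_derivative_works)
  ultimately show ?thesis by (rule has_derivative_compose)
qed

lemma C_k_translate: "C_k k f \<Longrightarrow> C_k k (\<lambda>x. f (x - y))"
proof (induction k arbitrary: f)
  case 0
  then show ?case by (auto intro!: continuous_on_compose2[of UNIV f] continuous_intros)
next
  case (Suc k)
  then have d: "((\<lambda>x. f (x - y)) has_derivative frechet_derivative f (at (x - y))) (at x)" for x
    by (intro has_derivative_translated) auto
  then have "frechet_derivative (\<lambda>x. f (x - y)) (at x) i = frechet_derivative f (at (x - y)) i" for x i
    by (rule frechet_derivative_eqI)
  moreover have "C_k k (\<lambda>x. frechet_derivative f (at x) i)" if "i \<in> Basis" for i
    using Suc.prems that by auto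
  moreover have "(\<lambda>x. f (x - y)) differentiable (at x)" for x
    using d by (rule differentiableI)
  ultimately show ?case
    using Suc.IH[of "\<lambda>x. frechet_derivative f (at x) i" for i] by simp
qed

text \<open>
  The functions below vanish to infinite order at the origin and, since \<open>q\<close> is arbitrary, are
  closed under differentiation.  The choice \<open>q = 1\<close> is the classical smooth function
  \<open>exp (- 1 / t)\<close>.
\<close>

definition flat_exp :: "real poly \<Rightarrow> real \<Rightarrow> real" where
  "flat_exp q t = (if t > 0 then poly q (1 / t) * exp (- (1 / t)) else 0)"

definition flat_exp_deriv :: "real poly \<Rightarrow> real poly" where
  "flat_exp_deriv q = [:0, 0, 1:] * (q - pderiv q)"

lemma poly_exp_tendsto_0: "((\<lambda>s. poly q s * exp (- s)) \<longlongrightarrow> 0) (at_top :: real filter)"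
proof -
  have "((\<lambda>s. \<Sum>i\<le>degree q. coeff q i * (s ^ i * exp (- s))) \<longlongrightarrow> (\<Sum>i\<le>degree q. coeff q i * 0)) (at_top :: real filter)"
    using tendsto_power_div_exp_0
    by (intro tendsto_sum tendsto_mult tendsto_const) (simp add: exp_minus divide_inverse)
  then show ?thesis by (simp add: poly_altdef sum_distrib_right mult.assoc)
qed

lemma flat_exp_has_real_derivative:
  "(flat_exp q has_real_derivative flat_exp (flat_exp_deriv q) t) (at t)"
proof (cases t "0::real" rule: linorder_cases)
  case less
  have "((\<lambda>_. 0) has_real_derivative 0) (at t)" by simp
  then have "(flat_exp q has_real_derivative 0) (at t)"
    by (rule has_field_derivative_transform_within_open[of _ _ _ "{..<0}"]) (use less in \<open>auto simp: flat_exp_def\<close>)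
  with less show ?thesis by (simp add: flat_exp_def)
next
  case greater
  have "((\<lambda>t. poly q (1 / t) * exp (- (1 / t))) has_real_derivative
      flat_exp (flat_exp_deriv q) t) (at t)"
    using greater
    by (auto intro!: derivative_eq_intros DERIV_chain2[OF poly_DERIV]
        simp: flat_exp_def flat_exp_deriv_def field_simps power2_eq_square)
  then show ?thesis
    by (rule has_field_derivative_transform_within_open[of _ _ _ "{0<..}"]) (use greater in \<open>auto simp: flat_exp_def\<close>)
next
  case equal
  have "((\<lambda>s. poly ([:0, 1:] * q) s * exp (- s)) \<longlongrightarrow> 0) (at_top :: real filter)"
    by (rule poly_exp_tendsto_0)
  then have "((\<lambda>t. poly ([:0, 1:] * q) (inverse t) * exp (- inverse t)) \<longlongrightarrow> 0) (at_right (0::real))"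
    by (rule filterlim_compose) (rule filterlim_inverse_at_top_right)
  then have "((\<lambda>t. flat_exp q t / t) \<longlongrightarrow> 0) (at_right (0::real))"
    by (rule Lim_transform_eventually)
      (auto simp: eventually_at_right_field flat_exp_def divide_inverse intro!: exI[of _ 1])
  moreover have left: "((\<lambda>t. flat_exp q t / t) \<longlongrightarrow> 0) (at_left (0::real))"
    by (rule tendsto_eventually) (auto simp: eventually_at_left_field flat_exp_def intro!: exI[of _ "-1"])
  ultimately have "((\<lambda>t. flat_exp q t / t) \<longlongrightarrow> 0) (at 0)"
    using filterlim_split_at[OF left] by blast
  with equal show ?thesis by (simp add: has_field_derivative_iff flat_exp_def)
qed

lemma flat_exp_smult: "flat_exp (smult c q) t = c * flat_exp q t"
  by (simp add: flat_exp_def)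

lemma C_k_flat_exp: "C_k k (\<lambda>x. flat_exp q (x \<bullet> w + c))"
proof (induction k arbitrary: q)
  case 0
  have "isCont (flat_exp q) t" for t
    using flat_exp_has_real_derivative DERIV_isCont by blast
  then have "continuous_on UNIV (flat_exp q)" by (simp add: continuous_on_eq_continuous_at)
  then show ?case by (auto intro!: continuous_on_compose2[of UNIV "flat_exp q"] continuous_intros)
next
  case (Suc k)
  have d: "((\<lambda>x. flat_exp q (x \<bullet> w + c)) has_derivative
      (\<lambda>v. flat_exp (flat_exp_deriv q) (x \<bullet> w + c) * (v \<bullet> w))) (at x)" for x
  proof -
    have "((\<lambda>x. x \<bullet> w + c) has_derivative (\<lambda>v. v \<bullet> w)) (at x)"
      by (auto intro!: derivative_eq_intros)
    from has_derivative_compose[OF this] show ?thesis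
      using flat_exp_has_real_derivative[of q "x \<bullet> w + c"]
      by (simp add: has_field_derivative_def)
  qed
  have "frechet_derivative (\<lambda>x. flat_exp q (x \<bullet> w + c)) (at x) i
      = flat_exp (smult (i \<bullet> w) (flat_exp_deriv q)) (x \<bullet> w + c)" for x i
    unfolding frechet_derivative_eqI[OF d] flat_exp_smult by (rule mult.commute)
  then show ?case using differentiableI[OF d] Suc.IH by simp
qed

text \<open>
  The factor \<open>Suc n\<close> only rescales the exponents, so the support stays the same box for all \<open>n\<close>
  while the values inside increase to 1.
\<close>

definition box_bump :: "'a::euclidean_space \<Rightarrow> 'a \<Rightarrow> nat \<Rightarrow> 'a \<Rightarrow> real" where
  "box_bump a b n x = (\<Prod>i\<in>Basis. flat_exp 1 (real (Suc n) * (x \<bullet> i - a \<bullet> i)) *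
     flat_exp 1 (real (Suc n) * (b \<bullet> i - x \<bullet> i)))"

lemma flat_exp_1: "0 \<le> flat_exp 1 t" "flat_exp 1 t \<le> 1" "flat_exp 1 t \<noteq> 0 \<longleftrightarrow> t > 0"
  by (auto simp: flat_exp_def)

lemma box_bump_nonneg: "0 \<le> box_bump a b n x"
  unfolding box_bump_def by (intro prod_nonneg mult_nonneg_nonneg flat_exp_1 ballI)

lemma box_bump_le_1: "box_bump a b n x \<le> 1"
  unfolding box_bump_def
  by (intro prod_le_1 conjI mult_nonneg_nonneg mult_le_one flat_exp_1)

lemma box_bump_nonzero_iff: "box_bump a b n x \<noteq> 0 \<longleftrightarrow> x \<in> box a b"
proof -
  have "0 < real (Suc n) * s \<longleftrightarrow> 0 < s" for s :: real
    by (simp add: zero_less_mult_iff)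
  then show ?thesis
    by (auto simp: box_bump_def mem_box flat_exp_1(3) simp del: of_nat_Suc)
qed

lemma C_k_box_bump: "C_k k (box_bump a b n)"
proof -
  have "C_k k (\<lambda>x. flat_exp 1 (real (Suc n) * (x \<bullet> i - a \<bullet> i)) *
     flat_exp 1 (real (Suc n) * (b \<bullet> i - x \<bullet> i)))" for i :: 'a
    using C_k_mult[OF C_k_flat_exp[of k 1 "real (Suc n) *\<^sub>R i" "- real (Suc n) * (a \<bullet> i)"]
        C_k_flat_exp[of k 1 "- real (Suc n) *\<^sub>R i" "real (Suc n) * (b \<bullet> i)"]]
    by (simp add: algebra_simps del: of_nat_Suc)
  then show ?thesis
    unfolding box_bump_def[abs_def] by (intro C_k_prod) auto
qed

lemma box_bump_test_function:
  assumes "cbox a b \<subseteq> C" shows "box_bump a b n \<in> test_functions C"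
proof -
  have "closure {x. box_bump a b n x \<noteq> 0} \<subseteq> cbox a b"
    unfolding box_bump_nonzero_iff using box_subset_cbox by (intro closure_minimal) auto
  moreover from this have "compact (closure {x. box_bump a b n x \<noteq> 0})"
    by (metis bounded_cbox bounded_subset closed_closure compact_eq_bounded_closed)
  ultimately show ?thesis
    using assms C_k_box_bump by (auto simp: test_functions_def)
qed

lemma box_bump_tendsto: "(\<lambda>n. box_bump a b n x) \<longlonglongrightarrow> indicator (box a b) x"
proof (cases "x \<in> box a b")
  case False
  then have "box_bump a b n x = 0" for n using box_bump_nonzero_iff by blast
  with False show ?thesis by simp
next
  case True
  have lim: "(\<lambda>n. flat_exp 1 (real (Suc n) * s)) \<longlonglongrightarrow> 1" if "s > 0" for s
  proof -
    have "(\<lambda>n. exp (- (inverse s * (1 / real (Suc n))))) \<longlonglongrightarrow> exp (- (inverse s * 0))"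
      by (intro tendsto_intros LIMSEQ_Suc[OF lim_1_over_n])
    moreover have "flat_exp 1 (real (Suc n) * s) = exp (- (inverse s * (1 / real (Suc n))))" for n
      using that by (simp add: flat_exp_def zero_less_mult_iff divide_inverse mult_ac del: of_nat_Suc)
    ultimately show ?thesis by simp
  qed
  have "(\<lambda>n. box_bump a b n x) \<longlonglongrightarrow> (\<Prod>i\<in>(Basis::'a set). 1 * 1)"
    unfolding box_bump_def using True by (intro tendsto_prod tendsto_mult lim) (auto simp: mem_box)
  with True show ?thesis by simp
qed

section \<open>The Radon--Nikodym theorem for charges\<close>

locale charge_space =
  fixes M :: "'a measure" and \<nu> :: "'a set \<Rightarrow> real"
  assumes charge_empty: "\<nu> {} = 0"
    and charge_sums: "range A \<subseteq> sets M \<Longrightarrow> disjoint_family A \<Longrightarrow> (\<lambda>n::nat. \<nu> (A n)) sums \<nu> (\<Union>n. A n)"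
begin

lemma charge_Un:
  assumes "A \<in> sets M" "B \<in> sets M" "A \<inter> B = {}" shows "\<nu> (A \<union> B) = \<nu> A + \<nu> B"
proof -
  have "(\<lambda>n. \<nu> (binaryset A B n)) sums \<nu> (\<Union>n. binaryset A B n)"
    using assms by (intro charge_sums) (auto simp: range_binaryset_eq disjoint_family_on_def binaryset_def)
  moreover have "(\<lambda>n. \<nu> (binaryset A B n)) sums (\<nu> A + \<nu> B)"
    by (intro binaryset_sums charge_empty)
  ultimately show ?thesis using sums_unique2 by (fastforce simp: UN_binaryset_eq)
qed

lemma charge_split:
  assumes "A \<in> sets M" "B \<in> sets M" shows "\<nu> A = \<nu> (A \<inter> B) + \<nu> (A - B)"
  using charge_Un[of "A \<inter> B" "A - B"] assms by (simp add: Int_Diff_Un Int_Diff_disjoint)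

lemma charge_increasing_limit:
  assumes A: "range A \<subseteq> sets M" "incseq A" shows "(\<lambda>n. \<nu> (A n)) \<longlonglongrightarrow> \<nu> (\<Union>n. A n)"
proof -
  have D: "disjointed A n \<in> sets M" for n
    using A sets.range_disjointed_sets[of A] by blast
  have "(\<lambda>n. \<nu> (disjointed A n)) sums \<nu> (\<Union>n. disjointed A n)"
    using D by (intro charge_sums disjoint_family_disjointed) auto
  then have "(\<lambda>n. \<Sum>i<Suc n. \<nu> (disjointed A i)) \<longlonglongrightarrow> \<nu> (\<Union>n. A n)"
    by (simp add: sums_def UN_disjointed_eq del: sum.lessThan_Suc) (rule LIMSEQ_Suc)
  moreover have "(\<Sum>i<Suc n. \<nu> (disjointed A i)) = \<nu> (A n)" for n
  proof (induction n)
    case 0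
    show ?case by (simp add: disjointed_def)
  next
    case (Suc n)
    have "disjointed A (Suc n) = A (Suc n) - A n" using A(2) by (simp add: disjointed_mono incseq_def mono_def)
    moreover have "A (Suc n) \<inter> A n = A n" using A(2) by (auto simp: incseq_Suc_iff)
    moreover have "A k \<in> sets M" for k using A(1) by auto
    ultimately show ?case using Suc charge_split[of "A (Suc n)" "A n"] by simp
  qed
  ultimately show ?thesis by simp
qed

lemma charge_decreasing_limit:
  assumes A: "range A \<subseteq> sets M" "decseq A" shows "(\<lambda>n. \<nu> (A n)) \<longlonglongrightarrow> \<nu> (\<Inter>n. A n)"
proof -
  have sets: "A n \<in> sets M" for n using A by auto
  have sub: "A n \<subseteq> A 0" for n using decseqD[OF A(2), of 0 n] by simp
  have d: "\<nu> B = \<nu> (A 0) - \<nu> (A 0 - B)" if "B \<in> sets M" "B \<subseteq> A 0" for B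
  proof -
    have "A 0 \<inter> B = B" using that by auto
    then show ?thesis using charge_split[OF sets[of 0] that(1)] by simp
  qed
  have "(\<lambda>n. \<nu> (A 0 - A n)) \<longlonglongrightarrow> \<nu> (\<Union>n. A 0 - A n)"
    using sets A(2) by (intro charge_increasing_limit) (auto simp: incseq_def dest: decseqD)
  then have "(\<lambda>n. \<nu> (A 0) - \<nu> (A 0 - A n)) \<longlonglongrightarrow> \<nu> (A 0) - \<nu> (\<Union>n. A 0 - A n)"
    by (intro tendsto_intros)
  moreover have "\<nu> (A 0) - \<nu> (A 0 - A n) = \<nu> (A n)" for n
    by (rule d[OF sets sub, symmetric])
  moreover have "\<nu> (\<Inter>n. A n) = \<nu> (A 0) - \<nu> (A 0 - (\<Inter>n. A n))"
    using sets sub by (intro d) auto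
  moreover have "A 0 - (\<Inter>n. A n) = (\<Union>n. A 0 - A n)" by auto
  ultimately show ?thesis by (simp only:)
qed

text \<open>
  A set on which the charge is unbounded can be split so that the charge is still unbounded on one
  part and at least 1 in absolute value on the other.  Repeating this would give infinitely many
  disjoint pieces whose charges do not tend to 0.
\<close>

lemma charge_bounded: "\<exists>c. \<forall>A\<in>sets M. \<bar>\<nu> A\<bar> \<le> c"
proof (rule ccontr)
  assume unbdd: "\<not> ?thesis"
  define bad where "bad E \<longleftrightarrow> E \<in> sets M \<and> (\<forall>c. \<exists>A\<in>sets M. A \<subseteq> E \<and> \<bar>\<nu> A\<bar> > c)" for E
  have step: "\<exists>E'. bad E' \<and> E' \<subseteq> E \<and> \<bar>\<nu> (E - E')\<bar> \<ge> 1" if E: "bad E" for E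
  proof -
    obtain A where A: "A \<in> sets M" "A \<subseteq> E" "\<bar>\<nu> A\<bar> > \<bar>\<nu> E\<bar> + 1" and "E \<in> sets M"
      using E unfolding bad_def by blast
    have "E \<inter> A = A" using A by auto
    then have "\<nu> E = \<nu> A + \<nu> (E - A)" using charge_split[OF \<open>E \<in> sets M\<close> A(1)] by simp
    then have "\<bar>\<nu> (E - A)\<bar> \<ge> 1" using A(3) by linarith
    have "bad A \<or> bad (E - A)"
    proof (rule ccontr)
      assume "\<not> (bad A \<or> bad (E - A))"
      moreover have "E - A \<in> sets M" using A(1) \<open>E \<in> sets M\<close> by simp
      ultimately have "\<not> (\<forall>c. \<exists>B\<in>sets M. B \<subseteq> A \<and> \<bar>\<nu> B\<bar> > c)"
          "\<not> (\<forall>c. \<exists>B\<in>sets M. B \<subseteq> E - A \<and> \<bar>\<nu> B\<bar> > c)"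
        using A(1) by (simp_all add: bad_def)
      then obtain c c' where "\<not> (\<exists>B\<in>sets M. B \<subseteq> A \<and> \<bar>\<nu> B\<bar> > c)"
          "\<not> (\<exists>B\<in>sets M. B \<subseteq> E - A \<and> \<bar>\<nu> B\<bar> > c')"
        by blast
      then have c: "\<forall>B\<in>sets M. B \<subseteq> A \<longrightarrow> \<bar>\<nu> B\<bar> \<le> c"
          "\<forall>B\<in>sets M. B \<subseteq> E - A \<longrightarrow> \<bar>\<nu> B\<bar> \<le> c'"
        by (meson not_less)+
      obtain B where B: "B \<in> sets M" "B \<subseteq> E" "\<bar>\<nu> B\<bar> > c + c'"
        using E unfolding bad_def by blast
      have "\<bar>\<nu> (B \<inter> A)\<bar> \<le> c" using A B by (intro c(1)[rule_format]) auto
      moreover have "\<bar>\<nu> (B - A)\<bar> \<le> c'" using A B by (intro c(2)[rule_format]) auto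
      ultimately
      show False using charge_split[OF B(1) A(1)] B(3) by linarith
    qed
    then show ?thesis
    proof
      assume "bad A"
      then show ?thesis using A \<open>\<bar>\<nu> (E - A)\<bar> \<ge> 1\<close> by blast
    next
      assume "bad (E - A)"
      moreover have "E - (E - A) = A" using A by auto
      ultimately show ?thesis using A(3) by (intro exI[of _ "E - A"]) auto
    qed
  qed
  have "bad (space M)"
    unfolding bad_def
  proof (intro conjI allI)
    fix c
    have "\<not> (\<forall>A\<in>sets M. \<bar>\<nu> A\<bar> \<le> c)" using unbdd by blast
    then obtain A where A: "A \<in> sets M" "\<not> \<bar>\<nu> A\<bar> \<le> c" by blast
    have "A \<subseteq> space M \<and> \<bar>\<nu> A\<bar> > c" using sets.sets_into_space[OF A(1)] A(2) by linarith
    with A(1) show "\<exists>A\<in>sets M. A \<subseteq> space M \<and> \<bar>\<nu> A\<bar> > c" by blast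
  qed (rule sets.top)
  moreover have "\<exists>E'. bad E' \<and> (E' \<subseteq> E \<and> \<bar>\<nu> (E - E')\<bar> \<ge> 1)" if "bad E" for E
    using step[OF that] .
  ultimately have "\<exists>E. \<forall>n::nat. bad (E n) \<and> (E (Suc n) \<subseteq> E n \<and> \<bar>\<nu> (E n - E (Suc n))\<bar> \<ge> 1)"
    using dependent_nat_choice[where P="\<lambda>_. bad" and Q="\<lambda>_ E E'. E' \<subseteq> E \<and> \<bar>\<nu> (E - E')\<bar> \<ge> 1"]
    by blast
  then obtain E where E: "\<And>n. bad (E n)" "\<And>n. E (Suc n) \<subseteq> E n" "\<And>n. \<bar>\<nu> (E n - E (Suc n))\<bar> \<ge> 1"
    by blast
  define D where "D n = E n - E (Suc n)" for n
  have "decseq E" using E(2) by (simp add: decseq_Suc_iff)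
  then have "E j \<subseteq> E (Suc i)" if "i < j" for i j using decseqD[of E "Suc i" j] that by simp
  then have D_disj: "D i \<inter> D j = {}" if "i < j" for i j using that unfolding D_def by blast
  have "disjoint_family D"
    unfolding disjoint_family_on_def
  proof (intro ballI impI)
    fix i j :: nat assume "i \<noteq> j"
    then show "D i \<inter> D j = {}" using D_disj[of i j] D_disj[of j i] by (cases "i < j") auto
  qed
  moreover have "E n \<in> sets M" for n using E(1)[of n] unfolding bad_def by (rule conjunct1)
  then have "D n \<in> sets M" for n unfolding D_def by (intro sets.Diff)
  ultimately have "(\<lambda>n. \<nu> (D n)) sums \<nu> (\<Union>n. D n)" by (intro charge_sums) blast+
  then have "(\<lambda>n. \<nu> (D n)) \<longlonglongrightarrow> 0" using sums_summable summable_LIMSEQ_zero by blast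
  then have "\<forall>\<^sub>F n in sequentially. \<bar>\<nu> (D n)\<bar> < 1"
    using tendstoD[of "\<lambda>n. \<nu> (D n)" 0 sequentially 1] by (simp add: dist_real_def)
  then obtain n where "\<bar>\<nu> (D n)\<bar> < 1" unfolding eventually_sequentially by blast
  then show False using E(3)[of n] by (simp add: D_def)
qed

text \<open>
  A set on which the charge attains its supremum is positive, and its complement is negative.
  Such a set is the limit superior of sets whose charges approach the supremum geometrically fast.
\<close>

lemma Hahn_decomposition:
  obtains P where "P \<in> sets M" "\<And>A. A \<in> sets M \<Longrightarrow> 0 \<le> \<nu> (A \<inter> P)" "\<And>A. A \<in> sets M \<Longrightarrow> \<nu> (A - P) \<le> 0"
proof -
  obtain c where c: "\<And>A. A \<in> sets M \<Longrightarrow> \<bar>\<nu> A\<bar> \<le> c" using charge_bounded by blast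
  define s where "s = (SUP A\<in>sets M. \<nu> A)"
  have bdd: "bdd_above (\<nu> ` sets M)" using c abs_le_D1 by (intro bdd_aboveI2[of _ _ c]) blast
  have le_s: "\<nu> A \<le> s" if "A \<in> sets M" for A unfolding s_def using that bdd by (rule cSUP_upper)
  have "\<exists>A\<in>sets M. s - (1/2)^n < \<nu> A" for n
  proof -
    have "s - (1/2)^n < s" by simp
    then show ?thesis unfolding s_def using less_cSUP_iff[OF _ bdd] by blast
  qed
  then obtain Q where Q: "\<And>n. Q n \<in> sets M" "\<And>n. s - (1/2)^n < \<nu> (Q n)" by metis
  \<comment> \<open>Finite unions from index \<open>n\<close> on lose at most the sum of the errors, less than \<open>2 (1/2)\<^sup>n\<close>.\<close>
  define T where "T n m = (\<Union>k\<le>m. Q (n + k))" for n m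
  define U where "U n = (\<Union>m. T n m)" for n
  have T: "T n m \<in> sets M" for n m using Q by (auto simp: T_def)
  have "s - (2 * (1/2)^n - (1/2)^(n + m)) \<le> \<nu> (T n m)" for n m
  proof (induction m)
    case 0
    show ?case using Q(2)[of n] by (simp add: T_def less_imp_le)
  next
    case (Suc m)
    define B where "B = Q (n + Suc m)"
    have B: "B \<in> sets M" using Q by (simp add: B_def)
    have "T n (Suc m) = T n m \<union> (B - T n m)" by (auto simp: T_def B_def atMost_Suc)
    then have "\<nu> (T n (Suc m)) = \<nu> (T n m) + \<nu> (B - T n m)"
      using charge_Un[of "T n m" "B - T n m"] B T by auto
    moreover have "\<nu> B = \<nu> (B \<inter> T n m) + \<nu> (B - T n m)" by (rule charge_split[OF B T])
    moreover have "\<nu> (B \<inter> T n m) \<le> s" using B T by (intro le_s) auto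
    moreover have "\<nu> B > s - (1/2)^(n + Suc m)" unfolding B_def by (rule Q(2))
    moreover have "(1/2::real)^(n + m) = 2 * (1/2)^(n + Suc m)" by simp
    ultimately show ?case using Suc by linarith
  qed
  then have "s - 2 * (1/2)^n \<le> \<nu> (T n m)" for n m
    by (rule order_trans[rotated]) simp
  moreover have "(\<lambda>m. \<nu> (T n m)) \<longlonglongrightarrow> \<nu> (U n)" for n
  proof -
    have "T n m \<subseteq> T n m'" if "m \<le> m'" for m m'
      unfolding T_def using that by (intro UN_mono) auto
    then show ?thesis
      unfolding U_def using T by (intro charge_increasing_limit) (auto simp: incseq_def)
  qed
  ultimately have Us: "s - 2 * (1/2)^n \<le> \<nu> (U n)" for n
    using LIMSEQ_le_const[of "\<lambda>m. \<nu> (T n m)" "\<nu> (U n)"] by blast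
  define P where "P = (\<Inter>n. U n)"
  have U: "U n \<in> sets M" for n using T by (auto simp: U_def)
  have "U (Suc n) \<subseteq> U n" for n
  proof
    fix x assume "x \<in> U (Suc n)"
    then obtain k where "x \<in> Q (n + Suc k)" by (auto simp: U_def T_def)
    then show "x \<in> U n" by (force simp: U_def T_def)
  qed
  then have "(\<lambda>n. \<nu> (U n)) \<longlonglongrightarrow> \<nu> P"
    unfolding P_def using U by (intro charge_decreasing_limit) (auto simp: decseq_Suc_iff)
  moreover have "(\<lambda>n. s - 2 * (1/2)^n) \<longlonglongrightarrow> s - 2 * 0"
    by (intro tendsto_intros LIMSEQ_power_zero) simp
  ultimately have "s - 2 * 0 \<le> \<nu> P" 
    using Us LIMSEQ_le[of "\<lambda>n. s - 2 * (1/2)^n" "s - 2 * 0" "\<lambda>n. \<nu> (U n)" "\<nu> P"] by blast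
  then have Ps: "s \<le> \<nu> P" by simp
  have P: "P \<in> sets M" using U by (auto simp: P_def)
  show thesis
  proof
    show "P \<in> sets M" by fact
    fix A assume A: "A \<in> sets M"
    have "\<nu> P = \<nu> (P \<inter> A) + \<nu> (P - A)" using charge_split[OF P A] .
    moreover have "\<nu> (P - A) \<le> s" using A P by (intro le_s) auto
    ultimately show "0 \<le> \<nu> (A \<inter> P)" using Ps by (simp add: Int_commute)
    have "\<nu> (P \<union> (A - P)) = \<nu> P + \<nu> (A - P)" using A P by (intro charge_Un) auto
    moreover have "\<nu> (P \<union> (A - P)) \<le> s" using A P by (intro le_s) auto
    ultimately show "\<nu> (A - P) \<le> 0" using Ps by simp
  qed
qed

end

lemma Radon_Nikodym_nonneg_charge:
  assumes "sigma_finite_measure M" and "charge_space M \<nu>"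
    and nonneg: "\<And>A. A \<in> sets M \<Longrightarrow> 0 \<le> \<nu> A"
    and ac: "\<And>A. A \<in> null_sets M \<Longrightarrow> \<nu> A = 0"
  shows "\<exists>f. integrable M f \<and> (\<forall>Q\<in>sets M. \<nu> Q = (LINT x:Q|M. f x))"
proof -
  interpret sigma_finite_measure M by fact
  interpret charge_space M \<nu> by fact
  define N where "N = measure_of (space M) (sets M) (\<lambda>A. ennreal (\<nu> A))"
  have sets_N: "sets N = sets M" by (simp add: N_def)
  have emeasure_N: "emeasure N A = ennreal (\<nu> A)" if "A \<in> sets M" for A
    unfolding N_def
  proof (rule emeasure_measure_of_sigma[OF _ _ _ that])
    show "sigma_algebra (space M) (sets M)" by (rule sets.sigma_algebra_axioms)
    show "positive (sets M) (\<lambda>A. ennreal (\<nu> A))" by (simp add: positive_def charge_empty)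
    show "countably_additive (sets M) (\<lambda>A. ennreal (\<nu> A))"
      unfolding countably_additive_def
    proof (intro allI impI)
      fix A :: "nat \<Rightarrow> _" assume A: "range A \<subseteq> sets M" "disjoint_family A"
      show "(\<Sum>i. ennreal (\<nu> (A i))) = ennreal (\<nu> (\<Union>i. A i))"
        by (rule suminf_ennreal_eq[OF _ charge_sums[OF A]]) (use A nonneg in blast)
    qed
  qed
  have "absolutely_continuous M N"
    unfolding absolutely_continuous_def using ac emeasure_N sets_N by (auto simp: null_sets_def)
  then obtain f where f: "f \<in> borel_measurable M" "density M f = N"
    using Radon_Nikodym sets_N by blast
  have int: "(\<integral>\<^sup>+x. f x * indicator Q x \<partial>M) = ennreal (\<nu> Q)" if "Q \<in> sets M" for Q
    using emeasure_density[OF f(1) that] emeasure_N[OF that] f(2) by simp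
  have "(\<integral>\<^sup>+x. f x \<partial>M) = (\<integral>\<^sup>+x. f x * indicator (space M) x \<partial>M)"
    by (intro nn_integral_cong) simp
  also have "\<dots> = ennreal (\<nu> (space M))" by (rule int) simp
  finally have tot: "(\<integral>\<^sup>+x. f x \<partial>M) = ennreal (\<nu> (space M))" .
  then have fin: "AE x in M. f x \<noteq> \<infinity>" using f(1) by (intro nn_integral_noteq_infinite) auto
  define g where "g x = enn2real (f x)" for x
  have "g \<in> borel_measurable M" unfolding g_def[abs_def] using f(1) by measurable
  moreover have "AE x in M. ennreal (g x) = f x"
    using fin by eventually_elim (simp add: g_def top.not_eq_extremum)
  moreover have "0 \<le> g x" for x by (simp add: g_def)
  ultimately have g: "AE x in M. ennreal (g x) = f x" "g \<in> borel_measurable M" "\<And>x. 0 \<le> g x"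
    by blast+
  have "(\<integral>\<^sup>+x. ennreal (g x) \<partial>M) = (\<integral>\<^sup>+x. f x \<partial>M)" using g(1) by (intro nn_integral_cong_AE) auto
  then have "integrable M g" using g tot by (intro integrableI_nonneg) auto
  moreover have "\<nu> Q = (LINT x:Q|M. g x)" if Q: "Q \<in> sets M" for Q
  proof -
    have "(\<integral>\<^sup>+x. ennreal (indicator Q x *\<^sub>R g x) \<partial>M) = (\<integral>\<^sup>+x. f x * indicator Q x \<partial>M)"
      using g(1) by (intro nn_integral_cong_AE) (auto split: split_indicator)
    also have "\<dots> = ennreal (\<nu> Q)" by (rule int[OF Q])
    finally have "(\<integral>x. indicator Q x *\<^sub>R g x \<partial>M) = \<nu> Q"
      using g(2,3) Q nonneg[OF Q] by (subst integral_eq_nn_integral) simp_all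
    then show ?thesis by (simp add: set_lebesgue_integral_def)
  qed
  ultimately show ?thesis by blast
qed

text \<open>
  The positive and the negative part of a Hahn decomposition are nonnegative charges, and the density
  is the difference of their densities.
\<close>

theorem Radon_Nikodym_charge:
  assumes M: "sigma_finite_measure M" and "charge_space M \<nu>"
    and ac: "\<And>A. A \<in> null_sets M \<Longrightarrow> \<nu> A = 0"
  shows "\<exists>f. integrable M f \<and> (\<forall>Q\<in>sets M. \<nu> Q = (LINT x:Q|M. f x))"
proof -
  interpret charge_space M \<nu> by fact
  obtain P where P: "P \<in> sets M" "\<And>A. A \<in> sets M \<Longrightarrow> 0 \<le> \<nu> (A \<inter> P)"
      "\<And>A. A \<in> sets M \<Longrightarrow> \<nu> (A - P) \<le> 0"
    by (rule Hahn_decomposition) blast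
  have "charge_space M (\<lambda>A. \<nu> (A \<inter> P))"
  proof
    fix A :: "nat \<Rightarrow> _" assume "range A \<subseteq> sets M" "disjoint_family A"
    then have "(\<lambda>n. \<nu> (A n \<inter> P)) sums \<nu> (\<Union>n. A n \<inter> P)"
      using P(1) by (intro charge_sums) (auto simp: disjoint_family_on_def)
    then show "(\<lambda>n. \<nu> (A n \<inter> P)) sums \<nu> ((\<Union>n. A n) \<inter> P)" by simp
  qed (simp add: charge_empty)
  moreover have "\<nu> (A \<inter> P) = 0" if "A \<in> null_sets M" for A
    using that P(1) by (intro ac null_set_Int2)
  ultimately obtain f where f: "integrable M f" "\<And>Q. Q \<in> sets M \<Longrightarrow> \<nu> (Q \<inter> P) = (LINT x:Q|M. f x)"
    using Radon_Nikodym_nonneg_charge[OF M, of "\<lambda>A. \<nu> (A \<inter> P)"] P(2) by blast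
  have "charge_space M (\<lambda>A. - \<nu> (A - P))"
  proof
    fix A :: "nat \<Rightarrow> _" assume "range A \<subseteq> sets M" "disjoint_family A"
    then have "(\<lambda>n. \<nu> (A n - P)) sums \<nu> (\<Union>n. A n - P)"
      using P(1) by (intro charge_sums) (auto simp: disjoint_family_on_def)
    then show "(\<lambda>n. - \<nu> (A n - P)) sums - \<nu> ((\<Union>n. A n) - P)" by (intro sums_minus) simp
  qed (simp add: charge_empty)
  moreover have "- \<nu> (A - P) = 0" if "A \<in> null_sets M" for A
    using ac[OF null_set_Diff[OF that P(1)]] by simp
  ultimately obtain g where g: "integrable M g" "\<And>Q. Q \<in> sets M \<Longrightarrow> - \<nu> (Q - P) = (LINT x:Q|M. g x)"
    using Radon_Nikodym_nonneg_charge[OF M, of "\<lambda>A. - \<nu> (A - P)"] P(3) by fastforce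
  have "\<nu> Q = (LINT x:Q|M. f x - g x)" if Q: "Q \<in> sets M" for Q
  proof -
    have "(LINT x:Q|M. f x - g x) = (LINT x:Q|M. f x) - (LINT x:Q|M. g x)"
      by (intro set_integral_diff; unfold set_integrable_def; intro integrable_mult_indicator Q f(1) g(1))
    then show ?thesis using f(2)[OF Q] g(2)[OF Q] charge_split[OF Q P(1)] by simp
  qed
  then show ?thesis using f(1) g(1) by (intro exI[of _ "\<lambda>x. f x - g x"]) auto
qed

lemma set_integral_lebesgue_on:
  fixes f :: "'a::euclidean_space \<Rightarrow> real"
  assumes "C \<in> sets lebesgue" "Q \<in> sets (lebesgue_on C)"
  shows "(LINT x:Q|lebesgue_on C. f x) = (LINT x:Q|lebesgue. f x)"
proof -
  have "Q \<subseteq> C" using sets.sets_into_space[OF assms(2)] by simp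
  then have "(\<lambda>x. indicator C x *\<^sub>R (indicator Q x *\<^sub>R f x)) = (\<lambda>x. indicator Q x *\<^sub>R f x)"
    by (auto simp: fun_eq_iff indicator_def)
  moreover have "(LINT x:Q|lebesgue_on C. f x) = (LINT x|lebesgue. indicator C x *\<^sub>R (indicator Q x *\<^sub>R f x))"
    unfolding set_lebesgue_integral_def using assms(1) by (intro integral_restrict_space) simp
  ultimately show ?thesis by (simp add: set_lebesgue_integral_def)
qed

lemma sigma_finite_lebesgue: "sigma_finite_measure (lebesgue :: 'a::euclidean_space measure)"
proof
  obtain A :: "'a set set" where "countable A" "A \<subseteq> sets lborel" "\<Union>A = space lborel" "\<forall>a\<in>A. emeasure lborel a \<noteq> \<infinity>"
    using lborel.sigma_finite_countable by blast
  then show "\<exists>A. countable A \<and> A \<subseteq> sets lebesgue \<and> \<Union>A = space (lebesgue :: 'a measure) \<and>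
      (\<forall>a\<in>A. emeasure lebesgue a \<noteq> \<infinity>)"
    by (intro exI[of _ A]) auto
qed

lemma charge_deriv_works:
  fixes C :: "'a::euclidean_space set"
  assumes C: "C \<in> sets lebesgue" and \<nu>: "\<nu> \<in> ac_charges C"
  shows "integrable (lebesgue_on C) (charge_deriv C \<nu>)"
    and "Q \<in> sets (lebesgue_on C) \<Longrightarrow> \<nu> Q = (LINT x:Q|lebesgue. charge_deriv C \<nu> x)"
proof -
  have "sigma_finite_measure (lebesgue_on C)"
    using C by (intro sigma_finite_measure_restrict_space sigma_finite_lebesgue)
  moreover have "charge_space (lebesgue_on C) \<nu>"
    using \<nu> by unfold_locales (auto simp: ac_charges_def charge_on_def)
  moreover have "\<nu> A = 0" if "A \<in> null_sets (lebesgue_on C)" for A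
    using \<nu> null_setsD2[OF that] that null_sets_restrict_space[OF C, of A] by (simp add: ac_charges_def)
  ultimately have "\<exists>f. integrable (lebesgue_on C) f \<and>
      (\<forall>Q\<in>sets (lebesgue_on C). \<nu> Q = (LINT x:Q|lebesgue_on C. f x))"
    by (rule Radon_Nikodym_charge)
  then have "\<exists>f. integrable (lebesgue_on C) f \<and>
      (\<forall>Q\<in>sets (lebesgue_on C). \<nu> Q = (LINT x:Q|lebesgue. f x))"
    using set_integral_lebesgue_on[OF C] by auto
  from someI_ex[OF this] show "integrable (lebesgue_on C) (charge_deriv C \<nu>)"
    and "Q \<in> sets (lebesgue_on C) \<Longrightarrow> \<nu> Q = (LINT x:Q|lebesgue. charge_deriv C \<nu> x)"
    unfolding charge_deriv_def by blast+
qed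

section \<open>Testing inequalities against bump functions\<close>

lemma test_function_properties:
  assumes "\<phi> \<in> test_functions C"
  obtains S where "compact S" "S \<subseteq> C" "\<And>x. x \<notin> S \<Longrightarrow> \<phi> x = 0"
    "\<And>x v. x \<notin> S \<Longrightarrow> frechet_derivative \<phi> (at x) v = 0"
proof
  let ?S = "closure {x. \<phi> x \<noteq> 0}"
  show "compact ?S" "?S \<subseteq> C" using assms by (auto simp: test_functions_def)
  show zero: "\<phi> x = 0" if "x \<notin> ?S" for x using that closure_subset[of "{x. \<phi> x \<noteq> 0}"] by auto
  show "frechet_derivative \<phi> (at x) v = 0" if "x \<notin> ?S" for x v
  proof -
    have eq: "0 = \<phi> y" if "y \<in> - ?S" for y
      by (rule sym, rule zero) (use that in blast)
    have "open (- ?S)" "x \<in> - ?S" using that by blast+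
    then have "(\<phi> has_derivative (\<lambda>_. 0)) (at x)"
      by (rule has_derivative_transform_within_open[OF has_derivative_const _ _ eq])
    then show ?thesis by (rule frechet_derivative_eqI)
  qed
qed

lemma test_function_differentiable:
  assumes "\<phi> \<in> test_functions C" shows "(\<phi> has_derivative frechet_derivative \<phi> (at x)) (at x)"
proof -
  have "C_k (Suc 0) \<phi>" using assms by (simp only: test_functions_def mem_Collect_eq)
  then show ?thesis by (simp add: frechet_derivative_works[symmetric])
qed

lemma test_function_continuous: "\<phi> \<in> test_functions C \<Longrightarrow> continuous_on UNIV \<phi>"
  using C_k_continuous[of 0 \<phi>] by (simp add: test_functions_def)

lemma frechet_derivative_basis_expansion:
  fixes \<phi> :: "'a::euclidean_space \<Rightarrow> real"
  assumes "(\<phi> has_derivative frechet_derivative \<phi> (at x)) (at x)"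
  shows "frechet_derivative \<phi> (at x) v = (\<Sum>i\<in>Basis. (v \<bullet> i) * frechet_derivative \<phi> (at x) i)"
proof -
  interpret bounded_linear "frechet_derivative \<phi> (at x)" using assms by (rule has_derivative_bounded_linear)
  have "frechet_derivative \<phi> (at x) (\<Sum>i\<in>Basis. (v \<bullet> i) *\<^sub>R i) = (\<Sum>i\<in>Basis. (v \<bullet> i) * frechet_derivative \<phi> (at x) i)"
    by (simp only: sum scaleR real_scaleR_def)
  then show ?thesis by (simp add: euclidean_representation)
qed

lemma test_function_deriv_continuous:
  assumes \<phi>: "\<phi> \<in> test_functions C"
  shows "continuous_on UNIV (\<lambda>x. frechet_derivative \<phi> (at x) v)"
proof -
  have "C_k (Suc 0) \<phi>" using \<phi> by (simp only: test_functions_def mem_Collect_eq)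
  then have "continuous_on UNIV (\<lambda>x. frechet_derivative \<phi> (at x) i)" if "i \<in> Basis" for i
    using that by simp
  then show ?thesis
    unfolding frechet_derivative_basis_expansion[OF test_function_differentiable[OF \<phi>], of _ v]
    by (intro continuous_intros)
qed

lemma compactly_supported_bounded:
  fixes \<psi> :: "'a::euclidean_space \<Rightarrow> real"
  assumes "compact S" "continuous_on UNIV \<psi>" "\<And>x. x \<notin> S \<Longrightarrow> \<psi> x = 0"
  obtains B where "B > 0" "\<And>x. \<bar>\<psi> x\<bar> \<le> B"
proof -
  have "bounded (\<psi> ` S)"
    using assms(1,2) by (intro compact_imp_bounded compact_continuous_image) (auto intro: continuous_on_subset)
  then obtain B where B: "B > 0" "\<And>x. x \<in> S \<Longrightarrow> \<bar>\<psi> x\<bar> \<le> B"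
    unfolding bounded_pos by auto
  have "\<bar>\<psi> x\<bar> \<le> B" for x
    using B assms(3)[of x] by (cases "x \<in> S") auto
  with B(1) show ?thesis by (rule that)
qed

lemma test_function_bounded:
  assumes \<phi>: "\<phi> \<in> test_functions C"
  obtains B where "B > 0" "\<And>x. \<bar>\<phi> x\<bar> \<le> B" "\<And>x. \<bar>frechet_derivative \<phi> (at x) v\<bar> \<le> B"
proof -
  obtain S where S: "compact S" "\<And>x. x \<notin> S \<Longrightarrow> \<phi> x = 0" "\<And>x v. x \<notin> S \<Longrightarrow> frechet_derivative \<phi> (at x) v = 0"
    using test_function_properties[OF \<phi>] by metis
  obtain B where B: "B > 0" "\<And>x. \<bar>\<phi> x\<bar> \<le> B"
    using compactly_supported_bounded[OF S(1) test_function_continuous[OF \<phi>] S(2)] by metis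
  obtain B' where B': "B' > 0" "\<And>x. \<bar>frechet_derivative \<phi> (at x) v\<bar> \<le> B'"
    using compactly_supported_bounded[OF S(1) test_function_deriv_continuous[OF \<phi>] S(3)] by metis
  show ?thesis
  proof (rule that[of "max B B'"])
    show "max B B' > 0" using B(1) by simp
    show "\<bar>\<phi> x\<bar> \<le> max B B'" for x using B(2)[of x] by simp
    show "\<bar>frechet_derivative \<phi> (at x) v\<bar> \<le> max B B'" for x using B'(2)[of x] by simp
  qed
qed

lemma locally_integrable_times_test:
  fixes f \<psi> :: "'a::euclidean_space \<Rightarrow> real"
  assumes "locally_integrable C f" "compact S" "S \<subseteq> C" "continuous_on UNIV \<psi>" "\<And>x. x \<notin> S \<Longrightarrow> \<psi> x = 0"
  shows "set_integrable lebesgue C (\<lambda>x. f x * \<psi> x)"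
proof -
  obtain B where B: "B > 0" "\<And>x. \<bar>\<psi> x\<bar> \<le> B"
    using compactly_supported_bounded[OF assms(2,4,5)] by metis
  have f: "integrable lebesgue (\<lambda>x. indicator S x *\<^sub>R f x)"
    using assms(1-3) by (simp add: locally_integrable_def set_integrable_def)
  have "\<psi> \<in> borel_measurable lborel"
    using assms(4) borel_measurable_continuous_onI by simp
  then have \<psi>: "\<psi> \<in> borel_measurable lebesgue" by (rule measurable_completion)
  have "integrable lebesgue (\<lambda>x. (indicator S x *\<^sub>R f x) * \<psi> x)"
  proof (rule Bochner_Integration.integrable_bound)
    show "integrable lebesgue (\<lambda>x. B * (indicator S x *\<^sub>R f x))" using f by simp
    show "(\<lambda>x. (indicator S x *\<^sub>R f x) * \<psi> x) \<in> borel_measurable lebesgue"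
      using borel_measurable_integrable[OF f] \<psi> by (rule borel_measurable_times)
    show "AE x in lebesgue. norm ((indicator S x *\<^sub>R f x) * \<psi> x) \<le> norm (B * (indicator S x *\<^sub>R f x))"
      using B by (intro AE_I2) (simp add: abs_mult mult.commute mult_right_mono)
  qed
  moreover have "(\<lambda>x. (indicator S x *\<^sub>R f x) * \<psi> x) = (\<lambda>x. indicator C x *\<^sub>R (f x * \<psi> x))"
  proof
    fix x show "(indicator S x *\<^sub>R f x) * \<psi> x = indicator C x *\<^sub>R (f x * \<psi> x)"
      using assms(3) assms(5)[of x] by (cases "x \<in> S") (auto simp: indicator_def)
  qed
  ultimately show ?thesis by (simp add: set_integrable_def)
qed

lemma measure_lebesgue_small_cube:
  "h \<ge> 0 \<Longrightarrow> measure lebesgue (box x (x + h *\<^sub>R One)) = h ^ DIM('a)" for x :: "'a::euclidean_space"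
  by (simp add: measure_lborel_box_eq inner_add_left)

text \<open>
  The bumps converge to the indicator of a box, so the tested inequality holds in integrated form on
  every box; shrinking cubes to a point then gives it pointwise by the Lebesgue differentiation
  theorem.
\<close>

lemma AE_le_if_tested:
  fixes C :: "'a::euclidean_space set"
  assumes C: "open C" and g: "locally_integrable C g"
    and test: "\<And>\<phi>. \<phi> \<in> test_functions C \<Longrightarrow> (\<And>x. 0 \<le> \<phi> x) \<Longrightarrow>
      (LINT x:C|lebesgue. g x * \<phi> x) \<le> c * (LINT x:C|lebesgue. \<phi> x)"
  shows "AE x in lebesgue. x \<in> C \<longrightarrow> g x \<le> c"
proof -
  have box: "(LINT x:box a b|lebesgue. g x) \<le> c * measure lebesgue (box a b)" if ab: "cbox a b \<subseteq> C" for a b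
  proof -
    have g_int: "integrable lebesgue (\<lambda>x. indicator (cbox a b) x *\<^sub>R g x)"
      using g ab by (simp add: locally_integrable_def set_integrable_def)
    have bump_meas: "box_bump a b n \<in> borel_measurable lebesgue" for n
      using C_k_continuous[OF C_k_box_bump[of 0 a b n]] borel_measurable_continuous_onI
      by (intro measurable_completion) simp
    have box_meas: "(indicator (box a b) :: 'a \<Rightarrow> real) \<in> borel_measurable lebesgue"
      by (intro measurable_completion) simp
    have bump_out: "box_bump a b n x = 0" if "x \<notin> cbox a b" for x n
      using that box_bump_nonzero_iff[of a b n x] box_subset_cbox[of a b] by blast
    have "(\<lambda>n. \<integral>x. (indicator (cbox a b) x *\<^sub>R g x) * box_bump a b n x \<partial>lebesgue)
        \<longlonglongrightarrow> (\<integral>x. (indicator (cbox a b) x *\<^sub>R g x) * indicator (box a b) x \<partial>lebesgue)"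
    proof (rule integral_dominated_convergence[where w="\<lambda>x. \<bar>indicator (cbox a b) x *\<^sub>R g x\<bar>"])
      show "(\<lambda>x. (indicator (cbox a b) x *\<^sub>R g x) * indicator (box a b) x) \<in> borel_measurable lebesgue"
        using borel_measurable_integrable[OF g_int] box_meas by (rule borel_measurable_times)
      show "(\<lambda>x. (indicator (cbox a b) x *\<^sub>R g x) * box_bump a b n x) \<in> borel_measurable lebesgue" for n
        using borel_measurable_integrable[OF g_int] bump_meas by (rule borel_measurable_times)
      show "integrable lebesgue (\<lambda>x. \<bar>indicator (cbox a b) x *\<^sub>R g x\<bar>)" using g_int by (rule integrable_abs)
      show "AE x in lebesgue. (\<lambda>n. (indicator (cbox a b) x *\<^sub>R g x) * box_bump a b n x)
          \<longlonglongrightarrow> (indicator (cbox a b) x *\<^sub>R g x) * indicator (box a b) x"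
        by (intro AE_I2 tendsto_mult tendsto_const box_bump_tendsto)
      show "AE x in lebesgue. norm ((indicator (cbox a b) x *\<^sub>R g x) * box_bump a b n x)
          \<le> \<bar>indicator (cbox a b) x *\<^sub>R g x\<bar>" for n
        using box_bump_nonneg[of a b n] box_bump_le_1[of a b n]
        by (intro AE_I2) (simp add: abs_mult mult_left_le)
    qed
    moreover have "(\<lambda>x. (indicator (cbox a b) x *\<^sub>R g x) * indicator (box a b) x) = (\<lambda>x. indicator (box a b) x *\<^sub>R g x)"
      using box_subset_cbox[of a b] by (auto simp: fun_eq_iff indicator_def)
    moreover have "(\<lambda>x. (indicator (cbox a b) x *\<^sub>R g x) * box_bump a b n x) = (\<lambda>x. indicator C x *\<^sub>R (g x * box_bump a b n x))" for n
      using bump_out ab by (auto simp: fun_eq_iff indicator_def)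
    ultimately have lim1: "(\<lambda>n. LINT x:C|lebesgue. g x * box_bump a b n x) \<longlonglongrightarrow> (LINT x:box a b|lebesgue. g x)"
      by (simp only: set_lebesgue_integral_def)
    have "(\<lambda>n. \<integral>x. box_bump a b n x \<partial>lebesgue) \<longlonglongrightarrow> (\<integral>x. indicator (box a b) x \<partial>lebesgue)"
    proof (rule integral_dominated_convergence[where w="indicator (cbox a b)"])
      show "(indicator (box a b) :: 'a \<Rightarrow> real) \<in> borel_measurable lebesgue" by (rule box_meas)
      show "integrable lebesgue (indicator (cbox a b) :: 'a \<Rightarrow> real)"
        using fmeasurable_cbox[of a b] by (simp add: fmeasurable_def less_top[symmetric])
      show "AE x in lebesgue. (\<lambda>n. box_bump a b n x) \<longlonglongrightarrow> indicator (box a b) x"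
        by (intro AE_I2 box_bump_tendsto)
      show "AE x in lebesgue. norm (box_bump a b n x) \<le> indicator (cbox a b) x" for n
        using box_bump_nonneg[of a b n] box_bump_le_1[of a b n] bump_out
        by (intro AE_I2) (auto simp: indicator_def)
    qed (rule bump_meas)
    moreover have "(LINT x:C|lebesgue. box_bump a b n x) = (\<integral>x. box_bump a b n x \<partial>lebesgue)" for n
      unfolding set_lebesgue_integral_def using bump_out ab
      by (intro Bochner_Integration.integral_cong) (auto simp: indicator_def)
    ultimately have "(\<lambda>n. c * (LINT x:C|lebesgue. box_bump a b n x)) \<longlonglongrightarrow> c * measure lebesgue (box a b)"
      by (intro tendsto_mult tendsto_const) simp
    with lim1 show ?thesis
      by (rule LIMSEQ_le) (use test box_bump_test_function[OF ab] box_bump_nonneg in blast)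
  qed
  have "AE x in lebesgue. x \<in> cbox a b \<longrightarrow> g x \<le> c" if ab: "cbox a b \<subseteq> C" for a b
  proof -
    define G where "G x = indicator (cbox a b) x *\<^sub>R g x" for x
    have G: "integrable lebesgue G"
      using g ab by (simp add: G_def[abs_def] locally_integrable_def set_integrable_def)
    have G_cbox: "set_integrable lebesgue (cbox x y) G" for x y
      unfolding set_integrable_def using G by (intro integrable_mult_indicator) auto
    have "G integrable_on cbox x y" for x y
      using G_cbox by (rule set_lebesgue_integral_eq_integral(1))
    then obtain N where N: "negligible N" and lebesgue_pt: "\<And>x e. \<lbrakk>x \<notin> N; 0 < e\<rbrakk> \<Longrightarrow>
        \<exists>d>0. \<forall>h. 0 < h \<and> h < d \<longrightarrow> norm (integral (cbox x (x + h *\<^sub>R One)) G /\<^sub>R h ^ DIM('a) - G x) < e"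
      using integrable_ccontinuous_explicit[of G] by blast
    have le_c: "g x \<le> c" if x: "x \<in> box a b" "x \<notin> N" for x
    proof (rule field_le_epsilon)
      fix e :: real assume "e > 0"
      from lebesgue_pt[OF x(2) this] obtain d where d: "d > 0" "\<forall>h. 0 < h \<and> h < d \<longrightarrow>
          norm (integral (cbox x (x + h *\<^sub>R One)) G /\<^sub>R h ^ DIM('a) - G x) < e"
        by blast
      have "((\<lambda>h. x + h *\<^sub>R One) \<longlongrightarrow> x + 0 *\<^sub>R One) (at_right 0)" by (intro tendsto_intros)
      then have "\<forall>\<^sub>F h in at_right 0. x + h *\<^sub>R One \<in> box a b"
        using x(1) by (intro topological_tendstoD open_box) auto
      moreover have "\<forall>\<^sub>F h in at_right 0. 0 < h \<and> h < d"
        using d(1) by (auto simp: eventually_at_right_field)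
      ultimately have "\<forall>\<^sub>F h in at_right 0. x + h *\<^sub>R One \<in> box a b \<and> 0 < h \<and> h < d"
        by eventually_elim auto
      then obtain h where h: "x + h *\<^sub>R One \<in> box a b" "0 < h" "h < d"
        using eventually_happens[of _ "at_right (0::real)"] by (auto simp: trivial_limit_at_right_real)
      have sub: "cbox x (x + h *\<^sub>R One) \<subseteq> cbox a b"
      proof
        fix y assume "y \<in> cbox x (x + h *\<^sub>R One)"
        then have "x \<bullet> i \<le> y \<bullet> i" "y \<bullet> i \<le> (x + h *\<^sub>R One) \<bullet> i" if "i \<in> Basis" for i
          using that by (auto simp: mem_box)
        moreover have "a \<bullet> i < x \<bullet> i" "(x + h *\<^sub>R One) \<bullet> i < b \<bullet> i" if "i \<in> Basis" for i
          using that x(1) h(1) by (auto simp: mem_box)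
        ultimately show "y \<in> cbox a b" unfolding mem_box by (meson le_less_trans less_le_trans less_imp_le)
      qed
      have "integral (cbox x (x + h *\<^sub>R One)) G = integral (box x (x + h *\<^sub>R One)) G"
        by (rule integral_open_interval[symmetric])
      also have "\<dots> = (LINT x:box x (x + h *\<^sub>R One)|lebesgue. G x)"
        by (rule set_lebesgue_integral_eq_integral(2)[symmetric])
          (rule set_integrable_subset[OF G_cbox[of x "x + h *\<^sub>R One"]], auto simp: box_subset_cbox)
      also have "\<dots> = (LINT x:box x (x + h *\<^sub>R One)|lebesgue. g x)"
        unfolding set_lebesgue_integral_def G_def using sub box_subset_cbox[of x "x + h *\<^sub>R One"]
        by (intro Bochner_Integration.integral_cong) (auto simp: indicator_def)
      also have "\<dots> \<le> c * measure lebesgue (box x (x + h *\<^sub>R One))"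
        using sub ab by (intro box) auto
      also have "\<dots> = c * h ^ DIM('a)" using h(2) measure_lebesgue_small_cube[of h x] by simp
      finally have "integral (cbox x (x + h *\<^sub>R One)) G /\<^sub>R h ^ DIM('a) \<le> c"
        using h(2) by (simp add: field_simps)
      moreover have "G x = g x" using x(1) box_subset_cbox[of a b] by (auto simp: G_def)
      ultimately show "g x \<le> c + e" using d(2)[rule_format, OF conjI[OF h(2,3)]] by (simp add: abs_less_iff)
    qed
    have "N \<union> (cbox a b - box a b) \<in> null_sets lebesgue"
      using N negligible_frontier_interval[of a b] by (simp add: negligible_iff_null_sets[symmetric])
    then have "AE x in lebesgue. x \<notin> N \<union> (cbox a b - box a b)" by (rule AE_not_in)
    then show ?thesis
    proof eventually_elim
      case (elim x)
      then show ?case using le_c[of x] by blast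
    qed
  qed
  moreover obtain \<D> where "countable \<D>" "\<D> \<subseteq> Pow C" "\<And>X. X \<in> \<D> \<Longrightarrow> \<exists>a b. X = cbox a b" "\<Union>\<D> = C"
    using open_countable_Union_open_cbox[OF C] by blast
  ultimately have ae: "AE x in lebesgue. x \<in> X \<longrightarrow> g x \<le> c" if "X \<in> \<D>" for X
    using that by (metis Pow_iff subsetD)
  have "AE x in lebesgue. \<forall>X\<in>\<D>. x \<in> X \<longrightarrow> g x \<le> c"
    using ae \<open>countable \<D>\<close> by (subst AE_ball_countable) blast+
  then show ?thesis
  proof eventually_elim
    case (elim x)
    then show ?case using \<open>\<Union>\<D> = C\<close> by blast
  qed
qed

section \<open>From weak gradients to Lipschitz bounds\<close>

lemma lebesgue_translate:
  fixes f :: "'a::euclidean_space \<Rightarrow> real"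
  assumes f: "f \<in> borel_measurable borel"
  shows "(\<integral>x. f (x + y) \<partial>lebesgue) = (\<integral>x. f x \<partial>lebesgue)"
    and "integrable lebesgue (\<lambda>x. f (x + y)) \<longleftrightarrow> integrable lebesgue f"
proof -
  have distr: "distr lborel borel (\<lambda>x. x + y) = lborel"
  proof -
    have "(\<lambda>x. x + y) = (+) y" by (simp add: fun_eq_iff)
    then show ?thesis using lborel_distr_plus[of y] by simp
  qed
  have [measurable]: "(\<lambda>x. x + y) \<in> borel \<rightarrow>\<^sub>M borel" "(\<lambda>x. f (x + y)) \<in> borel_measurable borel"
    using f by measurable
  have "(\<integral>x. f (x + y) \<partial>lborel) = (\<integral>x. f x \<partial>distr lborel borel (\<lambda>x. x + y))"
    using f by (intro integral_distr[symmetric]) auto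
  then show "(\<integral>x. f (x + y) \<partial>lebesgue) = (\<integral>x. f x \<partial>lebesgue)"
    using f by (simp add: distr integral_completion)
  have "integrable lborel (\<lambda>x. f (x + y)) \<longleftrightarrow> integrable (distr lborel borel (\<lambda>x. x + y)) f"
    using f by (intro integrable_distr_eq[symmetric]) auto
  then show "integrable lebesgue (\<lambda>x. f (x + y)) \<longleftrightarrow> integrable lebesgue f"
    using f by (simp add: distr integrable_completion)
qed

lemma test_function_borel: "\<phi> \<in> test_functions C \<Longrightarrow> \<phi> \<in> borel_measurable borel"
  by (rule borel_measurable_continuous_onI[OF test_function_continuous])

lemma test_function_deriv_borel:
  "\<phi> \<in> test_functions C \<Longrightarrow> (\<lambda>x. frechet_derivative \<phi> (at x) v) \<in> borel_measurable borel"
  by (rule borel_measurable_continuous_onI[OF test_function_deriv_continuous])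

lemma integrable_times_bounded:
  fixes u \<psi> :: "'a::euclidean_space \<Rightarrow> real"
  assumes u: "integrable lebesgue u" and \<psi>: "\<psi> \<in> borel_measurable borel" "\<And>x. \<bar>\<psi> x\<bar> \<le> B"
  shows "integrable lebesgue (\<lambda>x. u x * \<psi> x)"
proof (rule Bochner_Integration.integrable_bound)
  show "integrable lebesgue (\<lambda>x. u x * B)" using u by simp
  have "\<psi> \<in> borel_measurable lebesgue" using \<psi>(1) by (intro measurable_completion) simp
  with borel_measurable_integrable[OF u] show "(\<lambda>x. u x * \<psi> x) \<in> borel_measurable lebesgue"
    by (rule borel_measurable_times)
  have "norm (u x * \<psi> x) \<le> norm (u x * B)" for x
    using \<psi>(2)[of x] by (simp add: abs_mult mult_left_mono)
  then show "AE x in lebesgue. norm (u x * \<psi> x) \<le> norm (u x * B)" by simp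
qed

lemma test_function_along_line:
  assumes \<phi>: "\<phi> \<in> test_functions C"
  shows "((\<lambda>s. \<phi> (x - s *\<^sub>R v)) has_real_derivative - frechet_derivative \<phi> (at (x - s *\<^sub>R v)) v) (at s)"
proof -
  interpret bounded_linear "frechet_derivative \<phi> (at (x - s *\<^sub>R v))"
    by (rule has_derivative_bounded_linear[OF test_function_differentiable[OF \<phi>]])
  have "((\<lambda>s. x - s *\<^sub>R v) has_derivative (\<lambda>h. - (h *\<^sub>R v))) (at s)"
    by (auto intro!: derivative_eq_intros)
  from has_derivative_compose[OF this test_function_differentiable[OF \<phi>]]
  have "((\<lambda>s. \<phi> (x - s *\<^sub>R v)) has_derivative (\<lambda>h. frechet_derivative \<phi> (at (x - s *\<^sub>R v)) (- (h *\<^sub>R v)))) (at s)" .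
  moreover have "(\<lambda>h. frechet_derivative \<phi> (at (x - s *\<^sub>R v)) (- (h *\<^sub>R v)))
      = (*) (- frechet_derivative \<phi> (at (x - s *\<^sub>R v)) v)"
    by (simp add: fun_eq_iff neg scaleR)
  ultimately show ?thesis by (simp add: has_field_derivative_def)
qed

text \<open>
  The derivative falls on the smooth factor, so integrability of \<open>u\<close> suffices: the difference
  quotients of the test function are dominated by a bound of its derivative.
\<close>

lemma smoothing_has_real_derivative:
  assumes u: "integrable lebesgue u" and \<phi>: "\<phi> \<in> test_functions C"
  shows "((\<lambda>t. \<integral>x. u x * \<phi> (x - t *\<^sub>R v) \<partial>lebesgue) has_real_derivative
      - (\<integral>x. u x * frechet_derivative \<phi> (at (x - t *\<^sub>R v)) v \<partial>lebesgue)) (at t)"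
proof -
  obtain B where B: "B > 0" "\<And>x. \<bar>\<phi> x\<bar> \<le> B" "\<And>x. \<bar>frechet_derivative \<phi> (at x) v\<bar> \<le> B"
    by (rule test_function_bounded[OF \<phi>, of v]) metis
  have [measurable]: "\<phi> \<in> borel_measurable borel" by (rule test_function_borel[OF \<phi>])
  have [measurable]: "(\<lambda>x. frechet_derivative \<phi> (at x) v) \<in> borel_measurable borel"
    by (rule test_function_deriv_borel[OF \<phi>])
  have u_meas: "u \<in> borel_measurable lebesgue" using u by (rule borel_measurable_integrable)
  have int: "integrable lebesgue (\<lambda>x. u x * \<phi> (x - s *\<^sub>R v))" for s
    using B(2) by (intro integrable_times_bounded[OF u]) measurable
  have lip: "\<bar>\<phi> (x - a *\<^sub>R v) - \<phi> (x - b *\<^sub>R v)\<bar> \<le> B * \<bar>a - b\<bar>" for x a b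
    using field_differentiable_bound[of UNIV "\<lambda>s. \<phi> (x - s *\<^sub>R v)"
        "\<lambda>s. - frechet_derivative \<phi> (at (x - s *\<^sub>R v)) v" B a b]
      test_function_along_line[OF \<phi>] B(3) by simp
  show ?thesis
    unfolding DERIV_def tendsto_at_iff_sequentially
  proof (intro allI impI)
    fix X :: "nat \<Rightarrow> real" assume X: "\<forall>i. X i \<in> UNIV - {0}" "X \<longlonglongrightarrow> 0"
    define q where "q n x = (\<phi> (x - (t + X n) *\<^sub>R v) - \<phi> (x - t *\<^sub>R v)) / X n" for n x
    have [measurable]: "q n \<in> borel_measurable borel" for n unfolding q_def[abs_def] by measurable
    have "(\<lambda>n. \<integral>x. u x * q n x \<partial>lebesgue) \<longlonglongrightarrow> (\<integral>x. u x * (- frechet_derivative \<phi> (at (x - t *\<^sub>R v)) v) \<partial>lebesgue)"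
    proof (rule integral_dominated_convergence[where w="\<lambda>x. \<bar>u x\<bar> * B"])
      have "(\<lambda>x. - frechet_derivative \<phi> (at (x - t *\<^sub>R v)) v) \<in> borel_measurable lborel" by measurable
      from borel_measurable_times[OF u_meas measurable_completion[OF this]]
      show "(\<lambda>x. u x * (- frechet_derivative \<phi> (at (x - t *\<^sub>R v)) v)) \<in> borel_measurable lebesgue" .
      have "q n \<in> borel_measurable lborel" for n by measurable
      from borel_measurable_times[OF u_meas measurable_completion[OF this]]
      show "(\<lambda>x. u x * q n x) \<in> borel_measurable lebesgue" for n .
      show "integrable lebesgue (\<lambda>x. \<bar>u x\<bar> * B)" using u by simp
      have "(\<lambda>n. q n x) \<longlonglongrightarrow> - frechet_derivative \<phi> (at (x - t *\<^sub>R v)) v" for x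
      proof -
        have "((\<lambda>h. (\<phi> (x - (t + h) *\<^sub>R v) - \<phi> (x - t *\<^sub>R v)) / h) \<longlongrightarrow> - frechet_derivative \<phi> (at (x - t *\<^sub>R v)) v) (at 0)"
          using test_function_along_line[OF \<phi>, of x v t] by (simp only: DERIV_def)
        then show ?thesis using X by (simp add: tendsto_at_iff_sequentially q_def o_def)
      qed
      then show "AE x in lebesgue. (\<lambda>n. u x * q n x) \<longlonglongrightarrow> u x * (- frechet_derivative \<phi> (at (x - t *\<^sub>R v)) v)"
        by (intro AE_I2 tendsto_mult tendsto_const)
      have "\<bar>q n x\<bar> \<le> B" for n x
        using lip[of x "t + X n" t] X(1) by (simp add: q_def field_simps)
      then show "AE x in lebesgue. norm (u x * q n x) \<le> \<bar>u x\<bar> * B" for n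
        by (intro AE_I2) (simp add: abs_mult mult_left_mono)
    qed
    moreover have "(\<integral>x. u x * q n x \<partial>lebesgue)
        = ((\<integral>x. u x * \<phi> (x - (t + X n) *\<^sub>R v) \<partial>lebesgue) - (\<integral>x. u x * \<phi> (x - t *\<^sub>R v) \<partial>lebesgue)) / X n" for n
    proof -
      have "(\<integral>x. u x * q n x \<partial>lebesgue) = (\<integral>x. (u x * \<phi> (x - (t + X n) *\<^sub>R v) - u x * \<phi> (x - t *\<^sub>R v)) / X n \<partial>lebesgue)"
        by (intro Bochner_Integration.integral_cong) (auto simp: q_def right_diff_distrib)
      then show ?thesis using int by simp
    qed
    ultimately show "((\<lambda>h. ((\<integral>x. u x * \<phi> (x - (t + h) *\<^sub>R v) \<partial>lebesgue) - (\<integral>x. u x * \<phi> (x - t *\<^sub>R v) \<partial>lebesgue)) / h) \<circ> X)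
        \<longlonglongrightarrow> - (\<integral>x. u x * frechet_derivative \<phi> (at (x - t *\<^sub>R v)) v \<partial>lebesgue)"
      by (simp add: o_def)
  qed
qed

lemma inner_basis_expansion: "g \<bullet> v = (\<Sum>i\<in>Basis. (v \<bullet> i) * (g \<bullet> i))" for g v :: "'a::euclidean_space"
  by (subst euclidean_inner) (simp add: mult.commute)

lemma weak_gradient_locally_integrable:
  fixes g :: "'a::euclidean_space \<Rightarrow> 'a"
  assumes "\<forall>i\<in>Basis. weak_partial C f i (\<lambda>x. g x \<bullet> i)"
  shows "locally_integrable C f" "locally_integrable C (\<lambda>x. g x \<bullet> v)"
proof -
  show "locally_integrable C f" using assms nonempty_Basis unfolding weak_partial_def by blast
  show "locally_integrable C (\<lambda>x. g x \<bullet> v)"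
    unfolding locally_integrable_def
  proof (intro allI impI)
    fix S assume S: "compact S \<and> S \<subseteq> C"
    have "integrable lebesgue (\<lambda>x. \<Sum>i\<in>Basis. (v \<bullet> i) * (indicator S x *\<^sub>R (g x \<bullet> i)))"
      using assms S
      by (intro Bochner_Integration.integrable_sum integrable_mult_right)
        (auto simp: weak_partial_def locally_integrable_def set_integrable_def)
    moreover have "(\<lambda>x. \<Sum>i\<in>Basis. (v \<bullet> i) * (indicator S x *\<^sub>R (g x \<bullet> i))) = (\<lambda>x. indicator S x *\<^sub>R (g x \<bullet> v))"
      by (simp add: inner_basis_expansion[of _ v] sum_distrib_left mult.left_commute)
    ultimately show "set_integrable lebesgue S (\<lambda>x. g x \<bullet> v)" by (simp add: set_integrable_def)
  qed
qed

text \<open>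
  Both sides are linear in the direction, so the defining identity for basis vectors extends to all
  directions.
\<close>

lemma weak_gradient_directional:
  fixes g :: "'a::euclidean_space \<Rightarrow> 'a"
  assumes wp: "\<forall>i\<in>Basis. weak_partial C f i (\<lambda>x. g x \<bullet> i)" and \<phi>: "\<phi> \<in> test_functions C"
  shows "(LINT x:C|lebesgue. f x * frechet_derivative \<phi> (at x) v) = - (LINT x:C|lebesgue. (g x \<bullet> v) * \<phi> x)"
proof -
  obtain S where S: "compact S" "S \<subseteq> C" "\<And>x. x \<notin> S \<Longrightarrow> \<phi> x = 0"
      "\<And>x v. x \<notin> S \<Longrightarrow> frechet_derivative \<phi> (at x) v = 0"
    by (rule test_function_properties[OF \<phi>]) metis
  have f: "integrable lebesgue (\<lambda>x. indicator C x *\<^sub>R (f x * frechet_derivative \<phi> (at x) i))" for i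
    using locally_integrable_times_test[OF weak_gradient_locally_integrable(1)[OF wp] S(1,2)
        test_function_deriv_continuous[OF \<phi>, of i] S(4)] by (simp add: set_integrable_def)
  have g: "integrable lebesgue (\<lambda>x. indicator C x *\<^sub>R ((g x \<bullet> i) * \<phi> x))" for i
    using locally_integrable_times_test[OF weak_gradient_locally_integrable(2)[OF wp] S(1,2)
        test_function_continuous[OF \<phi>] S(3)] by (simp add: set_integrable_def)
  have "(LINT x:C|lebesgue. f x * frechet_derivative \<phi> (at x) v)
      = (\<integral>x. (\<Sum>i\<in>Basis. (v \<bullet> i) * (indicator C x *\<^sub>R (f x * frechet_derivative \<phi> (at x) i))) \<partial>lebesgue)"
    unfolding set_lebesgue_integral_def
      frechet_derivative_basis_expansion[OF test_function_differentiable[OF \<phi>], of _ v]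
    by (simp add: sum_distrib_left mult_ac)
  also have "\<dots> = (\<Sum>i\<in>Basis. (v \<bullet> i) * (LINT x:C|lebesgue. f x * frechet_derivative \<phi> (at x) i))"
    unfolding set_lebesgue_integral_def using f
    by (subst Bochner_Integration.integral_sum) (intro integrable_mult_right f, simp)
  also have "\<dots> = (\<Sum>i\<in>Basis. (v \<bullet> i) * - (LINT x:C|lebesgue. (g x \<bullet> i) * \<phi> x))"
    using wp \<phi> by (intro sum.cong refl) (simp add: weak_partial_def)
  also have "\<dots> = - (\<Sum>i\<in>Basis. (v \<bullet> i) * (LINT x:C|lebesgue. (g x \<bullet> i) * \<phi> x))"
    by (simp add: sum_negf)
  also have "(\<Sum>i\<in>Basis. (v \<bullet> i) * (LINT x:C|lebesgue. (g x \<bullet> i) * \<phi> x))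
      = (\<integral>x. (\<Sum>i\<in>Basis. (v \<bullet> i) * (indicator C x *\<^sub>R ((g x \<bullet> i) * \<phi> x))) \<partial>lebesgue)"
    unfolding set_lebesgue_integral_def using g
    by (subst Bochner_Integration.integral_sum) (intro integrable_mult_right g, simp)
  also have "\<dots> = (LINT x:C|lebesgue. (g x \<bullet> v) * \<phi> x)"
    unfolding set_lebesgue_integral_def
    by (simp add: inner_basis_expansion[of _ v] sum_distrib_left sum_distrib_right mult_ac)
  finally show ?thesis .
qed

lemma test_function_translate:
  assumes \<phi>: "\<phi> \<in> test_functions C" and w: "\<And>x. x \<in> C \<Longrightarrow> x + w \<in> C"
  shows "(\<lambda>x. \<phi> (x - w)) \<in> test_functions C"
proof -
  have "{x. \<phi> (x - w) \<noteq> 0} = (+) w ` {x. \<phi> x \<noteq> 0}"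
    by (auto simp: image_iff) (metis add_diff_cancel_left' add.commute diff_add_cancel)
  then have *: "closure {x. \<phi> (x - w) \<noteq> 0} = (+) w ` closure {x. \<phi> x \<noteq> 0}"
    by (simp only: closure_translation)
  have "C_k k (\<lambda>x. \<phi> (x - w))" for k
    using \<phi> by (intro C_k_translate) (simp add: test_functions_def)
  moreover have "compact (closure {x. \<phi> (x - w) \<noteq> 0})"
    unfolding * using \<phi> by (intro compact_translation) (simp add: test_functions_def)
  moreover have "closure {x. \<phi> (x - w) \<noteq> 0} \<subseteq> C"
    unfolding * using \<phi> w by (auto simp: test_functions_def add.commute)
  ultimately show ?thesis by (simp add: test_functions_def)
qed

lemma set_integral_test_support:
  fixes f \<psi> :: "'a::euclidean_space \<Rightarrow> real"
  assumes "\<And>x. x \<notin> C \<Longrightarrow> \<psi> x = 0" shows "(LINT x:C|lebesgue. f x * \<psi> x) = (\<integral>x. f x * \<psi> x \<partial>lebesgue)"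
  unfolding set_lebesgue_integral_def using assms
  by (intro Bochner_Integration.integral_cong) (auto simp: indicator_def)

locale body_and_cone = symmetric_body K for K :: "'a::euclidean_space set" +
  fixes C :: "'a set"
  assumes C_nonempty: "C \<noteq> {}" and open_C: "open C" and convex_C: "convex C" and cone_C: "pos_cone C"
begin

lemma scale_in_C: "x \<in> C \<Longrightarrow> t > 0 \<Longrightarrow> t *\<^sub>R x \<in> C"
  using cone_C by (simp add: pos_cone_def)

lemma add_in_C: assumes "x \<in> C" "y \<in> C" shows "x + y \<in> C"
proof -
  have "(1/2) *\<^sub>R x + (1/2) *\<^sub>R y \<in> C" using assms by (intro convexD[OF convex_C]) auto
  from scale_in_C[OF this, of 2] show ?thesis by (simp add: scaleR_add_right)
qed

lemma C_borel [measurable]: "C \<in> sets borel"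
  using open_C by simp

lemma C_lebesgue: "C \<in> sets lebesgue"
  using C_borel by simp

text \<open>
  Only increments in directions of the cone are compared: translating a test function along such a
  direction keeps its support inside the cone.
\<close>

lemma smoothed_increment_bound:
  assumes u: "integrable lebesgue u" and wp: "\<forall>i\<in>Basis. weak_partial C u i (\<lambda>x. g x \<bullet> i)"
    and G: "AE x in lebesgue. x \<in> C \<longrightarrow> dual_norm K (g x) \<le> G" and y: "y \<in> C"
    and \<phi>: "\<phi> \<in> test_functions C" "\<And>x. 0 \<le> \<phi> x"
  shows "\<bar>(\<integral>x. u x * \<phi> (x - y) \<partial>lebesgue) - (\<integral>x. u x * \<phi> x \<partial>lebesgue)\<bar> \<le> G * p y * (\<integral>x. \<phi> x \<partial>lebesgue)"
proof -
  define F where "F t = (\<integral>x. u x * \<phi> (x - t *\<^sub>R y) \<partial>lebesgue)" for t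
  define F' where "F' t = - (\<integral>x. u x * frechet_derivative \<phi> (at (x - t *\<^sub>R y)) y \<partial>lebesgue)" for t
  have deriv: "(F has_real_derivative F' t) (at t)" for t
    unfolding F_def[abs_def] F'_def by (rule smoothing_has_real_derivative[OF u \<phi>(1)])
  have bound: "\<bar>F' t\<bar> \<le> G * p y * (\<integral>x. \<phi> x \<partial>lebesgue)" if t: "0 < t" for t
  proof -
    define \<phi>t where "\<phi>t x = \<phi> (x - t *\<^sub>R y)" for x
    have \<phi>t: "\<phi>t \<in> test_functions C"
      unfolding \<phi>t_def[abs_def] using y t by (intro test_function_translate[OF \<phi>(1)] add_in_C scale_in_C)
    have "frechet_derivative \<phi> (at (x - t *\<^sub>R y)) y = frechet_derivative \<phi>t (at x) y" for x
      unfolding \<phi>t_def[abs_def] using test_function_differentiable[OF \<phi>(1)]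
      by (intro frechet_derivative_eqI[symmetric] has_derivative_translated) (auto simp: differentiable_def)
    then have F'_t: "F' t = - (\<integral>x. u x * frechet_derivative \<phi>t (at x) y \<partial>lebesgue)" by (simp add: F'_def)
    obtain S where S: "compact S" "S \<subseteq> C" "\<And>x. x \<notin> S \<Longrightarrow> \<phi>t x = 0"
        "\<And>x v. x \<notin> S \<Longrightarrow> frechet_derivative \<phi>t (at x) v = 0"
      by (rule test_function_properties[OF \<phi>t]) metis
    have off: "\<phi>t x = 0" "frechet_derivative \<phi>t (at x) y = 0" if "x \<notin> C" for x
      using S(2-4) that by blast+
    have "F' t = - (LINT x:C|lebesgue. u x * frechet_derivative \<phi>t (at x) y)"
      using F'_t set_integral_test_support[of C "\<lambda>x. frechet_derivative \<phi>t (at x) y" u] off by simp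
    also have "\<dots> = (LINT x:C|lebesgue. (g x \<bullet> y) * \<phi>t x)"
      using weak_gradient_directional[OF wp \<phi>t] by simp
    finally have F': "F' t = (LINT x:C|lebesgue. (g x \<bullet> y) * \<phi>t x)" .
    have int_g: "integrable lebesgue (\<lambda>x. indicator C x *\<^sub>R ((g x \<bullet> y) * \<phi>t x))"
      using locally_integrable_times_test[OF weak_gradient_locally_integrable(2)[OF wp] S(1,2)
          test_function_continuous[OF \<phi>t] S(3)] by (simp add: set_integrable_def)
    have "locally_integrable C (\<lambda>_. 1)"
      by (simp add: locally_integrable_def set_integrable_def lmeasurable_iff_integrable[symmetric] lmeasurable_compact)
    from locally_integrable_times_test[OF this S(1,2) test_function_continuous[OF \<phi>t] S(3)]
    have int_\<phi>: "integrable lebesgue (\<lambda>x. indicator C x *\<^sub>R \<phi>t x)" by (simp add: set_integrable_def)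
    have "\<bar>F' t\<bar> \<le> (\<integral>x. \<bar>indicator C x *\<^sub>R ((g x \<bullet> y) * \<phi>t x)\<bar> \<partial>lebesgue)"
      unfolding F' set_lebesgue_integral_def by (rule integral_abs_bound)
    also have "\<dots> \<le> (\<integral>x. (G * p y) * (indicator C x *\<^sub>R \<phi>t x) \<partial>lebesgue)"
    proof (rule integral_mono_AE)
      show "AE x in lebesgue. \<bar>indicator C x *\<^sub>R ((g x \<bullet> y) * \<phi>t x)\<bar> \<le> (G * p y) * (indicator C x *\<^sub>R \<phi>t x)"
        using G
      proof eventually_elim
        case (elim x)
        show ?case
        proof (cases "x \<in> C")
          case True
          then have "y \<bullet> g x \<le> G * p y" "(- y) \<bullet> g x \<le> G * p y"
            using elim inner_le_dual_norm[of y "g x"] inner_le_dual_norm[of "- y" "g x"] body_norm_nonneg[of y]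
            by (auto simp: body_norm_minus intro: order_trans mult_right_mono)
          then have "\<bar>g x \<bullet> y\<bar> \<le> G * p y" by (simp add: inner_commute abs_le_iff)
          then show ?thesis using True \<phi>(2) by (simp add: abs_mult \<phi>t_def mult_right_mono)
        qed simp
      qed
    qed (use int_g int_\<phi> in \<open>auto intro: integrable_abs integrable_mult_right\<close>)
    also have "\<dots> = G * p y * (LINT x:C|lebesgue. 1 * \<phi>t x)"
      by (simp add: set_lebesgue_integral_def)
    also have "(LINT x:C|lebesgue. 1 * \<phi>t x) = (\<integral>x. 1 * \<phi>t x \<partial>lebesgue)"
      using off by (intro set_integral_test_support)
    also have "\<dots> = (\<integral>x. \<phi> (x + (- (t *\<^sub>R y))) \<partial>lebesgue)" by (simp add: \<phi>t_def)
    also have "\<dots> = (\<integral>x. \<phi> x \<partial>lebesgue)" by (rule lebesgue_translate(1)[OF test_function_borel[OF \<phi>(1)]])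
    finally show ?thesis .
  qed
  obtain z where "0 < z" "F 1 - F 0 = (1 - 0) * F' z"
    using MVT2[of 0 1 F F'] deriv by (auto simp del: One_nat_def)
  then have "\<bar>F 1 - F 0\<bar> \<le> G * p y * (\<integral>x. \<phi> x \<partial>lebesgue)" using bound by simp
  then show ?thesis by (simp add: F_def)
qed

text \<open>
  Both signs of the increment are tested at once; after a translation the tested increment is the
  difference of smoothings that has just been estimated.
\<close>

lemma increment_bound:
  assumes u: "integrable lebesgue u" "u \<in> borel_measurable borel"
    and wp: "\<forall>i\<in>Basis. weak_partial C u i (\<lambda>x. g x \<bullet> i)"
    and G: "AE x in lebesgue. x \<in> C \<longrightarrow> dual_norm K (g x) \<le> G" and y: "y \<in> C"
  shows "AE x in lebesgue. x \<in> C \<longrightarrow> \<bar>u (x + y) - u x\<bar> \<le> G * p y"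
proof -
  have shift: "integrable lebesgue (\<lambda>x. u (x + y))" using u lebesgue_translate(2)[OF u(2)] by simp
  define e where "e s x = s * (u (x + y) - u x)" for s x
  have e_int: "integrable lebesgue (e s)" for s
    unfolding e_def[abs_def] using u(1) shift by auto
  have e_loc: "locally_integrable C (e s)" for s
    unfolding locally_integrable_def set_integrable_def
    using integrable_mult_indicator[OF _ e_int] by (auto intro: lmeasurable_compact fmeasurableD)
  have "AE x in lebesgue. x \<in> C \<longrightarrow> e s x \<le> G * p y" if s: "\<bar>s\<bar> = 1" for s
  proof (rule AE_le_if_tested[OF open_C e_loc])
    fix \<phi> assume \<phi>: "\<phi> \<in> test_functions C" "\<And>x. 0 \<le> \<phi> x"
    obtain B where B: "\<And>x. \<bar>\<phi> x\<bar> \<le> B" by (rule test_function_bounded[OF \<phi>(1), of 0]) metis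
    have \<phi>_meas [measurable]: "\<phi> \<in> borel_measurable borel" by (rule test_function_borel[OF \<phi>(1)])
    obtain S where "S \<subseteq> C" "\<And>x. x \<notin> S \<Longrightarrow> \<phi> x = 0"
      by (rule test_function_properties[OF \<phi>(1)]) metis
    then have off: "\<phi> x = 0" if "x \<notin> C" for x using that by blast
    have "(LINT x:C|lebesgue. e s x * \<phi> x) = (\<integral>x. e s x * \<phi> x \<partial>lebesgue)"
      using off by (rule set_integral_test_support)
    also have "\<dots> = (\<integral>x. s * (u (x + y) * \<phi> x - u x * \<phi> x) \<partial>lebesgue)"
      by (simp add: e_def algebra_simps)
    also have "\<dots> = s * ((\<integral>x. u (x + y) * \<phi> x \<partial>lebesgue) - (\<integral>x. u x * \<phi> x \<partial>lebesgue))"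
      using integrable_times_bounded[OF shift \<phi>_meas B] integrable_times_bounded[OF u(1) \<phi>_meas B] by simp
    also have "(\<integral>x. u (x + y) * \<phi> x \<partial>lebesgue) = (\<integral>x. u x * \<phi> (x - y) \<partial>lebesgue)"
    proof -
      have "(\<lambda>x. u x * \<phi> (x - y)) \<in> borel_measurable borel" using u(2) by measurable
      from lebesgue_translate(1)[OF this, of y] show ?thesis by simp
    qed
    also have "s * ((\<integral>x. u x * \<phi> (x - y) \<partial>lebesgue) - (\<integral>x. u x * \<phi> x \<partial>lebesgue))
        \<le> \<bar>s * ((\<integral>x. u x * \<phi> (x - y) \<partial>lebesgue) - (\<integral>x. u x * \<phi> x \<partial>lebesgue))\<bar>" by (rule abs_ge_self)
    also have "\<dots> \<le> G * p y * (\<integral>x. \<phi> x \<partial>lebesgue)"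
      using smoothed_increment_bound[OF u(1) wp G y \<phi>] s by (simp add: abs_mult)
    also have "(\<integral>x. \<phi> x \<partial>lebesgue) = (LINT x:C|lebesgue. \<phi> x)"
      using set_integral_test_support[of C \<phi> "\<lambda>_. 1"] off by simp
    finally show "(LINT x:C|lebesgue. e s x * \<phi> x) \<le> G * p y * (LINT x:C|lebesgue. \<phi> x)" .
  qed
  from this[of 1] this[of "-1"] show ?thesis
    by (auto simp: e_def elim!: eventually_elim2)
qed

end

section \<open>Averages over truncated cones\<close>

context body_and_cone
begin

definition sector :: "real \<Rightarrow> 'a set" where "sector h = {y \<in> C. p y < h}"

abbreviation "m \<equiv> measure lebesgue (K \<inter> C)"

lemma sector_borel [measurable]: "sector h \<in> sets borel"
proof -
  have "sector h = C \<inter> {y \<in> space borel. p y < h}" by (auto simp: sector_def)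
  then show ?thesis by simp
qed

lemma sector_eq_dilate: "h > 0 \<Longrightarrow> sector h = (\<lambda>y. h *\<^sub>R y) ` K \<inter> C"
  using in_dilate_iff by (auto simp: sector_def)

lemma shifted_set_eq: "h > 0 \<Longrightarrow> shifted_set K C h x = (\<lambda>y. x + y) ` sector h"
  by (simp add: shifted_set_def sector_eq_dilate)

lemma shifted_set_subset: "h > 0 \<Longrightarrow> x \<in> C \<Longrightarrow> shifted_set K C h x \<subseteq> C"
  by (auto simp: shifted_set_eq sector_def add_in_C)

lemma shifted_set_measurable: "h > 0 \<Longrightarrow> shifted_set K C h x \<in> sets lebesgue"
  using lebesgue_sets_translation[of "sector h" x] by (simp add: shifted_set_eq)

lemma emeasure_sector: "h > 0 \<Longrightarrow> emeasure lebesgue (sector h) = ennreal (h ^ DIM('a) * m)"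
  and sector_lmeasurable: "h > 0 \<Longrightarrow> sector h \<in> lmeasurable"
proof -
  have K1: "K \<inter> C \<in> lmeasurable"
    using open_K open_C bounded_K by (intro lmeasurable_open) (auto intro: bounded_subset)
  have e1: "emeasure lebesgue (K \<inter> C) = ennreal m"
    using K1 by (simp add: emeasure_eq_measure2)
  show e: "emeasure lebesgue (sector h) = ennreal (h ^ DIM('a) * m)" if h: "h > 0" for h
  proof -
    have "sector h = (\<lambda>y. h *\<^sub>R y + 0) ` (K \<inter> C)"
    proof safe
      fix y assume "y \<in> sector h"
      then have "y /\<^sub>R h \<in> K" "y /\<^sub>R h \<in> C" using h body_norm_less_iff[of h y] scale_in_C[of y "inverse h"]
        by (auto simp: sector_def)
      then show "y \<in> (\<lambda>y. h *\<^sub>R y + 0) ` (K \<inter> C)"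
        using h by (intro image_eqI[of _ _ "y /\<^sub>R h"]) auto
    next
      fix y assume "y \<in> K" "y \<in> C"
      then show "h *\<^sub>R y + 0 \<in> sector h"
        using h body_norm_less_iff[of h "h *\<^sub>R y"] scale_in_C[of y h] by (simp add: sector_def)
    qed
    then have "emeasure lebesgue (sector h) = \<bar>h\<bar> ^ DIM('a) * emeasure lebesgue (K \<inter> C)"
      using emeasure_lebesgue_affine[of h 0 "K \<inter> C"] by simp
    then show ?thesis using h by (simp add: e1 ennreal_mult ennreal_power)
  qed
  show "sector h \<in> lmeasurable" if "h > 0" for h
    using e[OF that] by (intro fmeasurableI) auto
qed

lemma sector_nonempty: assumes "h > 0" shows "\<exists>y. y \<in> sector h"
proof -
  obtain x where x: "x \<in> C" using C_nonempty by blast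
  define t where "t = h / (p x + 1)"
  have pos: "p x + 1 > 0" using body_norm_nonneg[of x] by simp
  then have t: "t > 0" using assms by (simp add: t_def)
  have "t * p x < h" using assms pos by (simp add: t_def field_simps)
  then show ?thesis using t x scale_in_C body_norm_scale[OF t] by (auto simp: sector_def intro!: exI[of _ "t *\<^sub>R x"])
qed

lemma sector_open: "open (sector h)"
proof -
  have "open {y. p y < h}" by (intro open_Collect_less continuous_on_body_norm continuous_on_const)
  then show ?thesis using open_C by (simp add: sector_def Collect_conj_eq open_Int)
qed

lemma m_pos: "m > 0"
proof -
  obtain y where "y \<in> sector 1" using sector_nonempty by force
  then have "\<not> negligible (sector 1)" using open_not_negligible[OF sector_open] by blast
  moreover have "sector 1 = K \<inter> C" using sector_eq_dilate[of 1] by simp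
  ultimately have "emeasure lebesgue (sector 1) \<noteq> 0"
    using sector_borel[of 1] by (simp add: negligible_iff_null_sets null_sets_def)
  then show ?thesis using emeasure_sector[of 1] by (auto simp: zero_less_measure_iff)
qed

text \<open>
  Layer-cake: \<open>h - |y|\<close> is the length of the interval of levels between \<open>|y|\<close> and \<open>h\<close>, and the
  sublevel set at level \<open>t\<close> has measure \<open>t\<^sup>d m\<close>.
\<close>

lemma sector_integral:
  assumes h: "h > 0"
  shows "set_integrable lebesgue (sector h) (\<lambda>y. h - p y)"
    and "(LINT y:sector h|lebesgue. h - p y) = m * h ^ (DIM('a) + 1) / (real DIM('a) + 1)"
    and "set_integrable lebesgue (sector h) p"
    and "(LINT y:sector h|lebesgue. p y) = h ^ DIM('a) * m * (real DIM('a) * h / (real DIM('a) + 1))"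
proof -
  let ?d = "DIM('a)"
  \<comment> \<open>Closed at the upper end: integrating \<open>f\<close> over \<open>y\<close> then gives \<open>t\<^sup>d m\<close> for all \<open>t\<close> in \<open>{0..h}\<close>, including \<open>t = 0\<close>.\<close>
  define f :: "'a \<Rightarrow> real \<Rightarrow> ennreal" where "f y t = indicator {(y, t). y \<in> C \<and> p y < t \<and> t \<le> h} (y, t)" for y t
  have [measurable]: "{(y, t). y \<in> C \<and> p y < t \<and> t \<le> h} \<in> sets (borel \<Otimes>\<^sub>M borel)"
  proof -
    have "{z \<in> space (borel \<Otimes>\<^sub>M borel). fst z \<in> C \<and> p (fst z) < snd z \<and> snd z \<le> h} \<in> sets (borel \<Otimes>\<^sub>M borel)"
      by measurable
    moreover have "{z \<in> space (borel \<Otimes>\<^sub>M borel). fst z \<in> C \<and> p (fst z) < snd z \<and> snd z \<le> h} = {(y, t). y \<in> C \<and> p y < t \<and> t \<le> h}"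
      by (auto simp: space_pair_measure)
    ultimately show ?thesis by simp
  qed
  have inner1: "(\<integral>\<^sup>+t. f y t \<partial>lborel) = ennreal (indicator (sector h) y * (h - p y))" for y
  proof -
    have "(\<integral>\<^sup>+t. f y t \<partial>lborel) = (\<integral>\<^sup>+t. indicator C y * indicator {p y <.. h} t \<partial>lborel)"
      by (intro nn_integral_cong) (auto simp: f_def indicator_def)
    also have "\<dots> = indicator C y * emeasure lborel {p y <.. h}"
      by (subst nn_integral_cmult) auto
    also have "\<dots> = ennreal (indicator (sector h) y * (h - p y))"
    proof (cases "p y < h")
      case True
      then show ?thesis by (auto simp: sector_def indicator_def)
    next
      case False
      then have "{p y <.. h} = {}" by auto
      with False show ?thesis by (simp add: sector_def)
    qed
    finally show ?thesis .
  qed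
  have inner2: "(\<integral>\<^sup>+y. f y t \<partial>lborel) = ennreal (t ^ ?d * m) * indicator {0..h} t" for t
  proof (cases "0 < t \<and> t \<le> h")
    case True
    then have "(\<integral>\<^sup>+y. f y t \<partial>lborel) = (\<integral>\<^sup>+y. indicator (sector t) y \<partial>lborel)"
      by (intro nn_integral_cong) (auto simp: f_def indicator_def sector_def)
    also have "\<dots> = emeasure lebesgue (sector t)" by simp
    finally show ?thesis using True emeasure_sector[of t] by simp
  next
    case False
    then have "f y t = 0" for y using body_norm_nonneg[of y] by (auto simp: f_def indicator_def)
    moreover have "t ^ ?d * m = 0 \<or> t \<notin> {0..h}" using False by auto
    ultimately show ?thesis by auto
  qed
  have "(\<integral>\<^sup>+y. ennreal (indicator (sector h) y * (h - p y)) \<partial>lebesgue)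
      = (\<integral>\<^sup>+y. ennreal (indicator (sector h) y * (h - p y)) \<partial>lborel)"
    by (rule nn_integral_completion)
  also have "\<dots> = (\<integral>\<^sup>+y. (\<integral>\<^sup>+t. f y t \<partial>lborel) \<partial>lborel)" by (simp add: inner1)
  also have "\<dots> = (\<integral>\<^sup>+t. (\<integral>\<^sup>+y. f y t \<partial>lborel) \<partial>lborel)"
    by (rule lborel_pair.Fubini'[symmetric]) (simp add: f_def case_prod_beta')
  also have "\<dots> = (\<integral>\<^sup>+t. ennreal (t ^ ?d * m) * indicator {0..h} t \<partial>lborel)" by (simp add: inner2)
  also have "\<dots> = ennreal (m * h ^ (?d + 1) / (real ?d + 1) - m * 0 ^ (?d + 1) / (real ?d + 1))"
  proof (rule nn_integral_FTC_Icc)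
    show "(\<lambda>t. t ^ ?d * m) \<in> borel_measurable borel" by measurable
    show "((\<lambda>t. m * t ^ (?d + 1) / (real ?d + 1)) has_real_derivative t ^ ?d * m) (at t)" for t
    proof -
      have "((\<lambda>t. m * t ^ (?d + 1) / (real ?d + 1)) has_real_derivative m * (real (?d + 1) * t ^ ?d) / (real ?d + 1)) (at t)"
        by (auto intro!: derivative_eq_intros simp del: power_Suc)
      moreover have "m * (real (?d + 1) * t ^ ?d) / (real ?d + 1) = t ^ ?d * m" by (simp add: field_simps)
      ultimately show ?thesis by simp
    qed
    show "0 \<le> t ^ ?d * m" if "t \<in> {0..h}" for t using that m_pos by simp
  qed (use h in auto)
  finally have nn: "(\<integral>\<^sup>+y. ennreal (indicator (sector h) y * (h - p y)) \<partial>lebesgue) = ennreal (m * h ^ (?d + 1) / (real ?d + 1))"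
    by simp
  have meas: "(\<lambda>y. indicator (sector h) y * (h - p y)) \<in> borel_measurable lebesgue"
    by (intro measurable_completion) measurable
  have nonneg: "0 \<le> indicator (sector h) y * (h - p y)" for y by (auto simp: indicator_def sector_def)
  have "has_bochner_integral lebesgue (\<lambda>y. indicator (sector h) y * (h - p y)) (m * h ^ (?d + 1) / (real ?d + 1))"
    using nn m_pos h meas nonneg by (intro has_bochner_integral_nn_integral) auto
  then show int1: "set_integrable lebesgue (sector h) (\<lambda>y. h - p y)"
    and val1: "(LINT y:sector h|lebesgue. h - p y) = m * h ^ (?d + 1) / (real ?d + 1)"
    by (simp_all add: set_integrable_def set_lebesgue_integral_def has_bochner_integral_iff)
  have const: "set_integrable lebesgue (sector h) (\<lambda>y. h)" "(LINT y:sector h|lebesgue. h) = h * (h ^ ?d * m)"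
  proof -
    have "integrable lebesgue (indicator (sector h) :: 'a \<Rightarrow> real)"
      using sector_lmeasurable[OF h] lmeasurable_iff_integrable by blast
    then show "set_integrable lebesgue (sector h) (\<lambda>y. h)" by (simp add: set_integrable_def)
    show "(LINT y:sector h|lebesgue. h) = h * (h ^ ?d * m)"
      using emeasure_sector[OF h] m_pos h by (simp add: set_lebesgue_integral_def measure_def)
  qed
  have diff: "(\<lambda>y. h - (h - p y)) = p" by auto
  show "set_integrable lebesgue (sector h) p"
    using set_integral_diff(1)[OF const(1) int1] by (simp add: diff)
  have "(LINT y:sector h|lebesgue. p y) = h * (h ^ ?d * m) - m * h ^ (?d + 1) / (real ?d + 1)"
    using set_integral_diff(2)[OF const(1) int1] const(2) val1 by (simp add: diff)
  also have "\<dots> = h ^ ?d * m * (real ?d * h / (real ?d + 1))"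
    by (simp add: field_simps)
  finally show "(LINT y:sector h|lebesgue. p y) = h ^ ?d * m * (real ?d * h / (real ?d + 1))" .
qed

text \<open>
  The exceptional set of the increment bound depends on \<open>y\<close>.  Fubini's theorem for null sets turns
  it into one exceptional set of \<open>x\<close>, outside of which the bound holds for almost every \<open>y\<close> and can
  be integrated over the truncated cone.
\<close>

lemma average_deviation:
  assumes u: "integrable lebesgue u" "u \<in> borel_measurable borel"
    and wp: "\<forall>i\<in>Basis. weak_partial C u i (\<lambda>x. g x \<bullet> i)"
    and G: "AE x in lebesgue. x \<in> C \<longrightarrow> dual_norm K (g x) \<le> G" and h: "h > 0"
  shows "AE x in lebesgue. x \<in> C \<longrightarrow>
    \<bar>u x - (LINT y:sector h|lebesgue. u (x + y)) / (h ^ DIM('a) * m)\<bar> \<le> real DIM('a) * h / (real DIM('a) + 1) * G"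
proof -
  define P where "P x y \<longleftrightarrow> x \<in> C \<longrightarrow> y \<in> C \<longrightarrow> \<bar>u (x + y) - u x\<bar> \<le> G * p y" for x y
  have "AE x in lebesgue. P x y" for y
    using increment_bound[OF u wp G, of y] by (cases "y \<in> C") (auto simp: P_def)
  then have "AE x in lborel. P x y" for y by (simp add: AE_completion_iff)
  then have "AE y in lborel. AE x in lborel. P x y" by simp
  moreover have "{z \<in> space (lborel \<Otimes>\<^sub>M lborel). P (fst z) (snd z)} \<in> sets (lborel \<Otimes>\<^sub>M lborel)"
    unfolding P_def using u(2) by measurable
  ultimately have "AE x in lborel. AE y in lborel. P x y"
    using lborel_pair.AE_commute[of P] by blast
  then have "AE x in lebesgue. AE y in lebesgue. P x y" by (simp add: AE_completion_iff)
  then show ?thesis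
  proof (eventually_elim, intro impI)
    fix x assume ae: "AE y in lebesgue. P x y" and x: "x \<in> C"
    let ?V = "h ^ DIM('a) * m"
    have V: "?V > 0" using h m_pos by simp
    have sec: "sector h \<in> sets lebesgue" using sector_lmeasurable[OF h] by (rule fmeasurableD)
    have "integrable lebesgue (\<lambda>y. u (y + x))" using lebesgue_translate(2)[OF u(2)] u(1) by simp
    then have "integrable lebesgue (\<lambda>y. u (x + y))" by (simp add: add.commute)
    then have int: "set_integrable lebesgue (sector h) (\<lambda>y. u (x + y))"
      unfolding set_integrable_def using sec by (intro integrable_mult_indicator)
    have ind: "integrable lebesgue (indicator (sector h) :: 'a \<Rightarrow> real)"
      using sector_lmeasurable[OF h] lmeasurable_iff_integrable by blast
    then have const: "set_integrable lebesgue (sector h) (\<lambda>y. u x)" by (simp add: set_integrable_def)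
    have const_val: "(LINT y:sector h|lebesgue. u x) = u x * ?V"
      using emeasure_sector[OF h] V by (simp add: set_lebesgue_integral_def measure_def)
    have diff: "set_integrable lebesgue (sector h) (\<lambda>y. u x - u (x + y))"
      by (rule set_integral_diff(1)[OF const int])
    have "\<bar>u x * ?V - (LINT y:sector h|lebesgue. u (x + y))\<bar> = \<bar>LINT y:sector h|lebesgue. u x - u (x + y)\<bar>"
      using set_integral_diff(2)[OF const int] const_val by simp
    also have "\<dots> \<le> (\<integral>y. \<bar>indicator (sector h) y *\<^sub>R (u x - u (x + y))\<bar> \<partial>lebesgue)"
      unfolding set_lebesgue_integral_def by (rule integral_abs_bound)
    also have "\<dots> \<le> (\<integral>y. G * (indicator (sector h) y *\<^sub>R p y) \<partial>lebesgue)"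
    proof (rule integral_mono_AE)
      show "AE y in lebesgue. \<bar>indicator (sector h) y *\<^sub>R (u x - u (x + y))\<bar> \<le> G * (indicator (sector h) y *\<^sub>R p y)"
        using ae
      proof eventually_elim
        case (elim y)
        then show ?case using x by (auto simp: P_def sector_def indicator_def abs_minus_commute)
      qed
      show "integrable lebesgue (\<lambda>y. \<bar>indicator (sector h) y *\<^sub>R (u x - u (x + y))\<bar>)"
        using diff unfolding set_integrable_def by (rule integrable_abs)
      show "integrable lebesgue (\<lambda>y. G * (indicator (sector h) y *\<^sub>R p y))"
        using sector_integral(3)[OF h] unfolding set_integrable_def by (rule integrable_mult_right)
    qed
    also have "\<dots> = G * (LINT y:sector h|lebesgue. p y)"
      by (simp add: set_lebesgue_integral_def)
    also have "\<dots> = real DIM('a) * h / (real DIM('a) + 1) * G * ?V"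
      by (simp add: sector_integral(4)[OF h])
    finally have "\<bar>u x * ?V - (LINT y:sector h|lebesgue. u (x + y))\<bar> / ?V \<le> real DIM('a) * h / (real DIM('a) + 1) * G"
      using V by (simp add: pos_divide_le_eq del: times_divide_eq_left)
    moreover have "\<bar>u x * ?V - (LINT y:sector h|lebesgue. u (x + y))\<bar> / ?V
        = \<bar>u x - (LINT y:sector h|lebesgue. u (x + y)) / ?V\<bar>"
    proof -
      have "u x - (LINT y:sector h|lebesgue. u (x + y)) / ?V = (u x * ?V - (LINT y:sector h|lebesgue. u (x + y))) / ?V"
        using V m_pos h by (simp add: diff_divide_distrib)
      then show ?thesis using V by (simp only: abs_divide abs_of_pos)
    qed
    ultimately show "\<bar>u x - (LINT y:sector h|lebesgue. u (x + y)) / ?V\<bar> \<le> real DIM('a) * h / (real DIM('a) + 1) * G"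
      by simp
  qed
qed

end

text \<open>
  Translates \<open>u (x + y)\<close> are jointly measurable in \<open>x\<close> and \<open>y\<close> for Borel functions, which is what
  Fubini's theorem asks for; hence densities are replaced by Borel representatives.
\<close>

lemma borel_representative:
  fixes f :: "'a::euclidean_space \<Rightarrow> real"
  assumes C: "C \<in> sets lebesgue" and f: "integrable (lebesgue_on C) f"
  obtains u where "u \<in> borel_measurable borel" "integrable lebesgue u" "AE x in lebesgue. x \<in> C \<longrightarrow> u x = f x"
proof -
  have int: "integrable lebesgue (\<lambda>x. indicator C x *\<^sub>R f x)"
    using f C integrable_restrict_space[of C lebesgue f] by simp
  from completion_ex_borel_measurable_real[OF borel_measurable_integrable[OF this]]
  obtain u where u: "u \<in> borel_measurable lborel" "AE x in lborel. indicator C x *\<^sub>R f x = u x" by blast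
  have ae: "AE x in lebesgue. indicator C x *\<^sub>R f x = u x" using u(2) by (rule AE_completion)
  have "u \<in> borel_measurable lebesgue" using u(1) by (rule measurable_completion)
  then have "integrable lebesgue u"
    using integrable_cong_AE[OF borel_measurable_integrable[OF int] _ ae] int by blast
  moreover have "AE x in lebesgue. x \<in> C \<longrightarrow> u x = f x"
    using ae by eventually_elim (auto simp: indicator_def)
  ultimately show ?thesis using u(1) that by simp
qed

lemma integrable_imp_locally_integrable:
  assumes "integrable lebesgue u" shows "locally_integrable C u"
  unfolding locally_integrable_def set_integrable_def
proof (intro allI impI)
  fix S assume "compact S \<and> S \<subseteq> C"
  then have "S \<in> sets lebesgue" by (intro fmeasurableD lmeasurable_compact) simp
  then show "integrable lebesgue (\<lambda>x. indicator S x *\<^sub>R u x)"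
    using assms by (rule integrable_mult_indicator)
qed

lemma weak_partial_cong_AE:
  assumes wp: "weak_partial C f i g" and u: "locally_integrable C u"
    and ae: "AE x in lebesgue. x \<in> C \<longrightarrow> u x = f x"
  shows "weak_partial C u i g"
proof -
  have "(LINT x:C|lebesgue. u x * frechet_derivative \<phi> (at x) i) = (LINT x:C|lebesgue. f x * frechet_derivative \<phi> (at x) i)"
    if \<phi>: "\<phi> \<in> test_functions C" for \<phi>
  proof -
    obtain S where S: "compact S" "S \<subseteq> C" "\<And>x v. x \<notin> S \<Longrightarrow> frechet_derivative \<phi> (at x) v = 0"
      by (rule test_function_properties[OF \<phi>]) metis
    have "set_integrable lebesgue C (\<lambda>x. w x * frechet_derivative \<phi> (at x) i)" if "locally_integrable C w" for w
      by (rule locally_integrable_times_test[OF that S(1,2) test_function_deriv_continuous[OF \<phi>] S(3)])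
    from this[of u] this[of f] have
      "(\<lambda>x. indicator C x *\<^sub>R (u x * frechet_derivative \<phi> (at x) i)) \<in> borel_measurable lebesgue"
      "(\<lambda>x. indicator C x *\<^sub>R (f x * frechet_derivative \<phi> (at x) i)) \<in> borel_measurable lebesgue"
      using u wp unfolding set_integrable_def weak_partial_def by (blast intro: borel_measurable_integrable)+
    then show ?thesis
      unfolding set_lebesgue_integral_def
    proof (rule integral_cong_AE)
      show "AE x in lebesgue. indicator C x *\<^sub>R (u x * frechet_derivative \<phi> (at x) i)
          = indicator C x *\<^sub>R (f x * frechet_derivative \<phi> (at x) i)"
        using ae by eventually_elim (simp add: indicator_def)
    qed
  qed
  with wp u show ?thesis by (simp add: weak_partial_def)
qed

section \<open>The additive inequality\<close>

lemma AE_lebesgue_on_iff: "C \<in> sets lebesgue \<Longrightarrow> (AE x in lebesgue_on C. P x) \<longleftrightarrow> (AE x in lebesgue. x \<in> C \<longrightarrow> P x)"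
  by (rule AE_restrict_space_iff) simp

lemma Linf_norm_le:
  assumes C: "C \<in> sets lebesgue" and f: "f \<in> borel_measurable (lebesgue_on C)"
    and ae: "AE x in lebesgue. x \<in> C \<longrightarrow> \<bar>f x\<bar> \<le> c"
  shows "Linf_norm C f \<le> ennreal c"
  unfolding Linf_norm_def
proof (rule esssup_I)
  show "(\<lambda>x. ennreal \<bar>f x\<bar>) \<in> borel_measurable (lebesgue_on C)" using f by measurable
  show "AE x in lebesgue_on C. ennreal \<bar>f x\<bar> \<le> ennreal c"
    unfolding AE_lebesgue_on_iff[OF C] using ae by eventually_elim (auto intro: ennreal_leI)
qed

lemma Linf_norm_AE:
  assumes C: "C \<in> sets lebesgue" shows "AE x in lebesgue. x \<in> C \<longrightarrow> ennreal \<bar>f x\<bar> \<le> Linf_norm C f"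
  using esssup_AE[of "\<lambda>x. ennreal \<bar>f x\<bar>" "lebesgue_on C"] unfolding AE_lebesgue_on_iff[OF C] Linf_norm_def .

lemma Linf_norm_AE_real:
  assumes C: "C \<in> sets lebesgue" and le: "Linf_norm C f \<le> ennreal c" "0 \<le> c"
  shows "AE x in lebesgue. x \<in> C \<longrightarrow> \<bar>f x\<bar> \<le> c"
  using Linf_norm_AE[OF C, of f]
proof eventually_elim
  case (elim x)
  then show ?case using le by (metis ennreal_le_iff order_trans)
qed

lemma Linf_norm_triangle:
  assumes f: "f \<in> borel_measurable (lebesgue_on C)" and g: "g \<in> borel_measurable (lebesgue_on C)"
  shows "Linf_norm C (\<lambda>x. f x + g x) \<le> Linf_norm C f + Linf_norm C g"
  unfolding Linf_norm_def
proof (rule esssup_I)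
  show "(\<lambda>x. ennreal \<bar>f x + g x\<bar>) \<in> borel_measurable (lebesgue_on C)" using f g by measurable
  show "AE x in lebesgue_on C. ennreal \<bar>f x + g x\<bar> \<le>
      esssup (lebesgue_on C) (\<lambda>x. ennreal \<bar>f x\<bar>) + esssup (lebesgue_on C) (\<lambda>x. ennreal \<bar>g x\<bar>)"
    using esssup_AE[of "\<lambda>x. ennreal \<bar>f x\<bar>" "lebesgue_on C"] esssup_AE[of "\<lambda>x. ennreal \<bar>g x\<bar>" "lebesgue_on C"]
  proof eventually_elim
    case (elim x)
    have "ennreal \<bar>f x + g x\<bar> \<le> ennreal (\<bar>f x\<bar> + \<bar>g x\<bar>)" by (intro ennreal_leI abs_triangle_ineq)
    also have "\<dots> = ennreal \<bar>f x\<bar> + ennreal \<bar>g x\<bar>" by simp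
    finally show ?case using add_mono[OF elim] by (rule order_trans)
  qed
qed

lemma Linf_norm_scale_le:
  assumes f: "f \<in> borel_measurable (lebesgue_on C)" and c: "0 \<le> c"
  shows "Linf_norm C (\<lambda>x. c * f x) \<le> ennreal c * Linf_norm C f"
  unfolding Linf_norm_def
proof (rule esssup_I)
  show "(\<lambda>x. ennreal \<bar>c * f x\<bar>) \<in> borel_measurable (lebesgue_on C)" using f by measurable
  show "AE x in lebesgue_on C. ennreal \<bar>c * f x\<bar> \<le> ennreal c * esssup (lebesgue_on C) (\<lambda>x. ennreal \<bar>f x\<bar>)"
    using esssup_AE[of "\<lambda>x. ennreal \<bar>f x\<bar>" "lebesgue_on C"]
  proof eventually_elim
    case (elim x)
    have "ennreal \<bar>c * f x\<bar> = ennreal c * ennreal \<bar>f x\<bar>" using c by (simp add: abs_mult ennreal_mult')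
    then show ?case using elim by (simp add: mult_left_mono)
  qed
qed

lemma Linf_norm_scale:
  assumes f: "f \<in> borel_measurable (lebesgue_on C)" and c: "0 < c"
  shows "Linf_norm C (\<lambda>x. c * f x) = ennreal c * Linf_norm C f"
proof (rule antisym)
  show "Linf_norm C (\<lambda>x. c * f x) \<le> ennreal c * Linf_norm C f"
    using f c by (intro Linf_norm_scale_le) auto
  have "Linf_norm C (\<lambda>x. inverse c * (c * f x)) \<le> ennreal (inverse c) * Linf_norm C (\<lambda>x. c * f x)"
    using f c by (intro Linf_norm_scale_le) auto
  moreover have "(\<lambda>x. inverse c * (c * f x)) = f" using c by (simp add: fun_eq_iff)
  ultimately have "Linf_norm C f \<le> ennreal (inverse c) * Linf_norm C (\<lambda>x. c * f x)" by simp
  then have "ennreal c * Linf_norm C f \<le> ennreal c * (ennreal (inverse c) * Linf_norm C (\<lambda>x. c * f x))"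
    by (rule mult_left_mono) simp
  also have "\<dots> = (ennreal c * ennreal (inverse c)) * Linf_norm C (\<lambda>x. c * f x)"
    by (simp only: mult.assoc)
  also have "ennreal c * ennreal (inverse c) = 1" using c by (simp add: ennreal_mult[symmetric])
  also have "1 * Linf_norm C (\<lambda>x. c * f x) = Linf_norm C (\<lambda>x. c * f x)" by simp
  finally show "ennreal c * Linf_norm C f \<le> Linf_norm C (\<lambda>x. c * f x)" .
qed

lemma ennreal_divide_real: "0 < V \<Longrightarrow> N / ennreal V = ennreal (inverse V) * N"
  by (simp add: divide_ennreal_def inverse_ennreal mult.commute)

lemma weak_grad_works:
  assumes f: "f \<in> W1inf C" shows "\<forall>i\<in>Basis. weak_partial C f i (\<lambda>x. weak_grad C f x \<bullet> i)"
proof -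
  have "\<forall>i\<in>Basis. \<exists>g. weak_partial C f i g" using f by (auto simp: W1inf_def)
  then obtain g where g: "\<And>i. i \<in> Basis \<Longrightarrow> weak_partial C f i (g i)" by metis
  have "\<forall>i\<in>Basis. weak_partial C f i (\<lambda>x. (\<Sum>j\<in>Basis. g j x *\<^sub>R j) \<bullet> i)"
    using g by simp
  then have "\<exists>g. \<forall>i\<in>Basis. weak_partial C f i (\<lambda>x. g x \<bullet> i)"
    by (rule exI[of _ "\<lambda>x. \<Sum>j\<in>Basis. g j x *\<^sub>R j"])
  then show ?thesis unfolding weak_grad_def by (rule someI_ex)
qed

context body_and_cone
begin

abbreviation "V h \<equiv> h ^ DIM('a) * m"

lemma V_pos: "h > 0 \<Longrightarrow> V h > 0"
  using m_pos by simp

lemma charge_of_shifted_set: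
  assumes \<nu>: "\<nu> \<in> ac_charges C" and u: "u \<in> borel_measurable borel" "integrable lebesgue u"
    and ae: "AE x in lebesgue. x \<in> C \<longrightarrow> u x = charge_deriv C \<nu> x" and h: "h > 0" and x: "x \<in> C"
  shows "\<nu> (shifted_set K C h x) = (LINT y:sector h|lebesgue. u (x + y))"
proof -
  let ?Q = "shifted_set K C h x"
  have Q: "?Q \<in> sets lebesgue" "?Q \<subseteq> C" using shifted_set_measurable[OF h] shifted_set_subset[OF h x] by auto
  then have Q_on: "?Q \<in> sets (lebesgue_on C)" using C_lebesgue by (simp add: sets_restrict_space_iff)
  have "\<nu> ?Q = (LINT y:?Q|lebesgue. charge_deriv C \<nu> y)"
    by (rule charge_deriv_works(2)[OF C_lebesgue \<nu> Q_on])
  also have "\<dots> = (LINT y:?Q|lebesgue. u y)"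
    unfolding set_lebesgue_integral_def
  proof (rule integral_cong_AE)
    have "integrable lebesgue (\<lambda>y. indicator C y *\<^sub>R charge_deriv C \<nu> y)"
      using charge_deriv_works(1)[OF C_lebesgue \<nu>] C_lebesgue integrable_restrict_space[of C lebesgue "charge_deriv C \<nu>"] by simp
    from borel_measurable_integrable[OF integrable_mult_indicator[OF Q(1) this]]
    show "(\<lambda>y. indicator ?Q y *\<^sub>R charge_deriv C \<nu> y) \<in> borel_measurable lebesgue"
    proof (rule measurable_cong[THEN iffD1, rotated])
      fix y show "indicator ?Q y *\<^sub>R indicator C y *\<^sub>R charge_deriv C \<nu> y = indicator ?Q y *\<^sub>R charge_deriv C \<nu> y"
        using Q(2) by (auto simp: indicator_def)
    qed
    show "(\<lambda>y. indicator ?Q y *\<^sub>R u y) \<in> borel_measurable lebesgue"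
      by (rule borel_measurable_integrable[OF integrable_mult_indicator[OF Q(1) u(2)]])
    show "AE y in lebesgue. indicator ?Q y *\<^sub>R charge_deriv C \<nu> y = indicator ?Q y *\<^sub>R u y"
      using ae by eventually_elim (use Q(2) in \<open>auto simp: indicator_def\<close>)
  qed
  also have "\<dots> = (\<integral>y. indicator (sector h) (y - x) * u y \<partial>lebesgue)"
    unfolding set_lebesgue_integral_def
  proof (intro Bochner_Integration.integral_cong refl)
    fix y
    have "y \<in> ?Q \<longleftrightarrow> y - x \<in> sector h"
      using h by (auto simp: shifted_set_eq image_iff) (metis add_diff_cancel_left' diff_add_cancel add.commute)
    then show "indicator ?Q y *\<^sub>R u y = indicator (sector h) (y - x) * u y" by (simp add: indicator_def)
  qed
  also have "\<dots> = (\<integral>y. indicator (sector h) (y + x - x) * u (y + x) \<partial>lebesgue)"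
    by (rule lebesgue_translate(1)[symmetric]) (use u(1) in measurable)
  also have "\<dots> = (LINT y:sector h|lebesgue. u (x + y))"
    by (simp add: set_lebesgue_integral_def add.commute)
  finally show ?thesis .
qed

lemma charge_representative:
  assumes "\<nu> \<in> ac_charges C"
  obtains u where "u \<in> borel_measurable borel" "integrable lebesgue u"
    "AE x in lebesgue. x \<in> C \<longrightarrow> u x = charge_deriv C \<nu> x"
  using borel_representative[OF C_lebesgue charge_deriv_works(1)[OF C_lebesgue assms]] .

text \<open>
  The essential supremum of a nonmeasurable function is infinite by definition, so this is what makes
  \<open>charge_norm_h\<close> a meaningful norm.
\<close>

lemma shifted_charge_measurable:
  assumes \<nu>: "\<nu> \<in> ac_charges C" and h: "h > 0"
  shows "(\<lambda>x. \<nu> (shifted_set K C h x)) \<in> borel_measurable (lebesgue_on C)"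
proof -
  obtain u where u [measurable]: "u \<in> borel_measurable borel" and u': "integrable lebesgue u"
      and ae: "AE x in lebesgue. x \<in> C \<longrightarrow> u x = charge_deriv C \<nu> x"
    by (rule charge_representative[OF \<nu>])
  have "(\<lambda>x. \<integral>y. indicator (sector h) y *\<^sub>R u (x + y) \<partial>lborel) \<in> borel_measurable lborel"
    by measurable
  moreover have "(\<lambda>x. \<integral>y. indicator (sector h) y *\<^sub>R u (x + y) \<partial>lborel) = (\<lambda>x. LINT y:sector h|lebesgue. u (x + y))"
  proof
    fix x
    have "(\<lambda>y. indicator (sector h) y *\<^sub>R u (x + y)) \<in> borel_measurable lborel" by measurable
    from integral_completion[OF this]
    show "(\<integral>y. indicator (sector h) y *\<^sub>R u (x + y) \<partial>lborel) = (LINT y:sector h|lebesgue. u (x + y))"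
      by (simp only: set_lebesgue_integral_def)
  qed
  ultimately have "(\<lambda>x. LINT y:sector h|lebesgue. u (x + y)) \<in> borel_measurable lebesgue"
    by (intro measurable_completion) (simp only:)
  then have "(\<lambda>x. LINT y:sector h|lebesgue. u (x + y)) \<in> borel_measurable (lebesgue_on C)"
    by (rule measurable_restrict_space1)
  then show ?thesis
    by (rule measurable_cong[THEN iffD1, rotated])
      (simp add: charge_of_shifted_set[OF \<nu> u u' ae h])
qed

lemma S_op_eq: "S_op K C h \<nu> = (\<lambda>x. inverse (V h) * \<nu> (shifted_set K C h x))"
  by (simp add: S_op_def fun_eq_iff divide_inverse mult.commute)

lemma S_op_measurable:
  "\<nu> \<in> ac_charges C \<Longrightarrow> h > 0 \<Longrightarrow> S_op K C h \<nu> \<in> borel_measurable (lebesgue_on C)"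
  unfolding S_op_eq using shifted_charge_measurable by simp

lemma Linf_norm_S_op:
  assumes "\<nu> \<in> ac_charges C" "h > 0"
  shows "Linf_norm C (S_op K C h \<nu>) = ennreal (inverse (V h)) * charge_norm_h K C h \<nu>"
  unfolding S_op_eq charge_norm_h_def
  by (intro Linf_norm_scale shifted_charge_measurable positive_imp_inverse_positive V_pos assms)

lemma S_op_norm_le:
  assumes h: "h > 0" shows "S_op_norm K C h \<le> ennreal (inverse (V h))"
  unfolding S_op_norm_def operator_norm_def
proof (rule SUP_least)
  fix \<nu> assume "\<nu> \<in> {\<nu> \<in> charges_K_h K C h. charge_norm_h K C h \<nu> \<le> 1}"
  then have \<nu>: "\<nu> \<in> ac_charges C" "charge_norm_h K C h \<nu> \<le> 1" by (auto simp: charges_K_h_def)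
  then show "Linf_norm C (S_op K C h \<nu>) \<le> ennreal (inverse (V h))"
    unfolding Linf_norm_S_op[OF \<nu>(1) h] using mult_left_mono[OF \<nu>(2), of "ennreal (inverse (V h))"] by simp
qed

lemma scale_ac_charge: "\<nu> \<in> ac_charges C \<Longrightarrow> (\<lambda>Q. c * \<nu> Q) \<in> ac_charges C"
  by (auto simp: ac_charges_def charge_on_def intro: sums_mult)

text \<open>
  A charge of positive norm is normalized before the supremum is applied.  If the seminorm vanishes,
  the average itself vanishes almost everywhere.
\<close>

lemma S_op_le_operator_norm:
  assumes \<nu>: "\<nu> \<in> charges_K_h K C h" and h: "h > 0"
  shows "Linf_norm C (S_op K C h \<nu>) \<le> S_op_norm K C h * charge_norm_h K C h \<nu>"
proof -
  have ac: "\<nu> \<in> ac_charges C" and fin: "charge_norm_h K C h \<nu> < \<infinity>" using \<nu> by (auto simp: charges_K_h_def)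
  then obtain n where n: "charge_norm_h K C h \<nu> = ennreal n" "n \<ge> 0"
    by (cases "charge_norm_h K C h \<nu>") auto
  show ?thesis
  proof (cases "n = 0")
    case True
    then show ?thesis using n by (simp add: Linf_norm_S_op[OF ac h])
  next
    case False
    with n have n_pos: "n > 0" by simp
    define \<nu>' where "\<nu>' = (\<lambda>Q. inverse n * \<nu> Q)"
    have ac': "\<nu>' \<in> ac_charges C" unfolding \<nu>'_def using ac by (rule scale_ac_charge)
    have "charge_norm_h K C h \<nu>' = ennreal (inverse n) * charge_norm_h K C h \<nu>"
      unfolding charge_norm_h_def \<nu>'_def using n_pos by (intro Linf_norm_scale shifted_charge_measurable ac h) simp
    then have one: "charge_norm_h K C h \<nu>' = 1" using n n_pos by (simp add: ennreal_mult[symmetric])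
    then have mem: "\<nu>' \<in> {\<nu> \<in> charges_K_h K C h. charge_norm_h K C h \<nu> \<le> 1}"
      using ac' by (simp add: charges_K_h_def)
    have "S_op K C h \<nu>' = (\<lambda>x. inverse n * S_op K C h \<nu> x)"
      by (simp add: S_op_eq \<nu>'_def mult_ac)
    then have "Linf_norm C (S_op K C h \<nu>') = ennreal (inverse n) * Linf_norm C (S_op K C h \<nu>)"
      using Linf_norm_scale[OF S_op_measurable[OF ac h], of "inverse n"] n_pos by simp
    moreover have "Linf_norm C (S_op K C h \<nu>') \<le> S_op_norm K C h"
      unfolding S_op_norm_def operator_norm_def using mem by (rule SUP_upper)
    ultimately have "ennreal n * (ennreal (inverse n) * Linf_norm C (S_op K C h \<nu>)) \<le> ennreal n * S_op_norm K C h"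
      by (simp add: mult_left_mono)
    moreover have "ennreal n * (ennreal (inverse n) * Linf_norm C (S_op K C h \<nu>)) = Linf_norm C (S_op K C h \<nu>)"
      using n_pos by (simp add: mult.assoc[symmetric] ennreal_mult[symmetric])
    ultimately show ?thesis by (simp add: n mult.commute)
  qed
qed

lemma charge_deriv_minus_average_le:
  assumes \<nu>: "\<nu> \<in> ac_charges C" and W: "charge_deriv C \<nu> \<in> W1inf C" and h: "h > 0"
  shows "Linf_norm C (\<lambda>x. charge_deriv C \<nu> x - S_op K C h \<nu> x)
    \<le> ennreal (real DIM('a) * h / (real DIM('a) + 1)) * grad_norm K C \<nu>"
proof (cases "grad_norm K C \<nu>")
  case top
  have "ennreal (real DIM('a) * h / (real DIM('a) + 1)) * top = top"
    unfolding ennreal_mult_top using h by simp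
  then show ?thesis using top by (simp only: top_greatest)
next
  case (real G)
  let ?f = "charge_deriv C \<nu>" and ?g = "weak_grad C (charge_deriv C \<nu>)"
  obtain u where u: "u \<in> borel_measurable borel" "integrable lebesgue u"
      and ae: "AE x in lebesgue. x \<in> C \<longrightarrow> u x = ?f x"
    by (rule charge_representative[OF \<nu>])
  have "\<forall>i\<in>Basis. weak_partial C u i (\<lambda>x. ?g x \<bullet> i)"
    using weak_grad_works[OF W] weak_partial_cong_AE[OF _ integrable_imp_locally_integrable[OF u(2)] ae] by blast
  moreover have "AE x in lebesgue. x \<in> C \<longrightarrow> dual_norm K (?g x) \<le> G"
    using Linf_norm_AE_real[OF C_lebesgue, of "\<lambda>x. dual_norm K (?g x)" G] real by (simp add: grad_norm_def dual_norm_nonneg)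
  ultimately have "AE x in lebesgue. x \<in> C \<longrightarrow>
      \<bar>u x - (LINT y:sector h|lebesgue. u (x + y)) / V h\<bar> \<le> real DIM('a) * h / (real DIM('a) + 1) * G"
    by (rule average_deviation[OF u(2,1) _ _ h])
  then have "AE x in lebesgue. x \<in> C \<longrightarrow> \<bar>?f x - S_op K C h \<nu> x\<bar> \<le> real DIM('a) * h / (real DIM('a) + 1) * G"
    using ae
  proof eventually_elim
    case (elim x)
    then show ?case using charge_of_shifted_set[OF \<nu> u ae h, of x] by (simp add: S_op_def)
  qed
  moreover have "(\<lambda>x. ?f x - S_op K C h \<nu> x) \<in> borel_measurable (lebesgue_on C)"
    using S_op_measurable[OF \<nu> h] charge_deriv_works(1)[OF C_lebesgue \<nu>] borel_measurable_integrable by simp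
  ultimately have "Linf_norm C (\<lambda>x. ?f x - S_op K C h \<nu> x) \<le> ennreal (real DIM('a) * h / (real DIM('a) + 1) * G)"
    by (intro Linf_norm_le C_lebesgue)
  moreover have "ennreal (real DIM('a) * h / (real DIM('a) + 1) * G) = ennreal (real DIM('a) * h / (real DIM('a) + 1)) * ennreal G"
    using real h by (intro ennreal_mult) auto
  ultimately show ?thesis using real by simp
qed

theorem additive_inequality:
  assumes \<nu>: "\<nu> \<in> charges1_K_h K C h" and h: "h > 0"
  shows "charge_deriv C \<nu> \<in> Linf C"
    and "Linf_norm C (charge_deriv C \<nu>) \<le> additive_mid K C h \<nu>"
    and "additive_mid K C h \<nu> \<le> additive_bound K C h \<nu>"
proof -
  have \<nu>_h: "\<nu> \<in> charges_K_h K C h" and W: "charge_deriv C \<nu> \<in> W1inf C" and ac: "\<nu> \<in> ac_charges C"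
    using \<nu> by (auto simp: charges1_K_h_def charges_K_h_def)
  show "charge_deriv C \<nu> \<in> Linf C" using W by (simp add: W1inf_def)
  have f: "charge_deriv C \<nu> \<in> borel_measurable (lebesgue_on C)"
    using charge_deriv_works(1)[OF C_lebesgue ac] by (rule borel_measurable_integrable)
  note S = S_op_measurable[OF ac h]
  have "Linf_norm C (charge_deriv C \<nu>) = Linf_norm C (\<lambda>x. (charge_deriv C \<nu> x - S_op K C h \<nu> x) + S_op K C h \<nu> x)"
    by simp
  also have "\<dots> \<le> Linf_norm C (\<lambda>x. charge_deriv C \<nu> x - S_op K C h \<nu> x) + Linf_norm C (S_op K C h \<nu>)"
    using f S by (intro Linf_norm_triangle) auto
  also have "\<dots> \<le> additive_mid K C h \<nu>"
    unfolding additive_mid_def by (intro add_mono order_refl S_op_le_operator_norm \<nu>_h h)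
  finally show "Linf_norm C (charge_deriv C \<nu>) \<le> additive_mid K C h \<nu>" .
  have "S_op_norm K C h * charge_norm_h K C h \<nu> \<le> charge_norm_h K C h \<nu> / ennreal (V h)"
    unfolding ennreal_divide_real[OF V_pos[OF h]] by (intro mult_right_mono S_op_norm_le h) simp
  then show "additive_mid K C h \<nu> \<le> additive_bound K C h \<nu>"
    unfolding additive_mid_def additive_bound_def by (intro add_mono charge_deriv_minus_average_le ac W h)
qed

end

section \<open>The multiplicative inequality\<close>

text \<open>
  If both norms are positive, the witness \<open>h\<close> minimizes the additive bound.  If one of them
  vanishes, the additive bound tends to 0 as \<open>h\<close> tends to infinity or to 0.
\<close>

lemma optimize_additive_bound:
  fixes F G N m :: real and d :: nat
  assumes d: "d \<ge> 1" and nonneg: "0 \<le> G" "0 \<le> N" and m: "0 < m"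
    and bound: "\<And>h. 0 < h \<Longrightarrow> F \<le> real d * h / (real d + 1) * G + N / (h ^ d * m)"
  shows "F \<le> ((real d + 1) / m) powr (1 / (real d + 1)) * G powr (real d / (real d + 1)) * N powr (1 / (real d + 1))"
    (is "F \<le> ?R")
proof -
  have R: "0 \<le> ?R" by simp
  consider "G = 0" | "G > 0" "N = 0" | "G > 0" "N > 0" using nonneg by linarith
  then show ?thesis
  proof cases
    case 1
    have "F \<le> 0"
    proof (rule ccontr)
      assume "\<not> F \<le> 0"
      then have F: "F > 0" by simp
      \<comment> \<open>The second argument makes \<open>N / (h m)\<close> at most \<open>F / 2\<close>; the first lets \<open>h\<close> replace its \<open>d\<close>-th power.\<close>
      define h where "h = max 1 (2 * N / (F * m))"
      have h: "h \<ge> 1" "2 * N / (F * m) \<le> h" by (auto simp: h_def)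
      have "h ^ 1 \<le> h ^ d" using h(1) d by (intro power_increasing) auto
      then have "N / (h ^ d * m) \<le> N / (h * m)"
        using h(1) m nonneg by (intro divide_left_mono mult_right_mono) auto
      also have "\<dots> \<le> F / 2" using h m F by (simp add: field_simps)
      finally have "N / (h ^ d * m) \<le> F / 2" .
      moreover have "F \<le> N / (h ^ d * m)" using bound[of h] h(1) 1 by simp
      ultimately show False using F by linarith
    qed
    with R show ?thesis by linarith
  next
    case 2
    have "F \<le> 0"
    proof (rule ccontr)
      assume "\<not> F \<le> 0"
      then have F: "F > 0" by simp
      define h where "h = F / (2 * G)"
      have h: "h > 0" using F 2 by (simp add: h_def)
      have "F \<le> (real d / (real d + 1)) * (h * G)" using bound[OF h] 2 by simp
      also have "\<dots> \<le> 1 * (h * G)" using h 2 by (intro mult_right_mono) auto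
      also have "\<dots> = F / 2" using 2 by (simp add: h_def)
      finally show False using F by simp
    qed
    with R show ?thesis by linarith
  next
    case 3
    define a where "a = 1 / (real d + 1)"
    \<comment> \<open>For this \<open>h\<close> the two terms are \<open>d h G / (d + 1)\<close> and \<open>h G / (d + 1)\<close>, with sum \<open>h G\<close>.\<close>
    define h where "h = ((real d + 1) / m * N / G) powr a"
    have h: "h > 0" using 3 m by (simp add: h_def)
    have "h ^ (d + 1) = ((real d + 1) / m * N / G) powr (a * real (d + 1))"
      using h by (simp only: powr_realpow[symmetric] h_def powr_powr)
    also have "a * real (d + 1) = 1" by (simp add: a_def)
    also have "((real d + 1) / m * N / G) powr 1 = (real d + 1) / m * N / G"
      using 3 m by (intro powr_one) simp
    finally have hd: "h ^ d * h = (real d + 1) / m * N / G" by (simp only: power_add power_one_right)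
    have "N / (h ^ d * m) = h * N / (h ^ d * h * m)" using h by simp
    also have "\<dots> = h * G / (real d + 1)" unfolding hd using 3 m by simp
    finally have "F \<le> real d * h / (real d + 1) * G + h * G / (real d + 1)" using bound[OF h] by simp
    also have "\<dots> = (real d + 1) * (h * G) / (real d + 1)"
      by (simp add: add_divide_distrib distrib_right)
    also have "\<dots> = h * G" by simp
    also have "\<dots> = ((real d + 1) / m) powr a * G powr (1 - a) * N powr a"
    proof -
      have "h = ((real d + 1) / m) powr a * N powr a / G powr a"
        unfolding h_def by (simp only: powr_divide powr_mult)
      moreover have "G powr (1 - a) = G / G powr a" using 3 by (simp add: powr_diff)
      ultimately show ?thesis by simp
    qed
    also have "1 - a = real d / (real d + 1)" by (simp add: a_def field_simps)
    finally show ?thesis by (simp add: a_def)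
  qed
qed

lemma locally_integrable_measurable:
  fixes g :: "'a::euclidean_space \<Rightarrow> real"
  assumes C: "open C" and g: "locally_integrable C g"
  shows "g \<in> borel_measurable (lebesgue_on C)"
proof -
  obtain \<D> where D: "countable \<D>" "\<D> \<subseteq> Pow C" "\<And>X. X \<in> \<D> \<Longrightarrow> \<exists>a b. X = cbox a b" "\<Union>\<D> = C"
    using open_countable_Union_open_cbox[OF C] by blast
  show ?thesis
  proof (rule measurable_piecewise_restrict[OF D(1)])
    show "space (lebesgue_on C) \<subseteq> \<Union>\<D>" using D(4) by simp
    fix X assume X: "X \<in> \<D>"
    then obtain a b where X_box: "X = cbox a b" using D(3) by blast
    have XC: "X \<subseteq> C" using X D(2) by blast
    have X_leb: "X \<in> sets lebesgue" "C \<in> sets lebesgue" using C by (auto simp: X_box)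
    show "X \<inter> space (lebesgue_on C) \<in> sets (lebesgue_on C)"
      using X_leb XC by (simp add: sets_restrict_space_iff Int_absorb2)
    have "C \<inter> X = X" using XC by blast
    then have "restrict_space (lebesgue_on C) X = lebesgue_on X"
      using restrict_restrict_space[of C lebesgue X] X_leb by simp
    moreover have "integrable lebesgue (\<lambda>x. indicator X x *\<^sub>R g x)"
      using g XC X_box compact_cbox by (simp add: locally_integrable_def set_integrable_def)
    then have "integrable (lebesgue_on X) g" using X_leb integrable_restrict_space[of X lebesgue g] by simp
    ultimately show "g \<in> borel_measurable (restrict_space (lebesgue_on C) X)"
      using borel_measurable_integrable by simp
  qed
qed

text \<open>
  The difference of two weak derivatives integrates to 0 against every test function.
\<close>

lemma weak_partial_unique:
  fixes g g' :: "'a::euclidean_space \<Rightarrow> real"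
  assumes C: "open C" and g: "weak_partial C f i g" and g': "weak_partial C f i g'"
  shows "AE x in lebesgue. x \<in> C \<longrightarrow> g x = g' x"
proof -
  have le: "AE x in lebesgue. x \<in> C \<longrightarrow> k x - k' x \<le> 0"
    if k: "weak_partial C f i k" and k': "weak_partial C f i k'" for k k'
  proof (rule AE_le_if_tested[OF C])
    show "locally_integrable C (\<lambda>x. k x - k' x)"
      using k k' by (auto simp: weak_partial_def locally_integrable_def intro!: set_integral_diff)
    fix \<phi> assume \<phi>: "\<phi> \<in> test_functions C"
    obtain S where S: "compact S" "S \<subseteq> C" "\<And>x. x \<notin> S \<Longrightarrow> \<phi> x = 0"
      by (rule test_function_properties[OF \<phi>]) metis
    have int: "set_integrable lebesgue C (\<lambda>x. w x * \<phi> x)" if "locally_integrable C w" for w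
      by (rule locally_integrable_times_test[OF that S(1,2) test_function_continuous[OF \<phi>] S(3)])
    have "(LINT x:C|lebesgue. k x * \<phi> x - k' x * \<phi> x) = (LINT x:C|lebesgue. k x * \<phi> x) - (LINT x:C|lebesgue. k' x * \<phi> x)"
      using k k' by (intro set_integral_diff int) (auto simp: weak_partial_def)
    also have "\<dots> = 0"
      using k k' \<phi> unfolding weak_partial_def by (metis diff_self minus_equation_iff)
    finally show "(LINT x:C|lebesgue. (k x - k' x) * \<phi> x) \<le> 0 * (LINT x:C|lebesgue. \<phi> x)"
      by (simp add: left_diff_distrib)
  qed
  from le[OF g g'] le[OF g' g] show ?thesis
    by eventually_elim auto
qed

context body_and_cone
begin

lemma weak_grad_measurable:
  assumes f: "f \<in> W1inf C"
  shows "weak_grad C f \<in> borel_measurable (lebesgue_on C)"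
proof (rule borel_measurable_euclidean_space[THEN iffD2], rule ballI)
  fix i :: 'a assume "i \<in> Basis"
  then have "locally_integrable C (\<lambda>x. weak_grad C f x \<bullet> i)"
    using weak_grad_works[OF f] unfolding weak_partial_def by blast
  then show "(\<lambda>x. weak_grad C f x \<bullet> i) \<in> borel_measurable (lebesgue_on C)"
    by (rule locally_integrable_measurable[OF open_C])
qed

lemma dual_norm_weak_grad_measurable:
  assumes "f \<in> W1inf C" shows "(\<lambda>x. dual_norm K (weak_grad C f x)) \<in> borel_measurable (lebesgue_on C)"
  using measurable_compose[OF weak_grad_measurable[OF assms] borel_measurable_dual_norm] .

text \<open>
  The weak gradient is an arbitrary choice among functions that satisfy the defining identity.  By
  uniqueness its components agree almost everywhere with the bounded weak derivatives that membership
  in \<open>W1inf\<close> provides.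
\<close>

lemma grad_norm_finite:
  assumes W: "charge_deriv C \<nu> \<in> W1inf C" shows "grad_norm K C \<nu> < \<infinity>"
proof -
  let ?f = "charge_deriv C \<nu>" and ?g = "weak_grad C (charge_deriv C \<nu>)"
  have "\<exists>c\<ge>0. AE x in lebesgue. x \<in> C \<longrightarrow> \<bar>?g x \<bullet> i\<bar> \<le> c" if i: "i \<in> Basis" for i
  proof -
    obtain g where g: "g \<in> Linf C" "weak_partial C ?f i g" using W i by (auto simp: W1inf_def)
    then have "Linf_norm C g < \<infinity>" by (simp add: Linf_def)
    then obtain c where c: "Linf_norm C g = ennreal c" "c \<ge> 0" by (cases "Linf_norm C g") auto
    have "AE x in lebesgue. x \<in> C \<longrightarrow> \<bar>g x\<bar> \<le> c" using c by (intro Linf_norm_AE_real C_lebesgue) auto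
    moreover have "AE x in lebesgue. x \<in> C \<longrightarrow> ?g x \<bullet> i = g x"
      using weak_grad_works[OF W] i by (intro weak_partial_unique[OF open_C _ g(2)]) blast
    ultimately have "AE x in lebesgue. x \<in> C \<longrightarrow> \<bar>?g x \<bullet> i\<bar> \<le> c" by eventually_elim auto
    with c(2) show ?thesis by blast
  qed
  then obtain c where c: "\<And>i. i \<in> Basis \<Longrightarrow> AE x in lebesgue. x \<in> C \<longrightarrow> \<bar>?g x \<bullet> i\<bar> \<le> c i" by metis
  then have components: "AE x in lebesgue. \<forall>i\<in>Basis. x \<in> C \<longrightarrow> \<bar>?g x \<bullet> i\<bar> \<le> c i"
    by (subst AE_ball_countable) (auto intro: countable_finite)
  obtain B where B: "B > 0" "\<And>z. dual_norm K z \<le> B * norm z" by (rule dual_norm_le_norm) metis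
  from components have "AE x in lebesgue. x \<in> C \<longrightarrow> \<bar>dual_norm K (?g x)\<bar> \<le> B * (\<Sum>i\<in>Basis. c i)"
  proof eventually_elim
    case (elim x)
    show ?case
    proof
      assume "x \<in> C"
      then have "norm (?g x) \<le> (\<Sum>i\<in>Basis. c i)"
        using elim by (intro order_trans[OF norm_le_l1] sum_mono) auto
      then have "B * norm (?g x) \<le> B * (\<Sum>i\<in>Basis. c i)" using B(1) by (intro mult_left_mono) auto
      then show "\<bar>dual_norm K (?g x)\<bar> \<le> B * (\<Sum>i\<in>Basis. c i)"
        using B(2)[of "?g x"] dual_norm_nonneg[of "?g x"] by linarith
    qed
  qed
  then have "grad_norm K C \<nu> \<le> ennreal (B * (\<Sum>i\<in>Basis. c i))"
    unfolding grad_norm_def by (intro Linf_norm_le C_lebesgue dual_norm_weak_grad_measurable W)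
  then show ?thesis using ennreal_less_top le_less_trans by (metis infinity_ennreal_def)
qed

lemma charges1_K_imp_charges1_K_h: "\<nu> \<in> charges1_K K C \<Longrightarrow> h > 0 \<Longrightarrow> \<nu> \<in> charges1_K_h K C h"
  and charge_norm_h_le: "h > 0 \<Longrightarrow> charge_norm_h K C h \<nu> \<le> charge_norm K C \<nu>"
proof -
  show le: "charge_norm_h K C h \<nu> \<le> charge_norm K C \<nu>" if "h > 0" for h \<nu>
    unfolding charge_norm_def using that by (intro SUP_upper) simp
  show "\<nu> \<in> charges1_K_h K C h" if "\<nu> \<in> charges1_K K C" "h > 0"
    using that le[OF that(2), of \<nu>] by (auto simp: charges1_K_def charges1_K_h_def charges_K_def charges_K_h_def)
qed

theorem multiplicative_inequality:
  assumes \<nu>: "\<nu> \<in> charges1_K K C"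
  shows "Linf_norm C (charge_deriv C \<nu>) \<le> multiplicative_bound K C \<nu>"
proof -
  have W: "charge_deriv C \<nu> \<in> W1inf C" and "charge_norm K C \<nu> < \<infinity>"
    using \<nu> by (auto simp: charges1_K_def charges_K_def)
  then obtain N where N: "charge_norm K C \<nu> = ennreal N" "N \<ge> 0" by (cases "charge_norm K C \<nu>") auto
  obtain G where G: "grad_norm K C \<nu> = ennreal G" "G \<ge> 0"
    using grad_norm_finite[OF W] by (cases "grad_norm K C \<nu>") auto
  have "Linf_norm C (charge_deriv C \<nu>) < \<infinity>" using W by (simp add: W1inf_def Linf_def)
  then obtain F where F: "Linf_norm C (charge_deriv C \<nu>) = ennreal F" "F \<ge> 0"
    by (cases "Linf_norm C (charge_deriv C \<nu>)") auto
  have "F \<le> real DIM('a) * h / (real DIM('a) + 1) * G + N / V h" if h: "h > 0" for h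
  proof -
    have "ennreal F \<le> additive_bound K C h \<nu>"
      using additive_inequality(2,3)[OF charges1_K_imp_charges1_K_h[OF \<nu> h] h] F by (metis order_trans)
    also have "\<dots> \<le> ennreal (real DIM('a) * h / (real DIM('a) + 1)) * ennreal G + ennreal (inverse (V h)) * ennreal N"
      unfolding additive_bound_def ennreal_divide_real[OF V_pos[OF h]] G(1)
      using charge_norm_h_le[OF h, of \<nu>] N by (intro add_mono mult_left_mono) auto
    also have "\<dots> = ennreal (real DIM('a) * h / (real DIM('a) + 1) * G) + ennreal (inverse (V h) * N)"
      using h G(2) N(2) V_pos[OF h] by (subst (1 2) ennreal_mult) auto
    also have "\<dots> = ennreal (real DIM('a) * h / (real DIM('a) + 1) * G + inverse (V h) * N)"
      using h G(2) N(2) V_pos[OF h] by (intro ennreal_plus[symmetric]) auto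
    finally have "F \<le> real DIM('a) * h / (real DIM('a) + 1) * G + inverse (V h) * N"
      using h G(2) N(2) V_pos[OF h] by (subst (asm) ennreal_le_iff) (auto intro!: add_nonneg_nonneg mult_nonneg_nonneg)
    then show ?thesis by (simp add: divide_inverse mult.commute)
  qed
  then have "F \<le> ((real DIM('a) + 1) / m) powr (1 / (real DIM('a) + 1)) * G powr (real DIM('a) / (real DIM('a) + 1))
      * N powr (1 / (real DIM('a) + 1))"
    using G(2) N(2) m_pos by (intro optimize_additive_bound) (auto simp: Suc_le_eq)
  then show ?thesis
    using G N by (simp add: F multiplicative_bound_def Let_def ennreal_leI)
qed

end

section \<open>The extremal charge\<close>

text \<open>
  Countable additivity follows from continuity of the integral along the increasing finite unions.
\<close>

lemma integral_mem_ac_charges: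
  fixes u :: "'a::euclidean_space \<Rightarrow> real"
  assumes C: "C \<in> sets lebesgue" and u: "integrable lebesgue u"
  shows "(\<lambda>Q. LINT x:Q|lebesgue. u x) \<in> ac_charges C"
proof -
  have set_int: "set_integrable lebesgue Q u" if "Q \<in> sets lebesgue" for Q
    unfolding set_integrable_def using that u by (rule integrable_mult_indicator)
  have "(\<lambda>n. LINT x:A n|lebesgue. u x) sums (LINT x:(\<Union>n. A n)|lebesgue. u x)"
    if A: "range A \<subseteq> sets (lebesgue_on C)" "disjoint_family A" for A :: "nat \<Rightarrow> 'a set"
  proof -
    have leb: "A n \<in> sets lebesgue" for n
    proof -
      have "A n \<in> sets (lebesgue_on C)" using A(1) by blast
      then show ?thesis using C by (simp add: sets_restrict_space_iff)
    qed
    define U where "U n = (\<Union>i<n. A i)" for n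
    have U: "U n \<in> sets lebesgue" for n using leb by (auto simp: U_def)
    have "(\<Sum>i<n. LINT x:A i|lebesgue. u x) = (LINT x:U n|lebesgue. u x)" for n
    proof (induction n)
      case 0
      show ?case by (simp add: U_def set_lebesgue_integral_def)
    next
      case (Suc n)
      have "U n \<inter> A n = {}"
        using A(2) by (auto simp: U_def disjoint_family_on_def) (metis IntI empty_iff less_irrefl)
      then have "(LINT x:U n \<union> A n|lebesgue. u x) = (LINT x:U n|lebesgue. u x) + (LINT x:A n|lebesgue. u x)"
        by (intro set_integral_Un set_int U leb)
      moreover have "U (Suc n) = U n \<union> A n" by (auto simp: U_def lessThan_Suc)
      ultimately show ?case using Suc by simp
    qed
    moreover have "(\<lambda>n. LINT x:U n|lebesgue. u x) \<longlonglongrightarrow> (LINT x:(\<Union>n. U n)|lebesgue. u x)"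
    proof (rule set_integral_cont_up[OF U])
      show "incseq U" unfolding incseq_def U_def by (intro allI impI UN_mono) auto
      show "set_integrable lebesgue (\<Union>n. U n) u" using U by (intro set_int) auto
    qed
    moreover have "(\<Union>n. U n) = (\<Union>n. A n)" by (force simp: U_def)
    ultimately show ?thesis by (simp add: sums_def)
  qed
  moreover have "(LINT x:Q|lebesgue. u x) = 0" if "Q \<in> null_sets lebesgue" for Q
    unfolding set_lebesgue_integral_def
  proof (rule integral_eq_zero_AE)
    show "AE x in lebesgue. indicator Q x *\<^sub>R u x = 0"
      using AE_not_in[OF that] by eventually_elim simp
  qed
  ultimately show ?thesis by (auto simp: ac_charges_def charge_on_def)
qed

text \<open>
  The slopes of a convex function decrease as the step decreases to 0.
\<close>

lemma convex_quotients_convergent: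
  fixes q :: "'a::euclidean_space \<Rightarrow> real"
  assumes q: "convex_on UNIV q" and bdd: "\<And>n. B \<le> real (Suc n) * (q (x + v /\<^sub>R real (Suc n)) - q x)"
  shows "convergent (\<lambda>n. real (Suc n) * (q (x + v /\<^sub>R real (Suc n)) - q x))"
proof -
  define s where "s n = real (Suc n) * (q (x + v /\<^sub>R real (Suc n)) - q x)" for n
  have "s (Suc n) \<le> s n" for n
  proof -
    define r where "r = real (Suc n) / real (Suc (Suc n))"
    have r: "0 \<le> r" "r \<le> 1" by (auto simp: r_def)
    have r': "real (Suc (Suc n)) * r = real (Suc n)" by (simp add: r_def)
    have "r * inverse (real (Suc n)) = inverse (real (Suc (Suc n)))" by (simp add: r_def field_simps)
    then have "(1 - r) *\<^sub>R x + r *\<^sub>R (x + v /\<^sub>R real (Suc n)) = x + v /\<^sub>R real (Suc (Suc n))"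
      by (simp add: scaleR_add_right scaleR_diff_left del: of_nat_Suc)
    then have "q (x + v /\<^sub>R real (Suc (Suc n))) \<le> (1 - r) * q x + r * q (x + v /\<^sub>R real (Suc n))"
      using convex_onD[OF q r, of x "x + v /\<^sub>R real (Suc n)"] by simp
    then have "q (x + v /\<^sub>R real (Suc (Suc n))) - q x \<le> r * (q (x + v /\<^sub>R real (Suc n)) - q x)"
      by (simp add: algebra_simps del: of_nat_Suc)
    then have "s (Suc n) \<le> real (Suc (Suc n)) * (r * (q (x + v /\<^sub>R real (Suc n)) - q x))"
      unfolding s_def by (intro mult_left_mono of_nat_0_le_iff)
    also have "\<dots> = s n" unfolding s_def mult.assoc[symmetric] r' ..
    finally show ?thesis .
  qed
  then have "decseq s" by (rule decseq_SucI)
  moreover have "\<forall>i. B \<le> s i" using bdd by (simp add: s_def)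
  ultimately obtain L where "s \<longlonglongrightarrow> L" by (rule decseq_convergent)
  then show ?thesis unfolding s_def[abs_def] by (rule convergentI)
qed

context body_and_cone
begin

definition tent :: "real \<Rightarrow> 'a \<Rightarrow> real" where "tent h x = max (h - p x) 0"

lemma extremal_charge_tent: "extremal_charge K h = (\<lambda>Q. LINT x:Q|lebesgue. tent h x)"
  by (simp add: extremal_charge_def tent_def fun_eq_iff)

lemma tent_nonneg: "0 \<le> tent h x" and tent_le: "h > 0 \<Longrightarrow> tent h x \<le> h"
  using body_norm_nonneg[of x] by (auto simp: tent_def)

lemma tent_lipschitz: "\<bar>tent h (x + w) - tent h x\<bar> \<le> p w"
  using body_norm_diff[of "x + w" x] body_norm_nonneg[of w] by (auto simp: tent_def max_def)

lemma tent_borel [measurable]: "tent h \<in> borel_measurable borel"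
  unfolding tent_def[abs_def] by measurable

lemma tent_integrable: assumes h: "h > 0" shows "integrable lebesgue (tent h)"
proof -
  obtain B where B: "B > 0" "\<And>x. norm x \<le> B * p x" by (rule norm_le_body_norm) metis
  show ?thesis
  proof (rule Bochner_Integration.integrable_bound)
    have "integrable lebesgue (indicator (cball 0 (B * h)) :: 'a \<Rightarrow> real)"
      using lmeasurable_cball lmeasurable_iff_integrable by blast
    then show "integrable lebesgue (\<lambda>x::'a. h * indicator (cball 0 (B * h)) x)" by simp
    show "tent h \<in> borel_measurable lebesgue" by (intro measurable_completion) simp
    have "norm (tent h x) \<le> norm (h * indicator (cball 0 (B * h)) x)" for x
    proof (cases "p x < h")
      case True
      then have "norm x \<le> B * h" using B(2)[of x] B(1) mult_left_mono[of "p x" h B] by linarith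
      then show ?thesis using tent_nonneg[of h x] tent_le[OF h, of x] h by simp
    next
      case False
      then show ?thesis by (simp add: tent_def)
    qed
    then show "AE x in lebesgue. norm (tent h x) \<le> norm (h * indicator (cball 0 (B * h)) x)" by simp
  qed
qed

lemma extremal_charge_ac: "h > 0 \<Longrightarrow> extremal_charge K h \<in> ac_charges C"
  unfolding extremal_charge_tent by (intro integral_mem_ac_charges C_lebesgue tent_integrable)

lemma charge_deriv_extremal:
  assumes h: "h > 0"
  shows "AE x in lebesgue. x \<in> C \<longrightarrow> charge_deriv C (extremal_charge K h) x = tent h x"
proof -
  have "AE x in lebesgue_on C. charge_deriv C (extremal_charge K h) x = tent h x"
  proof (rule density_unique_real)
    show "integrable (lebesgue_on C) (charge_deriv C (extremal_charge K h))"
      by (rule charge_deriv_works(1)[OF C_lebesgue extremal_charge_ac[OF h]])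
    have "integrable lebesgue (\<lambda>x. indicator C x *\<^sub>R tent h x)"
      using C_lebesgue tent_integrable[OF h] by (rule integrable_mult_indicator)
    then show "integrable (lebesgue_on C) (tent h)"
      using C_lebesgue integrable_restrict_space[of C lebesgue "tent h"] by simp
    fix Q assume Q: "Q \<in> sets (lebesgue_on C)"
    show "(LINT x:Q|lebesgue_on C. charge_deriv C (extremal_charge K h) x) = (LINT x:Q|lebesgue_on C. tent h x)"
      unfolding set_integral_lebesgue_on[OF C_lebesgue Q] charge_deriv_works(2)[OF C_lebesgue extremal_charge_ac[OF h] Q, symmetric]
      by (simp add: extremal_charge_tent)
  qed
  then show ?thesis unfolding AE_lebesgue_on_iff[OF C_lebesgue] .
qed

lemma convex_body_norm: "convex_on UNIV p"
proof (rule convex_onI)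
  fix t :: real and x y assume "0 < t" "t < 1"
  then show "p ((1 - t) *\<^sub>R x + t *\<^sub>R y) \<le> (1 - t) * p x + t * p y"
    using body_norm_triangle[of "(1 - t) *\<^sub>R x" "t *\<^sub>R y"] by (simp add: body_norm_scale)
qed simp

lemma convex_max_body_norm: "convex_on UNIV (\<lambda>x. max h (p x))"
proof (rule convex_onI)
  fix t :: real and x y assume t: "0 < t" "t < 1"
  have "p ((1 - t) *\<^sub>R x + t *\<^sub>R y) \<le> (1 - t) * p x + t * p y"
    using convex_onD[OF convex_body_norm, of t x y] t by simp
  also have "\<dots> \<le> (1 - t) * max h (p x) + t * max h (p y)"
    using t by (intro add_mono mult_left_mono) auto
  finally have "p ((1 - t) *\<^sub>R x + t *\<^sub>R y) \<le> (1 - t) * max h (p x) + t * max h (p y)" .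
  moreover have "(1 - t) * h + t * h \<le> (1 - t) * max h (p x) + t * max h (p y)"
    using t by (intro add_mono mult_left_mono) auto
  then have "h \<le> (1 - t) * max h (p x) + t * max h (p y)" by (simp add: algebra_simps)
  ultimately show "max h (p ((1 - t) *\<^sub>R x + t *\<^sub>R y)) \<le> (1 - t) * max h (p x) + t * max h (p y)"
    by simp
qed simp

definition tent_quotient :: "real \<Rightarrow> 'a \<Rightarrow> nat \<Rightarrow> 'a \<Rightarrow> real" where
  "tent_quotient h v n x = real (Suc n) * (tent h (x + v /\<^sub>R real (Suc n)) - tent h x)"

lemma tent_quotient_borel [measurable]: "tent_quotient h v n \<in> borel_measurable borel"
  unfolding tent_quotient_def[abs_def] by measurable

lemma body_norm_step: "real (Suc n) * p (v /\<^sub>R real (Suc n)) = p v"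
  using body_norm_scale[of "inverse (real (Suc n))" v] by (simp del: of_nat_Suc)

lemma tent_quotient_bound: "\<bar>tent_quotient h v n x\<bar> \<le> p v"
proof -
  have "\<bar>tent_quotient h v n x\<bar> \<le> real (Suc n) * p (v /\<^sub>R real (Suc n))"
    unfolding tent_quotient_def abs_mult using tent_lipschitz[of h x "v /\<^sub>R real (Suc n)"]
    by (intro mult_mono) auto
  then show ?thesis by (simp only: body_norm_step)
qed

text \<open>
  The tent is a difference of two convex functions, hence has one-sided directional derivatives
  everywhere.  They serve as its weak derivatives.
\<close>

lemma tent_quotient_convergent: "convergent (\<lambda>n. tent_quotient h v n x)"
proof -
  let ?e = "\<lambda>q n. real (Suc n) * (q (x + v /\<^sub>R real (Suc n)) - q x :: real)"
  have lower: "- p v \<le> ?e q n" if "\<And>w. \<bar>q (x + w) - q x\<bar> \<le> p w" for q :: "'a \<Rightarrow> real" and n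
  proof -
    have "real (Suc n) * (- p (v /\<^sub>R real (Suc n))) \<le> ?e q n"
      using that[of "v /\<^sub>R real (Suc n)"] by (intro mult_left_mono) (auto simp: abs_le_iff)
    then show ?thesis using body_norm_step[of n v] by (simp only: mult_minus_right)
  qed
  have "convergent (?e p)"
    using body_norm_diff[of "x + w" x for w]
    by (intro convex_quotients_convergent[OF convex_body_norm, of "- p v"] lower) simp
  moreover have "convergent (?e (\<lambda>x. max h (p x)))"
  proof (intro convex_quotients_convergent[OF convex_max_body_norm, of "- p v"] lower)
    show "\<bar>max h (p (x + w)) - max h (p x)\<bar> \<le> p w" for w
      using body_norm_diff[of "x + w" x] body_norm_nonneg[of w] by (auto simp: max_def)
  qed
  ultimately have "convergent (\<lambda>n. ?e (\<lambda>x. max h (p x)) n - ?e p n)" by (intro convergent_diff)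
  moreover have "?e (\<lambda>x. max h (p x)) n - ?e p n = tent_quotient h v n x" for n
  proof -
    have tent: "tent h y = max h (p y) - p y" for y by (simp add: tent_def max_def)
    show ?thesis unfolding tent_quotient_def tent by (simp only: right_diff_distrib)
  qed
  ultimately show ?thesis by simp
qed

text \<open>
  A translation moves the difference quotient of the test function to the tent.
\<close>

lemma tent_tested_quotients:
  assumes h: "h > 0" and \<phi>: "\<phi> \<in> test_functions C"
  shows "(\<lambda>n. \<integral>x. tent_quotient h v n x * \<phi> x \<partial>lebesgue)
    \<longlonglongrightarrow> - (\<integral>x. tent h x * frechet_derivative \<phi> (at x) v \<partial>lebesgue)"
proof -
  obtain B where B: "\<And>x. \<bar>\<phi> x\<bar> \<le> B" by (rule test_function_bounded[OF \<phi>, of 0]) metis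
  have \<phi>_borel [measurable]: "\<phi> \<in> borel_measurable borel" by (rule test_function_borel[OF \<phi>])
  define F where "F t = (\<integral>x. tent h x * \<phi> (x - t *\<^sub>R v) \<partial>lebesgue)" for t
  have "(F has_real_derivative - (\<integral>x. tent h x * frechet_derivative \<phi> (at (x - 0 *\<^sub>R v)) v \<partial>lebesgue)) (at 0)"
    unfolding F_def[abs_def] by (rule smoothing_has_real_derivative[OF tent_integrable[OF h] \<phi>])
  then have "((\<lambda>t. (F (0 + t) - F 0) / t) \<longlongrightarrow> - (\<integral>x. tent h x * frechet_derivative \<phi> (at x) v \<partial>lebesgue)) (at 0)"
    by (simp add: DERIV_def)
  moreover have "filterlim (\<lambda>n. inverse (real (Suc n))) (at 0) sequentially"
    using LIMSEQ_inverse_real_of_nat by (simp add: filterlim_at)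
  ultimately have "(\<lambda>n. (F (0 + inverse (real (Suc n))) - F 0) / inverse (real (Suc n)))
      \<longlonglongrightarrow> - (\<integral>x. tent h x * frechet_derivative \<phi> (at x) v \<partial>lebesgue)"
    by (rule filterlim_compose)
  moreover have "(F (0 + inverse (real (Suc n))) - F 0) / inverse (real (Suc n))
      = (\<integral>x. tent_quotient h v n x * \<phi> x \<partial>lebesgue)" for n
  proof -
    let ?w = "v /\<^sub>R real (Suc n)"
    have shift: "integrable lebesgue (\<lambda>x. tent h (x + ?w))"
      using lebesgue_translate(2)[OF tent_borel] tent_integrable[OF h] by simp
    have "(\<lambda>x. tent h x * \<phi> (x - ?w)) \<in> borel_measurable borel" by measurable
    from lebesgue_translate(1)[OF this, of ?w]
    have "F (inverse (real (Suc n))) = (\<integral>x. tent h (x + ?w) * \<phi> x \<partial>lebesgue)"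
      by (simp add: F_def del: of_nat_Suc)
    then have "F (inverse (real (Suc n))) - F 0
        = (\<integral>x. tent h (x + ?w) * \<phi> x \<partial>lebesgue) - (\<integral>x. tent h x * \<phi> x \<partial>lebesgue)" by (simp add: F_def)
    also have "\<dots> = (\<integral>x. tent h (x + ?w) * \<phi> x - tent h x * \<phi> x \<partial>lebesgue)"
      by (intro Bochner_Integration.integral_diff[symmetric] integrable_times_bounded[OF _ \<phi>_borel B] shift tent_integrable h)
    finally have "real (Suc n) * (F (inverse (real (Suc n))) - F 0)
        = (\<integral>x. real (Suc n) * (tent h (x + ?w) * \<phi> x - tent h x * \<phi> x) \<partial>lebesgue)" by simp
    also have "\<dots> = (\<integral>x. tent_quotient h v n x * \<phi> x \<partial>lebesgue)"
      by (simp add: tent_quotient_def algebra_simps del: of_nat_Suc)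
    finally show ?thesis by (simp add: divide_inverse mult.commute del: of_nat_Suc)
  qed
  ultimately show ?thesis by simp
qed

lemma tent_weak_partial:
  assumes h: "h > 0" and i: "i \<in> Basis"
  shows "\<exists>g\<in>Linf C. weak_partial C (tent h) i g"
proof -
  define D where "D x = lim (\<lambda>n. tent_quotient h i n x)" for x
  have lim: "(\<lambda>n. tent_quotient h i n x) \<longlonglongrightarrow> D x" for x
    unfolding D_def using tent_quotient_convergent by (simp add: convergent_LIMSEQ_iff)
  have D_borel [measurable]: "D \<in> borel_measurable borel"
    using lim by (rule borel_measurable_LIMSEQ_real) simp
  have D_bound: "\<bar>D x\<bar> \<le> p i" for x
    by (rule LIMSEQ_le_const2[OF tendsto_rabs[OF lim]]) (use tent_quotient_bound in blast)
  have "D \<in> borel_measurable lebesgue" by (intro measurable_completion) simp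
  then have D_on: "D \<in> borel_measurable (lebesgue_on C)" by (rule measurable_restrict_space1)
  then have "Linf_norm C D \<le> ennreal (p i)" using D_bound by (intro Linf_norm_le C_lebesgue) auto
  then have "D \<in> Linf C" using D_on le_less_trans[OF _ ennreal_less_top] by (auto simp: Linf_def)
  moreover have "weak_partial C (tent h) i D"
    unfolding weak_partial_def
  proof (intro conjI ballI)
    show "locally_integrable C (tent h)" by (rule integrable_imp_locally_integrable[OF tent_integrable[OF h]])
    show "locally_integrable C D"
      unfolding locally_integrable_def set_integrable_def
    proof (intro allI impI)
      fix S assume "compact S \<and> S \<subseteq> C"
      then have "integrable lebesgue (indicator S :: 'a \<Rightarrow> real)"
        using lmeasurable_compact lmeasurable_iff_integrable by blast
      from integrable_times_bounded[OF this D_borel D_bound]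
      show "integrable lebesgue (\<lambda>x. indicator S x *\<^sub>R D x)" by simp
    qed
    fix \<phi> assume \<phi>: "\<phi> \<in> test_functions C"
    obtain S where S: "compact S" "S \<subseteq> C" "\<And>x. x \<notin> S \<Longrightarrow> \<phi> x = 0"
        "\<And>x v. x \<notin> S \<Longrightarrow> frechet_derivative \<phi> (at x) v = 0"
      by (rule test_function_properties[OF \<phi>]) metis
    have off: "\<phi> x = 0" "frechet_derivative \<phi> (at x) i = 0" if "x \<notin> C" for x
      using S(2-4) that by blast+
    have [measurable]: "\<phi> \<in> borel_measurable borel" by (rule test_function_borel[OF \<phi>])
    have "locally_integrable UNIV (\<lambda>_::'a. 1)"
      by (simp add: locally_integrable_def set_integrable_def lmeasurable_iff_integrable[symmetric] lmeasurable_compact)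
    from locally_integrable_times_test[OF this S(1) _ test_function_continuous[OF \<phi>] S(3)]
    have \<phi>_int: "integrable lebesgue \<phi>" by (simp add: set_integrable_def)
    have "(\<lambda>n. \<integral>x. tent_quotient h i n x * \<phi> x \<partial>lebesgue) \<longlonglongrightarrow> (\<integral>x. D x * \<phi> x \<partial>lebesgue)"
    proof (rule integral_dominated_convergence[where w="\<lambda>x. p i * \<bar>\<phi> x\<bar>"])
      show "(\<lambda>x. D x * \<phi> x) \<in> borel_measurable lebesgue" by (intro measurable_completion) measurable
      show "(\<lambda>x. tent_quotient h i n x * \<phi> x) \<in> borel_measurable lebesgue" for n
        by (intro measurable_completion) measurable
      show "integrable lebesgue (\<lambda>x. p i * \<bar>\<phi> x\<bar>)" using \<phi>_int by simp
      show "AE x in lebesgue. (\<lambda>n. tent_quotient h i n x * \<phi> x) \<longlonglongrightarrow> D x * \<phi> x"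
        by (intro AE_I2 tendsto_mult lim tendsto_const)
      show "AE x in lebesgue. norm (tent_quotient h i n x * \<phi> x) \<le> p i * \<bar>\<phi> x\<bar>" for n
        using tent_quotient_bound by (intro AE_I2) (simp add: abs_mult mult_right_mono)
    qed
    from LIMSEQ_unique[OF this tent_tested_quotients[OF h \<phi>]]
    have "(\<integral>x. tent h x * frechet_derivative \<phi> (at x) i \<partial>lebesgue) = - (\<integral>x. D x * \<phi> x \<partial>lebesgue)" by simp
    moreover have "(LINT x:C|lebesgue. tent h x * frechet_derivative \<phi> (at x) i) = (\<integral>x. tent h x * frechet_derivative \<phi> (at x) i \<partial>lebesgue)"
      using off(2) by (rule set_integral_test_support)
    moreover have "(LINT x:C|lebesgue. D x * \<phi> x) = (\<integral>x. D x * \<phi> x \<partial>lebesgue)"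
      using off(1) by (rule set_integral_test_support)
    ultimately show "(LINT x:C|lebesgue. tent h x * frechet_derivative \<phi> (at x) i) = - (LINT x:C|lebesgue. D x * \<phi> x)"
      by simp
  qed
  ultimately show ?thesis by blast
qed

lemma charge_deriv_extremal_W1inf:
  assumes h: "h > 0" shows "charge_deriv C (extremal_charge K h) \<in> W1inf C"
proof -
  let ?f = "charge_deriv C (extremal_charge K h)"
  have f: "integrable (lebesgue_on C) ?f"
    by (rule charge_deriv_works(1)[OF C_lebesgue extremal_charge_ac[OF h]])
  have ae: "AE x in lebesgue. x \<in> C \<longrightarrow> ?f x = tent h x" by (rule charge_deriv_extremal[OF h])
  then have "AE x in lebesgue. x \<in> C \<longrightarrow> \<bar>?f x\<bar> \<le> h"
    by eventually_elim (use tent_nonneg tent_le[OF h] in auto)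
  then have "Linf_norm C ?f \<le> ennreal h"
    by (intro Linf_norm_le C_lebesgue borel_measurable_integrable f)
  then have "Linf_norm C ?f < \<infinity>" using le_less_trans[OF _ ennreal_less_top] by simp
  then have "?f \<in> Linf C" using borel_measurable_integrable[OF f] by (simp add: Linf_def)
  moreover have "locally_integrable C ?f"
    unfolding locally_integrable_def set_integrable_def
  proof (intro allI impI)
    fix S assume S: "compact S \<and> S \<subseteq> C"
    have "integrable lebesgue (\<lambda>x. indicator C x *\<^sub>R ?f x)"
      using f C_lebesgue integrable_restrict_space[of C lebesgue ?f] by simp
    moreover have "S \<in> sets lebesgue" using S by (intro fmeasurableD lmeasurable_compact) simp
    ultimately have "integrable lebesgue (\<lambda>x. indicator S x *\<^sub>R (indicator C x *\<^sub>R ?f x))"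
      by (rule integrable_mult_indicator[rotated])
    moreover have "(\<lambda>x. indicator S x *\<^sub>R (indicator C x *\<^sub>R ?f x)) = (\<lambda>x. indicator S x *\<^sub>R ?f x)"
      using S by (auto simp: fun_eq_iff indicator_def)
    ultimately show "integrable lebesgue (\<lambda>x. indicator S x *\<^sub>R ?f x)" by simp
  qed
  then have "\<exists>g\<in>Linf C. weak_partial C ?f i g" if "i \<in> Basis" for i
    using tent_weak_partial[OF h that] weak_partial_cong_AE[OF _ _ ae] by blast
  ultimately show ?thesis by (simp add: W1inf_def)
qed

text \<open>
  Testing bounds the component of the gradient in each fixed direction \<open>v\<close> by \<open>|v|\<close> almost
  everywhere.  A countable dense set of directions makes the exceptional set independent of \<open>v\<close>.
\<close>

lemma grad_norm_extremal:
  assumes h: "h > 0" shows "grad_norm K C (extremal_charge K h) \<le> 1"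
proof -
  let ?f = "charge_deriv C (extremal_charge K h)"
  let ?g = "weak_grad C ?f"
  have W: "?f \<in> W1inf C" by (rule charge_deriv_extremal_W1inf[OF h])
  have ae: "AE x in lebesgue. x \<in> C \<longrightarrow> tent h x = ?f x"
    using charge_deriv_extremal[OF h] by eventually_elim auto
  have wp: "\<forall>i\<in>Basis. weak_partial C (tent h) i (\<lambda>x. ?g x \<bullet> i)"
    using weak_grad_works[OF W] weak_partial_cong_AE[OF _ integrable_imp_locally_integrable[OF tent_integrable[OF h]] ae]
    by blast
  have dir: "AE x in lebesgue. x \<in> C \<longrightarrow> ?g x \<bullet> v \<le> p v" for v
  proof (rule AE_le_if_tested[OF open_C weak_gradient_locally_integrable(2)[OF wp]])
    fix \<phi> assume \<phi>: "\<phi> \<in> test_functions C" "\<And>x. 0 \<le> \<phi> x"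
    obtain S where S: "compact S" "S \<subseteq> C" "\<And>x. x \<notin> S \<Longrightarrow> \<phi> x = 0"
        "\<And>x v. x \<notin> S \<Longrightarrow> frechet_derivative \<phi> (at x) v = 0"
      by (rule test_function_properties[OF \<phi>(1)]) metis
    have off: "\<phi> x = 0" "frechet_derivative \<phi> (at x) v = 0" if "x \<notin> C" for x
      using S(2-4) that by blast+
    have [measurable]: "\<phi> \<in> borel_measurable borel" by (rule test_function_borel[OF \<phi>(1)])
    have "locally_integrable UNIV (\<lambda>_::'a. 1)"
      by (simp add: locally_integrable_def set_integrable_def lmeasurable_iff_integrable[symmetric] lmeasurable_compact)
    from locally_integrable_times_test[OF this S(1) _ test_function_continuous[OF \<phi>(1)] S(3)]
    have \<phi>_int: "integrable lebesgue \<phi>" by (simp add: set_integrable_def)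
    have "(LINT x:C|lebesgue. (?g x \<bullet> v) * \<phi> x) = - (LINT x:C|lebesgue. tent h x * frechet_derivative \<phi> (at x) v)"
      using weak_gradient_directional[OF wp \<phi>(1), of v] by simp
    also have "(LINT x:C|lebesgue. tent h x * frechet_derivative \<phi> (at x) v) = (\<integral>x. tent h x * frechet_derivative \<phi> (at x) v \<partial>lebesgue)"
      using off(2) by (rule set_integral_test_support)
    also have "- (\<integral>x. tent h x * frechet_derivative \<phi> (at x) v \<partial>lebesgue) \<le> p v * (\<integral>x. \<phi> x \<partial>lebesgue)"
    proof (rule LIMSEQ_le_const2[OF tent_tested_quotients[OF h \<phi>(1)]], intro exI allI impI)
      fix n
      have "(\<integral>x. tent_quotient h v n x * \<phi> x \<partial>lebesgue) \<le> (\<integral>x. p v * \<phi> x \<partial>lebesgue)"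
      proof (rule integral_mono)
        have "integrable lebesgue (\<lambda>x. \<phi> x * tent_quotient h v n x)"
          by (rule integrable_times_bounded[OF \<phi>_int tent_quotient_borel tent_quotient_bound])
        then show "integrable lebesgue (\<lambda>x. tent_quotient h v n x * \<phi> x)" by (simp add: mult.commute)
        show "integrable lebesgue (\<lambda>x. p v * \<phi> x)" using \<phi>_int by simp
        show "tent_quotient h v n x * \<phi> x \<le> p v * \<phi> x" for x
          using tent_quotient_bound[of h v n x] \<phi>(2)[of x] by (intro mult_right_mono) auto
      qed
      then show "(\<integral>x. tent_quotient h v n x * \<phi> x \<partial>lebesgue) \<le> p v * (\<integral>x. \<phi> x \<partial>lebesgue)" by simp
    qed
    also have "(\<integral>x. \<phi> x \<partial>lebesgue) = (LINT x:C|lebesgue. \<phi> x)"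
      using set_integral_test_support[of C \<phi> "\<lambda>_. 1"] off(1) by simp
    finally show "(LINT x:C|lebesgue. (?g x \<bullet> v) * \<phi> x) \<le> p v * (LINT x:C|lebesgue. \<phi> x)" .
  qed
  obtain D :: "'a set" where D: "countable D" "\<And>X. open X \<Longrightarrow> X \<noteq> {} \<Longrightarrow> \<exists>d\<in>D. d \<in> X"
    using countable_dense_exists by metis
  have "AE x in lebesgue. \<forall>v\<in>D. x \<in> C \<longrightarrow> ?g x \<bullet> v \<le> p v"
    using dir D(1) by (subst AE_ball_countable) auto
  then have "AE x in lebesgue. x \<in> C \<longrightarrow> \<bar>dual_norm K (?g x)\<bar> \<le> 1"
  proof eventually_elim
    case (elim x)
    show ?case
    proof
      assume x: "x \<in> C"
      have "v \<bullet> ?g x \<le> 1 * p v" for v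
      proof (rule ccontr)
        assume "\<not> v \<bullet> ?g x \<le> 1 * p v"
        then have "{v. p v < ?g x \<bullet> v} \<noteq> {}" by (auto simp: inner_commute not_le)
        moreover have "open {v. p v < ?g x \<bullet> v}"
          by (intro open_Collect_less continuous_on_body_norm continuous_intros)
        ultimately obtain d where "d \<in> D" "p d < ?g x \<bullet> d" using D(2) by blast
        then show False using elim x by fastforce
      qed
      then show "\<bar>dual_norm K (?g x)\<bar> \<le> 1"
        using dual_norm_le_iff[of 1 "?g x"] dual_norm_nonneg[of "?g x"] by simp
    qed
  qed
  then have "grad_norm K C (extremal_charge K h) \<le> ennreal 1"
    unfolding grad_norm_def by (intro Linf_norm_le C_lebesgue dual_norm_weak_grad_measurable W)
  then show ?thesis by simp
qed

text \<open>
  A shifted set stays inside the cone, so its charge is at most the total mass, whatever its size.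
\<close>

lemma charge_norm_extremal:
  assumes h: "h > 0"
  shows "charge_norm K C (extremal_charge K h) \<le> ennreal (m * h ^ (DIM('a) + 1) / (real DIM('a) + 1))"
  unfolding charge_norm_def charge_norm_h_def
proof (rule SUP_least)
  fix k :: real assume "k \<in> {0<..}"
  then have k: "k > 0" by simp
  have set_int: "integrable lebesgue (\<lambda>x. indicator Q x *\<^sub>R tent h x)" if "Q \<in> sets lebesgue" for Q
    using that tent_integrable[OF h] by (rule integrable_mult_indicator)
  have total: "(LINT y:C|lebesgue. tent h y) = m * h ^ (DIM('a) + 1) / (real DIM('a) + 1)"
  proof -
    have "(LINT y:C|lebesgue. tent h y) = (LINT y:sector h|lebesgue. h - p y)"
      unfolding set_lebesgue_integral_def
      by (intro Bochner_Integration.integral_cong) (auto simp: indicator_def sector_def tent_def)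
    then show ?thesis using sector_integral(2)[OF h] by simp
  qed
  have "\<bar>extremal_charge K h (shifted_set K C k x)\<bar> \<le> m * h ^ (DIM('a) + 1) / (real DIM('a) + 1)" if x: "x \<in> C" for x
  proof -
    let ?Q = "shifted_set K C k x"
    have "0 \<le> extremal_charge K h ?Q"
      unfolding extremal_charge_tent set_lebesgue_integral_def
      using tent_nonneg by (intro Bochner_Integration.integral_nonneg) simp
    moreover have "extremal_charge K h ?Q \<le> (LINT y:C|lebesgue. tent h y)"
      unfolding extremal_charge_tent set_lebesgue_integral_def
    proof (rule integral_mono[OF set_int set_int])
      show "?Q \<in> sets lebesgue" by (rule shifted_set_measurable[OF k])
      show "indicator ?Q y *\<^sub>R tent h y \<le> indicator C y *\<^sub>R tent h y" for y
        using shifted_set_subset[OF k x] tent_nonneg[of h y] by (auto simp: indicator_def)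
    qed (rule C_lebesgue)
    ultimately show ?thesis by (simp add: total)
  qed
  then show "Linf_norm C (\<lambda>x. extremal_charge K h (shifted_set K C k x)) \<le> ennreal (m * h ^ (DIM('a) + 1) / (real DIM('a) + 1))"
    by (intro Linf_norm_le C_lebesgue shifted_charge_measurable extremal_charge_ac h k) auto
qed

lemma extremal_charge_mem: "h > 0 \<Longrightarrow> extremal_charge K h \<in> charges1_K K C"
  using charge_norm_extremal[of h] extremal_charge_ac[of h] charge_deriv_extremal_W1inf[of h] le_less_trans[OF _ ennreal_less_top]
  by (auto simp: charges1_K_def charges_K_def)

text \<open>The tent exceeds any \<open>c < h\<close> on a truncated cone near the apex.\<close>

lemma charge_deriv_extremal_ge:
  assumes h: "h > 0" shows "ennreal h \<le> Linf_norm C (charge_deriv C (extremal_charge K h))"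
proof (rule ccontr)
  let ?f = "charge_deriv C (extremal_charge K h)"
  assume "\<not> ennreal h \<le> Linf_norm C ?f"
  then have less: "Linf_norm C ?f < ennreal h" by simp
  then obtain c where c: "Linf_norm C ?f = ennreal c" "c \<ge> 0"
    by (cases "Linf_norm C ?f") auto
  have ch: "c < h" using less c by (simp add: ennreal_less_iff)
  have "AE x in lebesgue. x \<in> C \<longrightarrow> \<bar>?f x\<bar> \<le> c" using c by (intro Linf_norm_AE_real C_lebesgue) auto
  then have "AE x in lebesgue. x \<notin> sector (h - c)"
    using charge_deriv_extremal[OF h]
    by eventually_elim (auto simp: sector_def tent_def)
  then have "emeasure lebesgue (sector (h - c)) = 0"
    using AE_iff_null[of lebesgue "\<lambda>x. x \<notin> sector (h - c)"] sector_borel[of "h - c"] by (simp add: null_sets_def)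
  then show False using emeasure_sector[of "h - c"] V_pos[of "h - c"] ch by simp
qed

text \<open>
  The gradient term is at most \<open>d h / (d + 1)\<close> and the charge term at most \<open>h / (d + 1)\<close>.
\<close>

lemma additive_bound_extremal:
  assumes h: "h > 0" shows "additive_bound K C h (extremal_charge K h) \<le> ennreal h"
proof -
  let ?d = "real DIM('a)"
  have "additive_bound K C h (extremal_charge K h)
      \<le> ennreal (?d * h / (?d + 1)) * 1 + ennreal (inverse (V h)) * ennreal (m * h ^ (DIM('a) + 1) / (?d + 1))"
    unfolding additive_bound_def ennreal_divide_real[OF V_pos[OF h]]
    using charge_norm_h_le[OF h] charge_norm_extremal[OF h]
    by (intro add_mono mult_left_mono grad_norm_extremal h) (auto intro: order_trans)
  also have "\<dots> = ennreal (?d * h / (?d + 1)) + ennreal (inverse (V h) * (m * h ^ (DIM('a) + 1) / (?d + 1)))"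
    using h V_pos[OF h] m_pos by (subst ennreal_mult) auto
  also have "inverse (V h) * (m * h ^ (DIM('a) + 1) / (?d + 1)) = h / (?d + 1)"
    using h m_pos by (simp add: field_simps)
  also have "ennreal (?d * h / (?d + 1)) + ennreal (h / (?d + 1)) = ennreal (?d * h / (?d + 1) + h / (?d + 1))"
    using h by (intro ennreal_plus[symmetric]) auto
  also have "?d * h / (?d + 1) + h / (?d + 1) = (?d + 1) * h / (?d + 1)"
    by (simp add: add_divide_distrib distrib_right)
  also have "\<dots> = h" by simp
  finally show ?thesis .
qed

lemma multiplicative_bound_extremal:
  assumes h: "h > 0" shows "multiplicative_bound K C (extremal_charge K h) \<le> ennreal h"
proof -
  let ?d = "real DIM('a)" and ?\<nu> = "extremal_charge K h"
  define a where "a = 1 / (?d + 1)"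
  define N where "N = m * h ^ (DIM('a) + 1) / (?d + 1)"
  have N: "N > 0" using h m_pos by (simp add: N_def)
  have G_le: "enn2real (grad_norm K C ?\<nu>) \<le> 1"
    using enn2real_mono[OF grad_norm_extremal[OF h]] by simp
  have N_le: "enn2real (charge_norm K C ?\<nu>) \<le> N"
    using enn2real_mono[OF charge_norm_extremal[OF h]] N by (simp add: N_def)
  have "((?d + 1) / m) powr a * enn2real (grad_norm K C ?\<nu>) powr (?d / (?d + 1)) * enn2real (charge_norm K C ?\<nu>) powr a
      \<le> ((?d + 1) / m) powr a * 1 * N powr a"
    using G_le N_le
    by (intro mult_mono powr_mono2 powr_le1) (auto simp: a_def)
  also have "\<dots> = ((?d + 1) / m * N) powr a"
    by (simp only: powr_mult mult_1_right)
  also have "(?d + 1) / m * N = h powr (?d + 1)"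
  proof -
    have "c / m * (m * X / c) = X" if "c \<noteq> 0" for c X :: real using m_pos that by simp
    moreover have "?d + 1 \<noteq> 0" using DIM_ge_Suc0[where ?'a='a] by linarith
    ultimately have "(?d + 1) / m * N = h ^ (DIM('a) + 1)" unfolding N_def by blast
    also have "\<dots> = h powr real (DIM('a) + 1)" using h by (rule powr_realpow[symmetric])
    finally show ?thesis by (simp add: add.commute)
  qed
  also have "(h powr (?d + 1)) powr a = h" using h by (simp add: powr_powr a_def)
  finally show ?thesis by (simp add: multiplicative_bound_def Let_def a_def ennreal_leI)
qed

end

theorem theorem3:
  fixes K C :: "'a::euclidean_space set"
  assumes "open K" "bounded K" "convex K" "\<forall>x\<in>K. - x \<in> K" "0 \<in> K"
    and "C \<noteq> {}" "open C" "convex C" "pos_cone C"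
  shows "(\<forall>h>0. \<forall>\<nu>\<in>charges1_K_h K C h.
            charge_deriv C \<nu> \<in> Linf C \<and>
            Linf_norm C (charge_deriv C \<nu>) \<le> additive_mid K C h \<nu> \<and>
            additive_mid K C h \<nu> \<le> additive_bound K C h \<nu>) \<and>
         (\<forall>\<nu>\<in>charges1_K K C.
            (\<forall>h>0. charge_deriv C \<nu> \<in> Linf C \<and>
               Linf_norm C (charge_deriv C \<nu>) \<le> additive_mid K C h \<nu> \<and>
               additive_mid K C h \<nu> \<le> additive_bound K C h \<nu>) \<and>
            Linf_norm C (charge_deriv C \<nu>) \<le> multiplicative_bound K C \<nu>) \<and>
         (\<forall>h>0. extremal_charge K h \<in> charges1_K K C \<and>
            Linf_norm C (charge_deriv C (extremal_charge K h))
              = additive_mid K C h (extremal_charge K h) \<and>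
            additive_mid K C h (extremal_charge K h)
              = additive_bound K C h (extremal_charge K h) \<and>
            Linf_norm C (charge_deriv C (extremal_charge K h))
              = multiplicative_bound K C (extremal_charge K h))"
proof -
  interpret body_and_cone K C using assms by unfold_locales auto
  have sharp: "extremal_charge K h \<in> charges1_K K C \<and>
      Linf_norm C (charge_deriv C (extremal_charge K h)) = additive_mid K C h (extremal_charge K h) \<and>
      additive_mid K C h (extremal_charge K h) = additive_bound K C h (extremal_charge K h) \<and>
      Linf_norm C (charge_deriv C (extremal_charge K h)) = multiplicative_bound K C (extremal_charge K h)"
    if h: "h > 0" for h
  proof -
    let ?\<nu> = "extremal_charge K h"
    have mem: "?\<nu> \<in> charges1_K K C" by (rule extremal_charge_mem[OF h])
    \<comment> \<open>All quantities lie between \<open>h\<close>, a lower bound for the derivative, and \<open>h\<close>, an upper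
       bound for the right-hand sides.\<close>
    note chain = charge_deriv_extremal_ge[OF h]
      additive_inequality(2,3)[OF charges1_K_imp_charges1_K_h[OF mem h] h] additive_bound_extremal[OF h]
    have "Linf_norm C (charge_deriv C ?\<nu>) = ennreal h" "additive_mid K C h ?\<nu> = ennreal h"
        "additive_bound K C h ?\<nu> = ennreal h"
      using chain by (auto intro!: antisym intro: order_trans)
    moreover have "multiplicative_bound K C ?\<nu> = ennreal h"
      using charge_deriv_extremal_ge[OF h] multiplicative_inequality[OF mem] multiplicative_bound_extremal[OF h]
      by (auto intro!: antisym intro: order_trans)
    ultimately show ?thesis using mem by simp
  qed
  show ?thesis
    using additive_inequality charges1_K_imp_charges1_K_h multiplicative_inequality sharp by blast
qed

end
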